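(* Let $\varepsilon>0$ be a fixed constant, let $p=p(n)\in[0,1]$, and suppose that $d:=p(n-1)\ge (1/2+\varepsilon)\log n$. Let $G=(V,E)\in\mathcal G(n,p)$. Then asymptotically almost surely $c(G)=O(\sqrt n)$; that is, there is a constant $K$ such that $\mathbb P\big(c(G)\le K\sqrt n\big)\to 1$ as $n\to\infty$.
   Context: $\mathcal G(n,p)$ is the binomial random graph on vertex set $\{1,\dots,n\}$ in which each pair of vertices is joined by an edge independently with probability $p$. An event holds asymptotically almost surely (a.a.s.) if its probability tends to $1$ as $n\to\infty$. $\log$ is the natural logarithm. The game of Cops and Robbers on a finite simple undirected graph $G$: $k$ cops first occupy vertices (several may share a vertex), then the robber chooses a vertex; then, alternately, the cops (each cop independently) and then the robber move, each either staying put or moving along an edge to an adjacent vertex. Both sides have full information. The cops win if at some point a cop occupies the same vertex as the robber. The cop number $c(G)$ is the minimum $k$ such that $k$ cops have a strategy guaranteeing a win. *)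

theory Defs
  imports Complex_Main
begin

(* Vertex set {1..n}; a graph is an edge set E of 2-element subsets of {1..n}. *)
definition all_pairs :: "nat \<Rightarrow> nat set set" where
  "all_pairs n = {e. \<exists>u v. u \<in> {1..n} \<and> v \<in> {1..n} \<and> u \<noteq> v \<and> e = {u, v}}"

definition gnp_prob :: "nat \<Rightarrow> real \<Rightarrow> (nat set set \<Rightarrow> bool) \<Rightarrow> real" where
  "gnp_prob n p P = (\<Sum>E \<in> {E. E \<subseteq> all_pairs n \<and> P E}.
      p ^ card E * (1 - p) ^ (card (all_pairs n) - card E))"

definition adj :: "nat set set \<Rightarrow> nat \<Rightarrow> nat \<Rightarrow> bool" where
  "adj E u v \<longleftrightarrow> {u, v} \<in> E \<and> u \<noteq> v"

definition step :: "nat set set \<Rightarrow> nat \<Rightarrow> nat \<Rightarrow> bool" where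
  "step E u v \<longleftrightarrow> v = u \<or> adj E u v"

(* cops_win E C r: cops at positions C (list), robber at r, cops to move;
   the cops can force capture in finitely many rounds. *)
inductive cops_win :: "nat set set \<Rightarrow> nat list \<Rightarrow> nat \<Rightarrow> bool" for E where
  caught: "r \<in> set C \<Longrightarrow> cops_win E C r"
| move: "list_all2 (step E) C C' \<Longrightarrow>
         (r \<in> set C' \<or> (\<forall>r'. step E r r' \<longrightarrow> cops_win E C' r')) \<Longrightarrow>
         cops_win E C r"

definition k_cops_win :: "nat \<Rightarrow> nat set set \<Rightarrow> nat \<Rightarrow> bool" where
  "k_cops_win n E k \<longleftrightarrow> (\<exists>C. length C = k \<and> set C \<subseteq> {1..n} \<and>
      (\<forall>r \<in> {1..n}. cops_win E C r))"

definition cop_number :: "nat \<Rightarrow> nat set set \<Rightarrow> nat" where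
  "cop_number n E = (LEAST k. k_cops_win n E k)"

end

theory Submission
  imports Defs "HOL-Library.FuncSet" "HOL-Library.Disjoint_Sets" "HOL-Real_Asymp.Real_Asymp"
begin

text \<open>
  Choose \<open>r\<close> with \<open>d ^ r \<le> sqrt n \<le> d ^ (r + 1)\<close> and put \<open>x = d ^ (r + 1) / sqrt n\<close>. A robber who
  starts at \<open>v\<close> is confined to the ball of radius \<open>r\<close> around \<open>v\<close> for \<open>r\<close> rounds, and this ball has
  \<open>O(sqrt n)\<close> vertices. Among \<open>O(sqrt n)\<close> randomly placed cops a set of \<open>s\<close> vertices of that ball has
  about \<open>s x\<close> cops within distance \<open>r + 1\<close>. If \<open>x\<close> is at least of order \<open>ln n\<close>, Hall's theorem sends
  distinct cops to all vertices of the ball in time. For smaller \<open>x\<close> this still works with the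
  exception of \<open>sqrt n / d\<close> vertices, and the \<open>O(sqrt n)\<close> neighbours of the exceptional vertices are
  covered by a second team that has one more round to get there. If \<open>r = 0\<close>, the first team is
  replaced by static cops that dominate all but \<open>sqrt n\<close> neighbours of each vertex. Vertices of degree
  less than \<open>\<delta> d\<close> spoil the expansion, but there are at most \<open>sqrt n\<close> of them, because
  \<open>d \<ge> (1/2 + \<epsilon>) ln n\<close>, and each can be given a cop of its own.

  The expansion up to distance \<open>r + 2\<close> needs total relative error \<open>O(1)\<close> over an unbounded number
  of layers. For all layers but the first one the failure probability \<open>exp (- c s d\<^sup>2)\<close> beats the union
  bound over all sets of size \<open>s\<close>; in the first layer small degrees are excluded by hand and sparse
  local edge counts prevent overlaps.
\<close>

section \<open>Teams of cops\<close>

text \<open>Two random choices are kept apart. The graph enters only through growth properties that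
  hold a.a.s.; in a fixed graph with these properties the cops are placed by the probabilistic
  method, with a union bound over the robber's starting vertices. Hall's condition fails for a set
  of s targets with probability about exp (- D s x), and there are as many such sets as s-subsets of
  the ball. For bounded x the sum is small only if s is at least a fixed fraction of the ball and at
  least of order ln n. Smaller sets are given up, and this creates the exceptional vertices. The
  threshold 1/2 comes from the fact that about n exp (- d) vertices have very small degree, which
  falls below sqrt n just beyond d = (ln n) / 2. Relative deviations in layer i are taken
  proportional to 2^(-i): they are summable, and the factor 4^(-i) that squaring puts into the
  Chernoff exponent is repaid by d^i, since d is at least 4.\<close>

definition nb :: "nat set set \<Rightarrow> nat set \<Rightarrow> nat set" where
  "nb E X = {u. \<exists>v\<in>X. step E v u}"

primrec ball :: "nat set set \<Rightarrow> nat set \<Rightarrow> nat \<Rightarrow> nat set" where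
  "ball E S 0 = S"
| "ball E S (Suc j) = nb E (ball E S j)"

lemma step_refl [simp]: "step E v v"
  by (simp add: step_def)

lemma step_sym: "step E u v \<longleftrightarrow> step E v u"
  by (auto simp: step_def adj_def insert_commute)

lemma subset_nb: "X \<subseteq> nb E X"
  unfolding nb_def using step_refl by blast

lemma nb_mono: "X \<subseteq> Y \<Longrightarrow> nb E X \<subseteq> nb E Y"
  by (auto simp: nb_def)

lemma ball_subset_Suc: "ball E S j \<subseteq> ball E S (Suc j)"
  by (simp add: subset_nb)

lemma ball_mono_radius: "i \<le> j \<Longrightarrow> ball E S i \<subseteq> ball E S j"
  by (rule lift_Suc_mono_le[of "ball E S"]) (rule ball_subset_Suc)

lemma ball_UN: "ball E S j = (\<Union>v\<in>S. ball E {v} j)"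
proof (induction j)
  case (Suc j)
  have "ball E S (Suc j) = nb E (\<Union>v\<in>S. ball E {v} j)" by (simp add: Suc[symmetric])
  also have "\<dots> = (\<Union>v\<in>S. ball E {v} (Suc j))" by (auto simp: nb_def)
  finally show ?case .
qed simp

lemma nb_subset:
  assumes "E \<subseteq> all_pairs n" "X \<subseteq> {1..n}"
  shows "nb E X \<subseteq> {1..n}"
proof
  fix u assume "u \<in> nb E X"
  then obtain v where v: "v \<in> X" "u = v \<or> {v, u} \<in> E" by (auto simp: nb_def step_def adj_def)
  then show "u \<in> {1..n}"
    using assms by (auto simp: all_pairs_def doubleton_eq_iff dest!: subsetD)
qed

lemma ball_subset:
  assumes "E \<subseteq> all_pairs n" "S \<subseteq> {1..n}"
  shows "ball E S j \<subseteq> {1..n}"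
  by (induction j) (use assms nb_subset in auto)

text \<open>A cop standing at \<open>f\<close> runs towards the centre, using the symmetry of
  \<open>step\<close>. The walk goes on for all times, so that the walks of many cops form one
  schedule without side conditions on lengths.\<close>

lemma walk_from_ball:
  assumes "f \<in> ball E {a} j"
  obtains g where "g 0 = f" "g j = a" "\<And>t. step E (g t) (g (Suc t))"
proof -
  have "\<exists>g. g 0 = f \<and> g j = a \<and> (\<forall>t. step E (g t) (g (Suc t)))"
    using assms
  proof (induction j arbitrary: f)
    case 0
    then show ?case by (intro exI[of _ "\<lambda>_. a"]) simp
  next
    case (Suc j)
    then obtain f' where f': "f' \<in> ball E {a} j" "step E f' f" by (auto simp: nb_def)
    from Suc.IH[OF f'(1)] obtain g
      where g: "g 0 = f'" "g j = a" "\<forall>t. step E (g t) (g (Suc t))" by blast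
    show ?case
      by (intro exI[of _ "case_nat f g"])
        (use g f' step_sym in \<open>auto simp: split: nat.splits\<close>)
  qed
  with that show ?thesis by blast
qed

section \<open>Hall's marriage theorem and its deficiency form\<close>

theorem hall_marriage:
  fixes N :: "'a \<Rightarrow> 'b set"
  assumes "finite I" "\<And>i. i \<in> I \<Longrightarrow> finite (N i)"
    and "\<And>S. S \<subseteq> I \<Longrightarrow> card S \<le> card (\<Union>i\<in>S. N i)"
  shows "\<exists>\<sigma>. inj_on \<sigma> I \<and> (\<forall>i\<in>I. \<sigma> i \<in> N i)"
  using assms
proof (induction "card I" arbitrary: I N rule: less_induct)
  case (less I N)
  note fin = less.prems(1) and finN = less.prems(2) and hall = less.prems(3)
  have finU: "finite (\<Union>i\<in>S. N i)" if "S \<subseteq> I" for S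
    using that fin finN by (meson finite_UN_I finite_subset subsetD)
  show ?case
  proof (cases "I = {}")
    case False
    \<comment> \<open>Halmos-Vaughan dichotomy. If every proper nonempty set has a surplus partner,
      one element can be matched arbitrarily without destroying Hall's condition. Otherwise a tight
      set \<open>S\<close> is matched within its own neighbourhood \<open>?M\<close>, and tightness
      gives Hall's condition for the rest after removal of \<open>?M\<close>.\<close>
    show ?thesis
    proof (cases "\<forall>S. S \<noteq> {} \<longrightarrow> S \<subset> I \<longrightarrow> card S < card (\<Union>i\<in>S. N i)")
      case True
      from False obtain i where i: "i \<in> I" by blast
      have "card {i} \<le> card (N i)" using hall[of "{i}"] i by simp
      then obtain x where x: "x \<in> N i" by fastforce
      let ?N = "\<lambda>j. N j - {x}"
      have "\<exists>\<sigma>. inj_on \<sigma> (I - {i}) \<and> (\<forall>j\<in>I - {i}. \<sigma> j \<in> ?N j)"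
      proof (rule less.hyps)
        show "card (I - {i}) < card I" using fin i by (meson card_Diff1_less)
        show "card S \<le> card (\<Union>j\<in>S. ?N j)" if S: "S \<subseteq> I - {i}" for S
        proof (cases "S = {}")
          case False
          then have "card S < card (\<Union>j\<in>S. N j)" using True S i by blast
          moreover have "(\<Union>j\<in>S. ?N j) = (\<Union>j\<in>S. N j) - {x}" by blast
          moreover have "finite (\<Union>j\<in>S. N j)" using finU S by blast
          ultimately show ?thesis
            by (cases "x \<in> (\<Union>j\<in>S. N j)") auto
        qed simp
      qed (use fin finN in auto)
      then obtain \<sigma> where \<sigma>: "inj_on \<sigma> (I - {i})" "\<forall>j\<in>I - {i}. \<sigma> j \<in> ?N j" by blast
      have "inj_on (\<sigma>(i := x)) I"
        using \<sigma> by (auto simp: inj_on_def)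
      moreover have "\<forall>j\<in>I. (\<sigma>(i := x)) j \<in> N j" using \<sigma>(2) x by auto
      ultimately show ?thesis by blast
    next
      case False
      then obtain S where S: "S \<noteq> {}" "S \<subset> I" "card (\<Union>i\<in>S. N i) \<le> card S"
        by (meson not_less)
      let ?M = "\<Union>i\<in>S. N i"
      have finS: "finite S" using S fin finite_subset by blast
      have "\<exists>\<sigma>. inj_on \<sigma> S \<and> (\<forall>j\<in>S. \<sigma> j \<in> N j)"
        by (rule less.hyps) (use S fin finN hall finS psubset_card_mono in \<open>auto simp: subset_iff psubset_eq\<close>)
      then obtain \<sigma> where \<sigma>: "inj_on \<sigma> S" "\<forall>j\<in>S. \<sigma> j \<in> N j" by blast
      have "\<exists>\<tau>. inj_on \<tau> (I - S) \<and> (\<forall>j\<in>I - S. \<tau> j \<in> N j - ?M)"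
      proof (rule less.hyps)
        show "card (I - S) < card I"
          using S fin by (metis Diff_subset card_seteq Diff_disjoint inf.absorb_iff2 inf_commute
              leI psubset_imp_subset)
        show "card T \<le> card (\<Union>j\<in>T. N j - ?M)" if T: "T \<subseteq> I - S" for T
        proof -
          have finT: "finite T" using T fin finite_subset by blast
          have TS: "T \<union> S \<subseteq> I" using T S by blast
          have "card T + card S = card (T \<union> S)"
            using T finS finT by (subst card_Un_disjoint) auto
          also have "\<dots> \<le> card (\<Union>i\<in>T \<union> S. N i)" using hall[OF TS] .
          also have "(\<Union>i\<in>T \<union> S. N i) = (\<Union>j\<in>T. N j - ?M) \<union> ?M" by blast
          also have "card \<dots> \<le> card (\<Union>j\<in>T. N j - ?M) + card ?M" by (rule card_Un_le)
          finally show ?thesis using S(3) by linarith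
        qed
      qed (use fin finN in auto)
      then obtain \<tau> where \<tau>: "inj_on \<tau> (I - S)" "\<forall>j\<in>I - S. \<tau> j \<in> N j - ?M" by blast
      let ?\<rho> = "\<lambda>i. if i \<in> S then \<sigma> i else \<tau> i"
      have "inj_on ?\<rho> I"
      proof (rule inj_onI)
        fix i j assume ij: "i \<in> I" "j \<in> I" "?\<rho> i = ?\<rho> j"
        consider "i \<in> S" "j \<in> S" | "i \<in> S" "j \<notin> S" | "i \<notin> S" "j \<in> S" | "i \<notin> S" "j \<notin> S"
          by blast
        then show "i = j"
        proof cases
          case 1 then show ?thesis using ij \<sigma>(1) by (auto dest: inj_onD)
        next
          case 2 then have "\<sigma> i \<in> ?M" "\<tau> j \<notin> ?M" using \<sigma>(2) \<tau>(2) ij(2) by blast+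
          then show ?thesis using 2 ij(3) by simp
        next
          case 3 then have "\<sigma> j \<in> ?M" "\<tau> i \<notin> ?M" using \<sigma>(2) \<tau>(2) ij(1) by blast+
          then show ?thesis using 3 ij(3) by simp
        next
          case 4 then show ?thesis using ij \<tau>(1) by (auto dest: inj_onD)
        qed
      qed
      moreover have "\<forall>i\<in>I. ?\<rho> i \<in> N i" using \<sigma>(2) \<tau>(2) by auto
      ultimately show ?thesis by blast
    qed
  qed auto
qed

corollary hall_marriage_deficiency:
  fixes N :: "'a \<Rightarrow> 'b set"
  assumes "finite I" "\<And>i. i \<in> I \<Longrightarrow> finite (N i)"
    and hall: "\<And>S. S \<subseteq> I \<Longrightarrow> u < card S \<Longrightarrow> card S \<le> card (\<Union>i\<in>S. N i)"
  obtains U \<sigma> where "U \<subseteq> I" "card U \<le> u" "inj_on \<sigma> (I - U)" "\<And>i. i \<in> I - U \<Longrightarrow> \<sigma> i \<in> N i"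
proof -
  \<comment> \<open>Add \<open>u\<close> dummy partners that everybody accepts.\<close>
  let ?N = "\<lambda>i. Inl ` N i \<union> Inr ` {..<u}"
  have "\<exists>\<sigma>. inj_on \<sigma> I \<and> (\<forall>i\<in>I. \<sigma> i \<in> ?N i)"
  proof (rule hall_marriage)
    fix S assume S: "S \<subseteq> I"
    show "card S \<le> card (\<Union>i\<in>S. ?N i)"
    proof (cases "S = {}")
      case False
      then have eq: "(\<Union>i\<in>S. ?N i) = Inl ` (\<Union>i\<in>S. N i) \<union> Inr ` {..<u}" by blast
      have "finite (\<Union>i\<in>S. N i)" using S assms(1,2) by (meson finite_UN_I finite_subset subsetD)
      then have "card (\<Union>i\<in>S. ?N i) = card (\<Union>i\<in>S. N i) + u"
        unfolding eq by (subst card_Un_disjoint) (auto simp: card_image)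
      then show ?thesis using hall[OF S] by fastforce
    qed simp
  qed (use assms in auto)
  then obtain \<tau> where \<tau>: "inj_on \<tau> I" "\<forall>i\<in>I. \<tau> i \<in> ?N i" by blast
  define U where "U = {i\<in>I. \<tau> i \<in> Inr ` {..<u}}"
  have "card U = card (\<tau> ` U)"
    using \<tau>(1) by (metis (no_types, lifting) U_def card_image inj_on_subset mem_Collect_eq subsetI)
  also have "\<dots> \<le> card (Inr ` {..<u} :: ('b + nat) set)"
    by (intro card_mono) (auto simp: U_def)
  finally have cU: "card U \<le> u" by (simp add: card_image)
  have l: "\<exists>y\<in>N i. \<tau> i = Inl y" if "i \<in> I - U" for i
    using that \<tau>(2) by (auto simp: U_def)
  have "inj_on (projl \<circ> \<tau>) (I - U)"
  proof (rule inj_onI)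
    fix i j assume ij: "i \<in> I - U" "j \<in> I - U" "(projl \<circ> \<tau>) i = (projl \<circ> \<tau>) j"
    then have "\<tau> i = \<tau> j" using l[OF ij(1)] l[OF ij(2)] by auto
    then show "i = j" using \<tau>(1) ij by (auto dest: inj_onD)
  qed
  moreover have "(projl \<circ> \<tau>) i \<in> N i" if "i \<in> I - U" for i using l[OF that] by auto
  ultimately show ?thesis using that[of U "projl \<circ> \<tau>"] cU by (auto simp: U_def)
qed

text \<open>A schedule fixed in advance: it may depend on \<open>A\<close>, hence on the robber's
  starting vertex, but it does not react to later moves. Only the positions at time \<open>j\<close>
  matter, because the robber is confined to a known set until then.\<close>

definition can_cover :: "nat set set \<Rightarrow> nat list \<Rightarrow> nat set \<Rightarrow> nat \<Rightarrow> bool" where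
  "can_cover E C A j \<longleftrightarrow> (\<exists>conf. conf 0 = C \<and>
     (\<forall>t. list_all2 (step E) (conf t) (conf (Suc t))) \<and> A \<subseteq> set (conf j))"

text \<open>\<open>\<sigma>\<close> assigns indices of cops and not vertices, so several cops on one
  vertex count separately, as they do in the random placement. Unassigned cops stay where they
  are.\<close>

lemma can_cover_matching:
  assumes inj: "inj_on \<sigma> A" and \<sigma>: "\<And>a. a \<in> A \<Longrightarrow> \<sigma> a < k \<and> f (\<sigma> a) \<in> ball E {a} j"
  shows "can_cover E (map f [0..<k]) A j"
proof -
  have "\<exists>g. \<forall>a\<in>A. g a 0 = f (\<sigma> a) \<and> g a j = a \<and> (\<forall>t. step E (g a t) (g a (Suc t)))"
    using walk_from_ball \<sigma> by (intro bchoice) metis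
  then obtain g where g: "\<And>a. a \<in> A \<Longrightarrow> g a 0 = f (\<sigma> a) \<and> g a j = a \<and> (\<forall>t. step E (g a t) (g a (Suc t)))"
    by blast
  define h where "h i = (if i \<in> \<sigma> ` A then g (inv_into A \<sigma> i) else (\<lambda>_. f i))" for i
  define conf where "conf t = map (\<lambda>i. h i t) [0..<k]" for t
  have "conf 0 = map f [0..<k]"
    using g by (auto simp: conf_def h_def inj inv_into_f_f)
  moreover have "list_all2 (step E) (conf t) (conf (Suc t))" for t
    unfolding conf_def list_all2_map1 list_all2_map2
    by (rule list_all2_refl) (use g in \<open>auto simp: h_def inj inv_into_f_f\<close>)
  moreover have "a \<in> set (conf j)" if "a \<in> A" for a
  proof -
    have "h (\<sigma> a) j = a" using g that inj by (auto simp: h_def inv_into_f_f)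
    then show ?thesis using \<sigma>[OF that] by (force simp: conf_def)
  qed
  ultimately show ?thesis unfolding can_cover_def by blast
qed

lemma can_cover_static: "can_cover E C (set C) j"
  unfolding can_cover_def by (rule exI[of _ "\<lambda>_. C"]) (auto intro: list_all2_refl)

section \<open>Strategies that confine the robber\<close>

lemma cops_win_step:
  assumes "list_all2 (step E) C C'" "r \<in> set C'"
  shows "cops_win E C r"
  using cops_win.move assms by blast

text \<open>Backward induction from time \<open>T\<close>. \<open>R t\<close> contains every
  position that an uncaught robber can have when both sides have made \<open>t\<close> moves; the
  schedule need not know where in \<open>R t\<close> the robber is.\<close>

lemma cops_win_trap:
  assumes conf: "\<And>t. list_all2 (step E) (conf t) (conf (Suc t))"
    and trap: "\<And>t r r'. t < T \<Longrightarrow> r \<in> R t \<Longrightarrow> r \<notin> set (conf (Suc t)) \<Longrightarrow> step E r r' \<Longrightarrow> r' \<in> R (Suc t)"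
    and last: "\<And>r. r \<in> R T \<Longrightarrow> cops_win E (conf T) r"
  shows "r \<in> R 0 \<Longrightarrow> cops_win E (conf 0) r"
proof -
  have "cops_win E (conf t) r" if "t \<le> T" "r \<in> R t" for t r
    using that
  proof (induction "T - t" arbitrary: t r)
    case 0
    then show ?case using last by simp
  next
    case (Suc m)
    then have "m = T - Suc t" "Suc t \<le> T" by auto
    then show ?case
      using Suc.hyps(1) Suc.prems trap[of t] conf[of t] cops_win.move[of E "conf t" "conf (Suc t)"]
      by (metis Suc_le_lessD)
  qed
  then show "r \<in> R 0 \<Longrightarrow> cops_win E (conf 0) r" by blast
qed

text \<open>The cops move before the robber, so when the first team has made \<open>Suc r\<close>
  moves the robber has made only \<open>r\<close> and is still in the ball of radius
  \<open>r\<close>. An uncaught robber then stands in \<open>U\<close>, the next move ends in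
  \<open>nb E U\<close>, and there the second team arrives one move later. \<open>C3\<close> never
  moves.\<close>

lemma cops_win_two_teams:
  assumes "can_cover E C1 A1 (Suc r)" "can_cover E C2 A2 (Suc (Suc r))"
    and 1: "ball E {v} r \<subseteq> A1 \<union> U \<union> set C3" and 2: "nb E U \<subseteq> A2 \<union> set C3"
  shows "cops_win E (C1 @ C2 @ C3) v"
proof -
  from assms obtain c1 c2 where
    c1: "c1 0 = C1" "\<And>t. list_all2 (step E) (c1 t) (c1 (Suc t))" "A1 \<subseteq> set (c1 (Suc r))" and
    c2: "c2 0 = C2" "\<And>t. list_all2 (step E) (c2 t) (c2 (Suc t))" "A2 \<subseteq> set (c2 (Suc (Suc r)))"
    unfolding can_cover_def by blast
  define conf where "conf t = c1 t @ c2 t @ C3" for t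
  define R where "R t = (if t \<le> r then ball E {v} t else nb E U)" for t
  have st: "list_all2 (step E) (conf t) (conf (Suc t))" for t
    unfolding conf_def using c1(2) c2(2) by (intro list_all2_appendI list_all2_refl) auto
  have "v \<in> R 0 \<Longrightarrow> cops_win E (conf 0) v"
  proof (rule cops_win_trap[where conf = conf and T = "Suc r" and R = R, OF st])
    fix t w w' assume a: "t < Suc r" "w \<in> R t" "w \<notin> set (conf (Suc t))" "step E w w'"
    show "w' \<in> R (Suc t)"
    proof (cases "t = r")
      case True
      then have "w \<in> U" using a c1(3) 1 by (auto simp: R_def conf_def)
      then show ?thesis using True a(4) by (auto simp: R_def nb_def)
    next
      case False
      then show ?thesis using a by (auto simp: R_def nb_def)
    qed
  next
    fix w assume "w \<in> R (Suc r)"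
    then have "w \<in> set (conf (Suc (Suc r)))" using 2 c2(3) by (auto simp: R_def conf_def)
    then show "cops_win E (conf (Suc r)) w" using st cops_win_step by blast
  qed
  then show ?thesis by (simp add: R_def conf_def c1 c2)
qed

text \<open>The dominators \<open>C2\<close> wait for one round. The robber's first move ends either
  within reach of a dominator, who steps onto that vertex, or on a vertex that the other cops occupy
  after their second move.\<close>

lemma cops_win_dominators:
  assumes "can_cover E C1 A 2"
    and 1: "\<And>w. step E v w \<Longrightarrow> w \<in> A \<union> set C3 \<union> nb E (set C2)"
  shows "cops_win E (C1 @ C2 @ C3) v"
proof -
  from assms obtain c where
    c: "c 0 = C1" "\<And>t. list_all2 (step E) (c t) (c (Suc t))" "A \<subseteq> set (c 2)"
    unfolding can_cover_def by blast
  define conf where "conf t = c t @ C2 @ C3" for t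
  have st: "list_all2 (step E) (conf t) (conf (Suc t))" for t
    unfolding conf_def using c(2) by (intro list_all2_appendI list_all2_refl) auto
  have "cops_win E (conf 1) w" if "step E v w" for w
  proof (cases "w \<in> nb E (set C2)")
    case True
    then obtain y where y: "y \<in> set C2" "step E y w" by (auto simp: nb_def)
    \<comment> \<open>All dominators on \<open>y\<close> move to \<open>w\<close> at once, which
      avoids singling out one position of the list.\<close>
    have "list_all2 (step E) C2 (map (\<lambda>z. if z = y then w else z) C2)"
      unfolding list_all2_map2 by (rule list_all2_refl) (use y in auto)
    then have "list_all2 (step E) (conf 1) (c (Suc 1) @ map (\<lambda>z. if z = y then w else z) C2 @ C3)"
      unfolding conf_def using c(2)[of 1] by (intro list_all2_appendI list_all2_refl) auto
    moreover have "w \<in> set (c (Suc 1) @ map (\<lambda>z. if z = y then w else z) C2 @ C3)"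
      using y by force
    ultimately show ?thesis by (rule cops_win_step)
  next
    case False
    then have "w \<in> set (conf (Suc 1))" using 1[OF that] c(3) by (auto simp: conf_def numeral_2_eq_2)
    then show ?thesis using st cops_win_step by blast
  qed
  then have "cops_win E (conf 0) v" using cops_win.move[OF st[of 0]] by simp
  then show ?thesis by (simp add: conf_def c)
qed

section \<open>Random placement of a team\<close>

lemma sum_Pow_power_card:
  fixes y :: real
  assumes "finite A"
  shows "(\<Sum>S\<in>Pow A. y ^ card S) = (1 + y) ^ card A"
  using assms
proof (induction A)
  case (insert a A)
  have "(\<Sum>S\<in>Pow (insert a A). y ^ card S)
      = (\<Sum>S\<in>Pow A. y ^ card S) + (\<Sum>S\<in>insert a ` Pow A. y ^ card S)"
    unfolding Pow_insert using insert by (intro sum.union_disjoint) auto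
  also have "(\<Sum>S\<in>insert a ` Pow A. y ^ card S) = (\<Sum>S\<in>Pow A. y ^ card (insert a S))"
    by (rule sum.reindex_cong[of "insert a"]) (use insert in \<open>auto simp: inj_on_def\<close>)
  also have "\<dots> = (\<Sum>S\<in>Pow A. y * y ^ card S)"
  proof (rule sum.cong)
    fix S assume "S \<in> Pow A"
    then have "finite S" "a \<notin> S" using insert finite_subset by auto
    then show "y ^ card (insert a S) = y * y ^ card S" by simp
  qed simp
  finally show ?case using insert by (simp add: sum_distrib_left[symmetric] algebra_simps)
qed simp

text \<open>Rankin's trick: each term is multiplied by \<open>exp (\<theta> * (card S - u))\<close>,
  which is at least 1, and the restriction on the size is dropped. With \<open>u = 1\<close> it also
  serves for union bounds over all nonempty vertex sets.\<close>

lemma sum_large_subsets_power_card_le: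
  fixes z \<theta> u :: real
  assumes "finite A" "0 \<le> z" "0 \<le> \<theta>"
  shows "(\<Sum>S\<in>{S\<in>Pow A. u \<le> card S}. z ^ card S) \<le> exp (- \<theta> * u + z * exp \<theta> * card A)"
proof -
  have "(\<Sum>S\<in>{S\<in>Pow A. u \<le> card S}. z ^ card S)
      \<le> (\<Sum>S\<in>{S\<in>Pow A. u \<le> card S}. exp (- \<theta> * u) * (z * exp \<theta>) ^ card S)"
  proof (rule sum_mono)
    fix S assume "S \<in> {S\<in>Pow A. u \<le> card S}"
    then have "0 \<le> \<theta> * (card S - u)" using assms by simp
    then have "1 \<le> exp (- \<theta> * u) * exp \<theta> ^ card S"
      by (simp add: exp_of_nat_mult[symmetric] exp_add[symmetric] algebra_simps)
    then have "z ^ card S * 1 \<le> z ^ card S * (exp (- \<theta> * u) * exp \<theta> ^ card S)"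
      using assms by (intro mult_left_mono) auto
    then show "z ^ card S \<le> exp (- \<theta> * u) * (z * exp \<theta>) ^ card S"
      by (simp add: power_mult_distrib algebra_simps)
  qed
  also have "\<dots> \<le> (\<Sum>S\<in>Pow A. exp (- \<theta> * u) * (z * exp \<theta>) ^ card S)"
    using assms by (intro sum_mono2) auto
  also have "\<dots> = exp (- \<theta> * u) * (1 + z * exp \<theta>) ^ card A"
    using sum_Pow_power_card[OF assms(1), of "z * exp \<theta>"] by (simp add: sum_distrib_left[symmetric])
  also have "\<dots> \<le> exp (- \<theta> * u) * exp (z * exp \<theta>) ^ card A"
    using assms by (intro mult_left_mono power_mono exp_ge_add_one_self) auto
  also have "\<dots> = exp (- \<theta> * u + z * exp \<theta> * card A)"
    by (simp add: exp_of_nat_mult[symmetric] exp_add[symmetric] algebra_simps)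
  finally show ?thesis .
qed

text \<open>Divided by \<open>real n ^ k\<close> this is an exponential moment of the number of cops
  in \<open>B\<close> when \<open>k\<close> cops are placed independently and uniformly. Each cop
  contributes a factor of at most \<open>1 - card B / (2 * n)\<close>, because
  \<open>exp (- 1) \<le> 1/2\<close>.\<close>

lemma sum_exp_neg_hits_le:
  assumes "n > 0" "B \<subseteq> {1..n}"
  shows "(\<Sum>f\<in>PiE {..<k} (\<lambda>_. {1..n}). exp (- real (card {i\<in>{..<k}. f i \<in> B})))
     \<le> real n ^ k * exp (- (k * card B / (2 * real n)))"
proof -
  have finB: "finite B" using assms(2) finite_subset by blast
  have "(\<Sum>f\<in>PiE {..<k} (\<lambda>_. {1..n}). exp (- real (card {i\<in>{..<k}. f i \<in> B})))
      = (\<Sum>f\<in>PiE {..<k} (\<lambda>_. {1..n}). \<Prod>i<k. exp (- of_bool (f i \<in> B)))"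
  proof (rule sum.cong)
    fix f
    have "(\<Sum>i<k. of_bool (f i \<in> B)) = real (card {i\<in>{..<k}. f i \<in> B})"
      by (subst sum_of_bool_eq) (auto simp: Int_def)
    then show "exp (- real (card {i\<in>{..<k}. f i \<in> B})) = (\<Prod>i<k. exp (- of_bool (f i \<in> B)))"
      by (simp add: exp_sum[symmetric] sum_negf)
  qed simp
  also have "\<dots> = (\<Prod>i<k. \<Sum>a\<in>{1..n}. exp (- of_bool (a \<in> B)))"
    by (rule prod_sum_PiE[symmetric]) auto
  also have "\<dots> = (\<Sum>a\<in>{1..n}. exp (- of_bool (a \<in> B)) :: real) ^ k" by simp
  also have "\<dots> \<le> (real n * exp (- (card B / (2 * real n)))) ^ k"
  proof (intro power_mono)
    have e: "exp (- 1 :: real) \<le> 1 / 2"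
      using exp_ge_add_one_self[of 1] by (simp add: exp_minus field_simps)
    have "(\<Sum>a\<in>{1..n}. exp (- of_bool (a \<in> B)) :: real) \<le> (\<Sum>a\<in>{1..n}. 1 - of_bool (a \<in> B) / 2)"
      by (intro sum_mono) (use e in auto)
    also have "\<dots> = n - card B / 2"
      using assms(2) by (simp add: sum_subtractf sum_divide_distrib[symmetric] sum_of_bool_eq Int_absorb1)
    also have "\<dots> = n * (1 + - (card B / (2 * real n)))" using assms by (simp add: field_simps)
    also have "\<dots> \<le> n * exp (- (card B / (2 * real n)))"
      by (intro mult_left_mono exp_ge_add_one_self) auto
    finally show "(\<Sum>a\<in>{1..n}. exp (- of_bool (a \<in> B)) :: real) \<le> n * exp (- (card B / (2 * real n)))" .
  qed (auto intro: sum_nonneg)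
  also have "\<dots> = real n ^ k * exp (- (k * card B / (2 * real n)))"
    by (simp add: power_mult_distrib exp_of_nat_mult[symmetric])
  finally show ?thesis .
qed

text \<open>The cops are placed at random: by Markov's inequality applied to \<open>exp (- X)\<close>, where \<open>X\<close> is
  the number of cops in the ball around \<open>S\<close>, Hall's condition fails for \<open>S\<close> with probability at
  most the corresponding summand below.\<close>

lemma team_exists:
  assumes "n > 0" and E: "E \<subseteq> all_pairs n" and A: "\<And>v. v \<in> {1..n} \<Longrightarrow> A v \<subseteq> {1..n}"
    and sum: "(\<Sum>v\<in>{1..n}. \<Sum>S\<in>{S\<in>Pow (A v). u < card S}.
        exp (card S - k * card (ball E S j) / (2 * real n))) < 1"
  obtains C U where "length C = k" "set C \<subseteq> {1..n}" "\<And>v. v \<in> {1..n} \<Longrightarrow> U v \<subseteq> A v"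
    "\<And>v. v \<in> {1..n} \<Longrightarrow> card (U v) \<le> u" "\<And>v. v \<in> {1..n} \<Longrightarrow> can_cover E C (A v - U v) j"
proof -
  define F where "F = PiE {..<k} (\<lambda>_. {1..n})"
  define hits where "hits f S = {i\<in>{..<k}. f i \<in> ball E S j}" for f :: "nat \<Rightarrow> nat" and S
  let ?T = "\<lambda>v. {S\<in>Pow (A v). u < card S}"
  have finF: "finite F" unfolding F_def by (intro finite_PiE) auto
  have cardF: "card F = n ^ k" unfolding F_def by (simp add: card_PiE)
  have finA: "finite (A v)" if "v \<in> {1..n}" for v using A[OF that] finite_subset by blast
  have "\<exists>f\<in>F. \<forall>v\<in>{1..n}. \<forall>S\<in>?T v. card S \<le> card (hits f S)"
  proof (rule ccontr)
    assume "\<not> ?thesis"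
    then have bad: "\<exists>v\<in>{1..n}. \<exists>S\<in>?T v. card (hits f S) < card S" if "f \<in> F" for f
      using that by (meson not_le)
    have "real n ^ k = (\<Sum>f\<in>F. 1)" by (simp add: cardF)
    also have "\<dots> \<le> (\<Sum>f\<in>F. \<Sum>v\<in>{1..n}. \<Sum>S\<in>?T v. exp (real (card S) - card (hits f S)))"
    proof (rule sum_mono)
      fix f assume "f \<in> F"
      from bad[OF this] obtain v S where v: "v \<in> {1..n}" "S \<in> ?T v" "card (hits f S) < card S" by blast
      have "1 \<le> exp (real (card S) - card (hits f S))" using v(3) by simp
      also have "\<dots> \<le> (\<Sum>S\<in>?T v. exp (real (card S) - card (hits f S)))"
        by (rule member_le_sum) (use v finA in auto)
      also have "\<dots> \<le> (\<Sum>v\<in>{1..n}. \<Sum>S\<in>?T v. exp (real (card S) - card (hits f S)))"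
        by (rule member_le_sum[where f = "\<lambda>v. \<Sum>S\<in>?T v. exp (real (card S) - card (hits f S))"])
          (use v in \<open>auto intro: sum_nonneg\<close>)
      finally show "1 \<le> (\<Sum>v\<in>{1..n}. \<Sum>S\<in>?T v. exp (real (card S) - card (hits f S)))" .
    qed
    also have "\<dots> = (\<Sum>v\<in>{1..n}. \<Sum>S\<in>?T v. exp (card S) * (\<Sum>f\<in>F. exp (- real (card (hits f S)))))"
      by (subst sum.swap, rule sum.cong[OF refl], subst sum.swap)
        (simp add: sum_distrib_left exp_diff exp_minus field_simps)
    also have "\<dots> \<le> (\<Sum>v\<in>{1..n}. \<Sum>S\<in>?T v.
        exp (card S) * (real n ^ k * exp (- (k * card (ball E S j) / (2 * real n)))))"
    proof (intro sum_mono mult_left_mono)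
      fix v S assume "v \<in> {1..n}" "S \<in> ?T v"
      then have "ball E S j \<subseteq> {1..n}" using A ball_subset[OF E] by blast
      then show "(\<Sum>f\<in>F. exp (- real (card (hits f S)))) \<le> real n ^ k * exp (- (k * card (ball E S j) / (2 * real n)))"
        unfolding F_def hits_def by (rule sum_exp_neg_hits_le[OF assms(1)])
    qed auto
    also have "\<dots> = real n ^ k * (\<Sum>v\<in>{1..n}. \<Sum>S\<in>?T v. exp (card S - k * card (ball E S j) / (2 * real n)))"
      by (simp add: sum_distrib_left diff_conv_add_uminus exp_add mult_ac del: add_uminus_conv_diff)
    also have "\<dots> < real n ^ k * 1"
      using sum assms(1) by (intro mult_strict_left_mono) auto
    finally show False by simp
  qed
  then obtain f where f: "f \<in> F" "\<And>v S. v \<in> {1..n} \<Longrightarrow> S \<in> ?T v \<Longrightarrow> card S \<le> card (hits f S)"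
    by blast
  have "\<exists>U. U \<subseteq> A v \<and> card U \<le> u \<and> can_cover E (map f [0..<k]) (A v - U) j" if v: "v \<in> {1..n}" for v
  proof -
    let ?N = "\<lambda>a. hits f {a}"
    have un: "(\<Union>a\<in>S. ?N a) = hits f S" for S
      unfolding hits_def by (subst ball_UN) blast
    obtain U \<sigma> where U: "U \<subseteq> A v" "card U \<le> u" "inj_on \<sigma> (A v - U)"
        "\<And>i. i \<in> A v - U \<Longrightarrow> \<sigma> i \<in> ?N i"
    proof (rule hall_marriage_deficiency[of "A v" ?N u])
      show "card S \<le> card (\<Union>i\<in>S. ?N i)" if "S \<subseteq> A v" "u < card S" for S
        unfolding un using f(2)[OF v, of S] that by simp
    qed (use finA[OF v] in \<open>auto simp: hits_def\<close>)
    have "can_cover E (map f [0..<k]) (A v - U) j"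
      by (rule can_cover_matching[OF U(3)]) (use U(4) in \<open>auto simp: hits_def\<close>)
    then show ?thesis using U by blast
  qed
  then obtain U where "\<And>v. v \<in> {1..n} \<Longrightarrow> U v \<subseteq> A v \<and> card (U v) \<le> u \<and> can_cover E (map f [0..<k]) (A v - U v) j"
    by metis
  moreover have "set (map f [0..<k]) \<subseteq> {1..n}" using f(1) by (auto simp: F_def PiE_def Pi_def)
  ultimately show ?thesis using that[of "map f [0..<k]" U] by simp
qed

text \<open>\<open>y\<close> is the expansion in units of \<open>sqrt n\<close>. With at least
  \<open>2 * D / c * sqrt n\<close> cops the negative term of the exponent in
  \<open>team_exists\<close> is at least \<open>D * min (card S * y) (sqrt n)\<close>. The first
  alternative gives a geometric weight \<open>z ^ card S\<close>, controlled by \<open>small\<close>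
  through the free parameter \<open>\<theta>\<close>; the second, saturated one gives
  \<open>exp (- D * sqrt n)\<close>, which by \<open>large\<close> beats the sum over all subsets of
  \<open>A v\<close>. Each contributes at most \<open>1 / (3 * n)\<close> per starting vertex, hence
  2/3 in total.\<close>

lemma team_exists_of_expansion:
  fixes a c y D \<theta> :: real
  assumes n: "n > 0" and E: "E \<subseteq> all_pairs n" and A: "\<And>v. v \<in> {1..n} \<Longrightarrow> A v \<subseteq> {1..n}"
    and a: "\<And>v. v \<in> {1..n} \<Longrightarrow> card (A v) \<le> a"
    and expand: "\<And>v S. v \<in> {1..n} \<Longrightarrow> S \<subseteq> A v \<Longrightarrow> S \<noteq> {} \<Longrightarrow>
        c * min (card S * (y * sqrt n)) n \<le> card (ball E S j)"
    and k: "2 * D * sqrt n \<le> c * k" and nn: "0 \<le> \<theta>" "0 \<le> c" "0 \<le> y" "0 \<le> D"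
    and small: "- \<theta> * (u + 1) + exp (1 - D * y + \<theta>) * a \<le> - ln (3 * n)"
    and large: "2 * a - D * sqrt n \<le> - ln (3 * n)"
  obtains C U where "length C = k" "set C \<subseteq> {1..n}" "\<And>v. v \<in> {1..n} \<Longrightarrow> U v \<subseteq> A v"
    "\<And>v. v \<in> {1..n} \<Longrightarrow> card (U v) \<le> u" "\<And>v. v \<in> {1..n} \<Longrightarrow> can_cover E C (A v - U v) j"
proof -
  define z where "z = exp (1 - D * y)"
  have n3: "exp (- ln (3 * n)) = 1 / (3 * real n)" using n by (simp add: exp_minus exp_ln field_simps)
  have inner: "(\<Sum>S\<in>{S\<in>Pow (A v). u < card S}. exp (card S - k * card (ball E S j) / (2 * real n)))
      \<le> 2 / (3 * real n)" if v: "v \<in> {1..n}" for v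
  proof -
    let ?T = "{S\<in>Pow (A v). real (u + 1) \<le> card S}"
    have fin: "finite (A v)" using A[OF v] finite_subset by blast
    have "exp (card S - k * card (ball E S j) / (2 * real n)) \<le> z ^ card S + exp 1 ^ card S * exp (- D * sqrt n)"
      if S: "S \<in> ?T" for S
    proof -
      have "S \<noteq> {}" using S by auto
      have mn: "sqrt n * min (card S * y) (sqrt n) = min (card S * (y * sqrt n)) n"
        by (simp add: min_mult_distrib_left algebra_simps)
      have sq: "sqrt n * (sqrt n * m) = n * m" for m :: real by (simp flip: mult.assoc)
      have "D * min (card S * y) (sqrt n) = (2 * D * sqrt n) * min (card S * (y * sqrt n)) n / (2 * real n)"
        using n by (simp add: mn[symmetric] sq)
      also have "\<dots> \<le> (c * k) * min (card S * (y * sqrt n)) n / (2 * real n)"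
        using k nn by (intro divide_right_mono mult_right_mono) auto
      also have "\<dots> = k * (c * min (card S * (y * sqrt n)) n) / (2 * real n)" by simp
      also have "\<dots> \<le> k * card (ball E S j) / (2 * real n)"
        using mult_left_mono[OF expand[OF v _ \<open>S \<noteq> {}\<close>], of "real k"] S
        by (intro divide_right_mono) auto
      finally have *: "D * min (card S * y) (sqrt n) \<le> k * card (ball E S j) / (2 * real n)" .
      show ?thesis
      proof (cases "card S * y \<le> sqrt n")
        case True
        then have "card S - k * card (ball E S j) / (2 * real n) \<le> card S * (1 - D * y)"
          using * by (simp add: algebra_simps)
        then have "exp (card S - k * card (ball E S j) / (2 * real n)) \<le> z ^ card S"
          unfolding z_def by (simp add: exp_of_nat_mult[symmetric])
        then show ?thesis by (smt (verit) exp_gt_zero zero_le_power mult_nonneg_nonneg)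
      next
        case False
        then have "exp (card S - k * card (ball E S j) / (2 * real n)) \<le> exp (card S - D * sqrt n)"
          using * by (simp add: min_def)
        also have "\<dots> = exp 1 ^ card S * exp (- D * sqrt n)"
          by (simp add: exp_of_nat_mult[symmetric] exp_diff exp_minus field_simps)
        finally show ?thesis by (simp add: z_def add_increasing)
      qed
    qed
    then have "(\<Sum>S\<in>?T. exp (card S - k * card (ball E S j) / (2 * real n)))
        \<le> (\<Sum>S\<in>?T. z ^ card S + exp 1 ^ card S * exp (- D * sqrt n))"
      by (rule sum_mono)
    also have "\<dots> = (\<Sum>S\<in>?T. z ^ card S) + (\<Sum>S\<in>?T. exp 1 ^ card S) * exp (- D * sqrt n)"
      by (simp add: sum.distrib sum_distrib_right)
    also have "(\<Sum>S\<in>?T. z ^ card S) \<le> exp (- \<theta> * real (u + 1) + z * exp \<theta> * card (A v))"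
      by (rule sum_large_subsets_power_card_le) (use fin nn in \<open>auto simp: z_def\<close>)
    also have "\<dots> \<le> exp (- \<theta> * (u + 1) + exp (1 - D * y + \<theta>) * a)"
      using a[OF v] by (simp add: z_def exp_add[symmetric])
    also have "\<dots> \<le> 1 / (3 * real n)" using small unfolding n3[symmetric] by (simp add: add.commute)
    also have "(\<Sum>S\<in>?T. exp 1 ^ card S) \<le> (1 + exp 1 :: real) ^ card (A v)"
      using sum_mono2[of "Pow (A v)" ?T "\<lambda>S. exp 1 ^ card S :: real"] fin
      by (auto simp: sum_Pow_power_card)
    also have "\<dots> \<le> exp 2 ^ card (A v)"
    proof (intro power_mono)
      have e: "2 \<le> exp (1 :: real)" using exp_ge_add_one_self[of "1::real"] by simp
      have "2 * exp 1 \<le> exp 1 * exp (1 :: real)" by (intro mult_right_mono e) simp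
      then have "(1 + exp 1 :: real) \<le> exp 1 * exp 1" using e by linarith
      then show "(1 + exp 1 :: real) \<le> exp 2" by (simp add: exp_add[symmetric])
    qed (simp add: add_nonneg_nonneg)
    also have "\<dots> = exp (2 * card (A v))" by (simp add: exp_of_nat_mult[symmetric] mult.commute)
    also have "\<dots> \<le> exp (2 * a)" using a[OF v] by simp
    finally have "(\<Sum>S\<in>?T. exp (card S - k * card (ball E S j) / (2 * real n)))
        \<le> 1 / (3 * real n) + exp (2 * a) * exp (- D * sqrt n)" by simp
    also have "exp (2 * a) * exp (- D * sqrt n) \<le> exp (- ln (3 * n))"
      using large by (simp add: exp_add[symmetric])
    finally have "(\<Sum>S\<in>?T. exp (card S - k * card (ball E S j) / (2 * real n))) \<le> 2 / (3 * real n)"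
      unfolding n3 by simp
    moreover have "?T = {S\<in>Pow (A v). u < card S}" by auto
    ultimately show ?thesis by simp
  qed
  have "(\<Sum>v\<in>{1..n}. \<Sum>S\<in>{S\<in>Pow (A v). u < card S}. exp (card S - k * card (ball E S j) / (2 * real n)))
      \<le> (\<Sum>v\<in>{1..n}. 2 / (3 * real n))" using inner by (rule sum_mono)
  also have "\<dots> < 1" using n by (simp add: field_simps)
  finally have S: "(\<Sum>v\<in>{1..n}. \<Sum>S\<in>{S\<in>Pow (A v). u < card S}.
        exp (card S - k * card (ball E S j) / (2 * real n))) < 1" .
  from team_exists[OF n E A S] that show ?thesis by blast
qed

section \<open>Random sets of edges\<close>

text \<open>The product Bernoulli measure as an explicit finite sum with the same weights as
  \<open>gnp_prob\<close>. The ground set is a parameter because independence is expressed by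
  splitting it.\<close>

definition expect :: "'a set \<Rightarrow> real \<Rightarrow> ('a set \<Rightarrow> real) \<Rightarrow> real" where
  "expect \<Omega> p f = (\<Sum>E\<in>Pow \<Omega>. p ^ card E * (1 - p) ^ (card \<Omega> - card E) * f E)"

abbreviation prob :: "'a set \<Rightarrow> real \<Rightarrow> ('a set \<Rightarrow> bool) \<Rightarrow> real" where
  "prob \<Omega> p P \<equiv> expect \<Omega> p (\<lambda>E. of_bool (P E))"

lemma expect_cong: "(\<And>E. E \<subseteq> \<Omega> \<Longrightarrow> f E = g E) \<Longrightarrow> expect \<Omega> p f = expect \<Omega> p g"
  unfolding expect_def by (intro sum.cong) auto

lemma expect_mono:
  assumes "0 \<le> p" "p \<le> 1" "\<And>E. E \<subseteq> \<Omega> \<Longrightarrow> f E \<le> g E"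
  shows "expect \<Omega> p f \<le> expect \<Omega> p g"
  unfolding expect_def using assms by (intro sum_mono mult_left_mono) auto

lemma expect_sum: "expect \<Omega> p (\<lambda>E. \<Sum>i\<in>I. f i E) = (\<Sum>i\<in>I. expect \<Omega> p (f i))"
  unfolding expect_def by (simp add: sum_distrib_left) (rule sum.swap)

lemma expect_cmult: "expect \<Omega> p (\<lambda>E. c * f E) = c * expect \<Omega> p f"
  unfolding expect_def by (simp add: sum_distrib_left mult_ac)

text \<open>The weights are multiplicative over disjoint ground sets. Every independence argument
  below rests on this identity.\<close>

lemma expect_Un:
  assumes "finite A" "finite B" "A \<inter> B = {}"
  shows "expect (A \<union> B) p (\<lambda>E. f (E \<inter> A) * g (E \<inter> B)) = expect A p f * expect B p g"
proof -
  let ?w = "\<lambda>\<Omega> E. p ^ card E * (1 - p) ^ (card \<Omega> - card E)"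
  have "expect A p f * expect B p g = (\<Sum>(X, Y)\<in>Pow A \<times> Pow B. (?w A X * f X) * (?w B Y * g Y))"
    unfolding expect_def by (simp add: sum_product sum.cartesian_product)
  also have "\<dots> = (\<Sum>E\<in>Pow (A \<union> B). ?w (A \<union> B) E * (f (E \<inter> A) * g (E \<inter> B)))"
  proof (rule sum.reindex_bij_witness[of _ "\<lambda>E. (E \<inter> A, E \<inter> B)" "\<lambda>(X, Y). X \<union> Y"])
    fix XY assume "XY \<in> Pow A \<times> Pow B"
    then obtain X Y where XY: "XY = (X, Y)" "X \<subseteq> A" "Y \<subseteq> B" by auto
    have fin: "finite X" "finite Y" using XY assms finite_subset by blast+
    have "X \<inter> Y = {}" using XY assms(3) by blast
    then have c: "card (X \<union> Y) = card X + card Y" "card (A \<union> B) = card A + card B"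
      using card_Un_disjoint fin assms by blast+
    have le: "card X \<le> card A" "card Y \<le> card B" using XY assms card_mono by blast+
    have i: "(X \<union> Y) \<inter> A = X" "(X \<union> Y) \<inter> B = Y" using XY assms(3) by blast+
    have "card A + card B - (card X + card Y) = (card A - card X) + (card B - card Y)" using le by simp
    then show "?w (A \<union> B) (case XY of (X, Y) \<Rightarrow> X \<union> Y) * (f ((case XY of (X, Y) \<Rightarrow> X \<union> Y) \<inter> A) *
        g ((case XY of (X, Y) \<Rightarrow> X \<union> Y) \<inter> B)) = (case XY of (X, Y) \<Rightarrow> (?w A X * f X) * (?w B Y * g Y))"
      by (simp only: XY prod.case c i power_add) (simp add: mult_ac)
  qed (use assms in auto)
  finally show ?thesis unfolding expect_def by simp
qed

lemma expect_const:
  assumes "finite \<Omega>"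
  shows "expect \<Omega> p (\<lambda>_. c) = c"
proof -
  have "expect \<Omega> p (\<lambda>_. 1) = 1" using assms
  proof (induction \<Omega>)
    case empty
    then show ?case by (simp add: expect_def)
  next
    case (insert e \<Omega>)
    have "expect {e} p (\<lambda>_. 1) = 1" by (simp add: expect_def Pow_insert)
    then show ?case
      using expect_Un[of "{e}" \<Omega> p "\<lambda>_. 1" "\<lambda>_. 1"] insert by simp
  qed
  then show ?thesis using expect_cmult[of \<Omega> p c "\<lambda>_. 1"] by simp
qed

lemma expect_restrict:
  assumes "finite \<Omega>" "A \<subseteq> \<Omega>"
  shows "expect \<Omega> p (\<lambda>E. f (E \<inter> A)) = expect A p f"
proof -
  have "A \<union> (\<Omega> - A) = \<Omega>" using assms by blast
  then show ?thesis
    using expect_Un[of A "\<Omega> - A" p f "\<lambda>_. 1"] assms finite_subset[of A \<Omega>] expect_const[of "\<Omega> - A" p 1]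
    by simp
qed

text \<open>That a function depends only on the edges in \<open>A\<close>, or only on those outside,
  is stated as invariance under intersection; this reduces the claim to
  \<open>expect_Un\<close>.\<close>

lemma expect_indep:
  assumes "finite \<Omega>" "A \<subseteq> \<Omega>"
    and f: "\<And>E. E \<subseteq> \<Omega> \<Longrightarrow> f (E \<inter> A) = f E" and g: "\<And>E. E \<subseteq> \<Omega> \<Longrightarrow> g (E \<inter> (\<Omega> - A)) = g E"
  shows "expect \<Omega> p (\<lambda>E. f E * g E) = expect \<Omega> p f * expect \<Omega> p g"
proof -
  have U: "A \<union> (\<Omega> - A) = \<Omega>" using assms by blast
  have fin: "finite A" using assms finite_subset by blast
  have "expect \<Omega> p (\<lambda>E. f E * g E) = expect (A \<union> (\<Omega> - A)) p (\<lambda>E. f (E \<inter> A) * g (E \<inter> (\<Omega> - A)))"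
    unfolding U using f g by (intro expect_cong) auto
  also have "\<dots> = expect A p f * expect (\<Omega> - A) p g"
    using assms fin by (intro expect_Un) auto
  also have "expect A p f = expect \<Omega> p (\<lambda>E. f (E \<inter> A))"
    using expect_restrict[OF assms(1,2)] by simp
  also have "expect (\<Omega> - A) p g = expect \<Omega> p (\<lambda>E. g (E \<inter> (\<Omega> - A)))"
    using expect_restrict[OF assms(1), of "\<Omega> - A"] by simp
  also have "expect \<Omega> p (\<lambda>E. f (E \<inter> A)) = expect \<Omega> p f" using f by (intro expect_cong) auto
  also have "expect \<Omega> p (\<lambda>E. g (E \<inter> (\<Omega> - A))) = expect \<Omega> p g" using g by (intro expect_cong) auto
  finally show ?thesis .
qed

lemma expect_prod_blocks:
  assumes "finite Y" "\<And>w. w \<in> Y \<Longrightarrow> finite (B w)" "disjoint_family_on B Y"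
  shows "expect (\<Union>w\<in>Y. B w) p (\<lambda>E. \<Prod>w\<in>Y. g w (E \<inter> B w)) = (\<Prod>w\<in>Y. expect (B w) p (g w))"
  using assms
proof (induction Y)
  case empty
  then show ?case by (simp add: expect_const)
next
  case (insert w Y)
  let ?U = "\<Union>w\<in>Y. B w"
  have disj: "B w \<inter> ?U = {}" using insert by (auto simp: disjoint_family_on_def)
  have "expect (B w \<union> ?U) p (\<lambda>E. \<Prod>w\<in>insert w Y. g w (E \<inter> B w))
      = expect (B w \<union> ?U) p (\<lambda>E. g w (E \<inter> B w) * (\<lambda>E. \<Prod>w\<in>Y. g w (E \<inter> B w)) (E \<inter> ?U))"
  proof (rule expect_cong)
    fix E
    have "(\<Prod>v\<in>Y. g v (E \<inter> B v)) = (\<Prod>v\<in>Y. g v (E \<inter> ?U \<inter> B v))"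
      by (intro prod.cong refl arg_cong2[where f = g]) auto
    then show "(\<Prod>w\<in>insert w Y. g w (E \<inter> B w)) = g w (E \<inter> B w) * (\<lambda>E. \<Prod>w\<in>Y. g w (E \<inter> B w)) (E \<inter> ?U)"
      using insert by simp
  qed
  also have "\<dots> = expect (B w) p (g w) * expect ?U p (\<lambda>E. \<Prod>w\<in>Y. g w (E \<inter> B w))"
    using insert disj by (intro expect_Un) auto
  finally show ?case using insert by (simp add: disjoint_family_on_insert)
qed

section \<open>Events and union bounds\<close>

lemma prob_mono:
  assumes "0 \<le> p" "p \<le> 1" "\<And>E. E \<subseteq> \<Omega> \<Longrightarrow> P E \<Longrightarrow> Q E"
  shows "prob \<Omega> p P \<le> prob \<Omega> p Q"
  using assms by (intro expect_mono) auto

lemma prob_nonneg: "0 \<le> p \<Longrightarrow> p \<le> 1 \<Longrightarrow> 0 \<le> prob \<Omega> p P"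
  unfolding expect_def by (intro sum_nonneg) auto

lemma prob_le_1: "finite \<Omega> \<Longrightarrow> 0 \<le> p \<Longrightarrow> p \<le> 1 \<Longrightarrow> prob \<Omega> p P \<le> 1"
  using expect_mono[of p \<Omega> "\<lambda>E. of_bool (P E)" "\<lambda>_. 1"] expect_const[of \<Omega> p 1] by simp

lemma expect_0 [simp]: "expect \<Omega> p (\<lambda>_. 0) = 0"
  by (simp add: expect_def)

lemma prob_compl:
  assumes "finite \<Omega>"
  shows "prob \<Omega> p (\<lambda>E. \<not> P E) = 1 - prob \<Omega> p P"
proof -
  have "expect \<Omega> p (\<lambda>E. 1) = prob \<Omega> p P + prob \<Omega> p (\<lambda>E. \<not> P E)"
    unfolding expect_def sum.distrib[symmetric] by (intro sum.cong) auto
  then show ?thesis using expect_const[OF assms, of p 1] by simp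
qed

lemma prob_union_bound:
  assumes "0 \<le> p" "p \<le> 1" "finite I"
  shows "prob \<Omega> p (\<lambda>E. \<exists>i\<in>I. P i E) \<le> (\<Sum>i\<in>I. prob \<Omega> p (P i))"
proof -
  have "prob \<Omega> p (\<lambda>E. \<exists>i\<in>I. P i E) \<le> expect \<Omega> p (\<lambda>E. \<Sum>i\<in>I. of_bool (P i E))"
  proof (rule expect_mono[OF assms(1,2)])
    fix E
    show "of_bool (\<exists>i\<in>I. P i E) \<le> (\<Sum>i\<in>I. of_bool (P i E) :: real)"
    proof (cases "\<exists>i\<in>I. P i E")
      case True
      then obtain i where i: "i \<in> I" "P i E" by blast
      have "(of_bool (P i E) :: real) \<le> (\<Sum>i\<in>I. of_bool (P i E))"
        by (rule member_le_sum) (use i assms in auto)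
      then show ?thesis using i by auto
    qed (auto intro: sum_nonneg)
  qed
  then show ?thesis by (simp add: expect_sum)
qed

lemma prob_disj_le:
  assumes "0 \<le> p" "p \<le> 1"
  shows "prob \<Omega> p (\<lambda>E. P E \<or> Q E) \<le> prob \<Omega> p P + prob \<Omega> p Q"
proof -
  have "prob \<Omega> p (\<lambda>E. P E \<or> Q E) \<le> expect \<Omega> p (\<lambda>E. of_bool (P E) + of_bool (Q E))"
    using assms by (intro expect_mono) auto
  also have "\<dots> = prob \<Omega> p P + prob \<Omega> p Q"
    by (simp add: expect_def sum.distrib[symmetric] algebra_simps)
  finally show ?thesis .
qed

lemma prob_empty:
  fixes \<Omega> :: "'a set"
  assumes "finite \<Omega>"
  shows "prob \<Omega> p (\<lambda>E. E = {}) = (1 - p) ^ card \<Omega>"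
proof -
  have "prob \<Omega> p (\<lambda>E. E = {}) = (\<Sum>E\<in>{{} :: 'a set}. p ^ card E * (1 - p) ^ (card \<Omega> - card E) * of_bool (E = {}))"
    unfolding expect_def by (intro sum.mono_neutral_right) (use assms in auto)
  then show ?thesis by simp
qed

lemma prob_nonempty:
  "finite \<Omega> \<Longrightarrow> prob \<Omega> p (\<lambda>E. E \<noteq> {}) = 1 - (1 - p) ^ card \<Omega>"
  using prob_compl[of \<Omega> p "\<lambda>E. E = {}"] prob_empty[of \<Omega> p] by simp

lemma prob_one_edge_and_none:
  assumes "finite B" "e \<notin> B"
  shows "prob (insert e B) p (\<lambda>E. e \<in> E \<and> E \<inter> B = {}) = p * (1 - p) ^ card B"
proof -
  have "prob ({e} \<union> B) p (\<lambda>E. e \<in> E \<and> E \<inter> B = {})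
      = expect ({e} \<union> B) p (\<lambda>E. of_bool (e \<in> E \<inter> {e}) * of_bool (E \<inter> B = {}))"
    by (intro expect_cong) auto
  also have "\<dots> = prob {e} p (\<lambda>E. e \<in> E) * prob B p (\<lambda>E. E = {})"
    by (rule expect_Un) (use assms in auto)
  also have "prob {e} p (\<lambda>E. e \<in> E) = p" by (simp add: expect_def Pow_insert)
  finally show ?thesis using prob_empty[OF assms(1)] by simp
qed

text \<open>The factor \<open>exp l - 1\<close> in the hypothesis on \<open>q\<close> lets one
  statement serve both tails: for \<open>l > 0\<close> it asks for an upper bound on the block
  probabilities, for \<open>l < 0\<close> for a lower one. Disjoint blocks turn the moment into a
  product, and \<open>1 + x \<le> exp x\<close> bounds each factor.\<close>

lemma expect_exp_count_le:
  assumes "finite \<Omega>" "finite Y" "disjoint_family_on B Y" "\<And>w. w \<in> Y \<Longrightarrow> B w \<subseteq> \<Omega>"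
    and p: "0 \<le> p" "p \<le> 1"
    and q: "\<And>w. w \<in> Y \<Longrightarrow> (exp l - 1) * prob (B w) p (\<phi> w) \<le> (exp l - 1) * q"
  shows "expect \<Omega> p (\<lambda>E. exp (l * card {w\<in>Y. \<phi> w (E \<inter> B w)})) \<le> exp ((exp l - 1) * q * card Y)"
proof -
  let ?g = "\<lambda>w E. exp (l * of_bool (\<phi> w E))" and ?U = "\<Union>w\<in>Y. B w"
  have finB: "finite (B w)" if "w \<in> Y" for w using assms(1,4) that finite_subset by blast
  have U: "?U \<subseteq> \<Omega>" using assms(4) by blast
  have "expect \<Omega> p (\<lambda>E. exp (l * card {w\<in>Y. \<phi> w (E \<inter> B w)}))
      = expect \<Omega> p (\<lambda>E. (\<lambda>E. \<Prod>w\<in>Y. ?g w (E \<inter> B w)) (E \<inter> ?U))"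
  proof (rule expect_cong)
    fix E
    have "l * card {w\<in>Y. \<phi> w (E \<inter> B w)} = (\<Sum>w\<in>Y. l * of_bool (\<phi> w (E \<inter> B w)))"
      using assms(2) by (simp add: sum_distrib_left[symmetric] sum_of_bool_eq Int_def)
    also have "\<dots> = (\<Sum>w\<in>Y. l * of_bool (\<phi> w (E \<inter> ?U \<inter> B w)))"
    proof (rule sum.cong)
      fix w assume "w \<in> Y"
      then have "E \<inter> ?U \<inter> B w = E \<inter> B w" by auto
      then show "l * of_bool (\<phi> w (E \<inter> B w)) = l * of_bool (\<phi> w (E \<inter> ?U \<inter> B w))" by simp
    qed simp
    finally show "exp (l * card {w\<in>Y. \<phi> w (E \<inter> B w)}) = (\<lambda>E. \<Prod>w\<in>Y. ?g w (E \<inter> B w)) (E \<inter> ?U)"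
      by (simp only: exp_sum[OF assms(2)])
  qed
  also have "\<dots> = (\<Prod>w\<in>Y. expect (B w) p (?g w))"
    by (subst expect_restrict[OF assms(1) U], rule expect_prod_blocks) (use assms finB in auto)
  also have "\<dots> \<le> (\<Prod>w\<in>Y. exp ((exp l - 1) * q))"
  proof (rule prod_mono, safe)
    fix w assume w: "w \<in> Y"
    show "0 \<le> expect (B w) p (?g w)" unfolding expect_def using p by (intro sum_nonneg) auto
    have "expect (B w) p (?g w) = expect (B w) p (\<lambda>E. 1 + (exp l - 1) * of_bool (\<phi> w E))"
      by (intro expect_cong) auto
    also have "\<dots> = expect (B w) p (\<lambda>_. 1) + (exp l - 1) * prob (B w) p (\<phi> w)"
      by (simp add: expect_cmult[symmetric]) (simp add: expect_def sum.distrib[symmetric] algebra_simps)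
    also have "\<dots> \<le> 1 + (exp l - 1) * q" using q[OF w] expect_const[OF finB[OF w]] by simp
    also have "\<dots> \<le> exp ((exp l - 1) * q)" by (rule exp_ge_add_one_self)
    finally show "expect (B w) p (?g w) \<le> exp ((exp l - 1) * q)" .
  qed
  also have "\<dots> = exp ((exp l - 1) * q * card Y)"
    by (simp add: exp_of_nat_mult[symmetric] mult_ac)
  finally show ?thesis .
qed

section \<open>Chernoff bounds\<close>

lemma markov_exp:
  assumes p: "0 \<le> p" "p \<le> 1" and "\<And>E. E \<subseteq> \<Omega> \<Longrightarrow> P E \<Longrightarrow> t \<le> f E"
  shows "prob \<Omega> p P \<le> exp (- t) * expect \<Omega> p (\<lambda>E. exp (f E))"
proof -
  have "prob \<Omega> p P \<le> expect \<Omega> p (\<lambda>E. exp (- t) * exp (f E))"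
    using p
  proof (rule expect_mono)
    fix E assume E: "E \<subseteq> \<Omega>"
    show "of_bool (P E) \<le> exp (- t) * exp (f E)"
      using assms(3)[OF E] by (cases "P E") (auto simp: exp_add[symmetric])
  qed
  then show ?thesis by (simp add: expect_cmult)
qed

text \<open>\<open>l\<close> is left free for large deviations: it is \<open>ln n / 4\<close> for
  counting edges inside small sets and 1 for undominated neighbours. \<open>chernoff_upper\<close>
  is the case \<open>l = \<eta> / 2\<close>.\<close>

lemma chernoff_upper_exp:
  fixes q \<mu> t :: real
  assumes "finite \<Omega>" "finite Y" "disjoint_family_on B Y" "\<And>w. w \<in> Y \<Longrightarrow> B w \<subseteq> \<Omega>"
    and p: "0 \<le> p" "p \<le> 1" and l: "0 \<le> l"
    and q: "\<And>w. w \<in> Y \<Longrightarrow> prob (B w) p (\<phi> w) \<le> q" and mu: "q * card Y \<le> \<mu>"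
  shows "prob \<Omega> p (\<lambda>E. t \<le> card {w\<in>Y. \<phi> w (E \<inter> B w)}) \<le> exp ((exp l - 1) * \<mu> - l * t)"
proof -
  have "prob \<Omega> p (\<lambda>E. t \<le> card {w\<in>Y. \<phi> w (E \<inter> B w)})
      \<le> exp (- (l * t)) * expect \<Omega> p (\<lambda>E. exp (l * card {w\<in>Y. \<phi> w (E \<inter> B w)}))"
    using p l by (intro markov_exp mult_left_mono) auto
  also have "\<dots> \<le> exp (- (l * t)) * exp ((exp l - 1) * q * card Y)"
    using assms by (intro mult_left_mono expect_exp_count_le) auto
  also have "\<dots> \<le> exp (- (l * t)) * exp ((exp l - 1) * \<mu>)"
    using mu l mult_left_mono[OF mu, of "exp l - 1"] by (simp add: mult.assoc)
  finally show ?thesis by (simp add: exp_add[symmetric])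
qed

lemma chernoff_lower_exp:
  fixes q \<mu> t :: real
  assumes "finite \<Omega>" "finite Y" "disjoint_family_on B Y" "\<And>w. w \<in> Y \<Longrightarrow> B w \<subseteq> \<Omega>"
    and p: "0 \<le> p" "p \<le> 1" and l: "0 \<le> l"
    and q: "\<And>w. w \<in> Y \<Longrightarrow> q \<le> prob (B w) p (\<phi> w)" and mu: "\<mu> \<le> q * card Y"
  shows "prob \<Omega> p (\<lambda>E. card {w\<in>Y. \<phi> w (E \<inter> B w)} \<le> t) \<le> exp (l * t - (1 - exp (- l)) * \<mu>)"
proof -
  have "prob \<Omega> p (\<lambda>E. card {w\<in>Y. \<phi> w (E \<inter> B w)} \<le> t)
      \<le> exp (- (- l * t)) * expect \<Omega> p (\<lambda>E. exp (- l * card {w\<in>Y. \<phi> w (E \<inter> B w)}))"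
    using p l by (intro markov_exp) (auto intro: mult_left_mono)
  also have "exp (- (- l * t)) = exp (l * t)" by simp
  also have "exp (l * t) * expect \<Omega> p (\<lambda>E. exp (- l * card {w\<in>Y. \<phi> w (E \<inter> B w)}))
      \<le> exp (l * t) * exp ((exp (- l) - 1) * q * card Y)"
  proof (rule mult_left_mono)
    show "expect \<Omega> p (\<lambda>E. exp (- l * card {w\<in>Y. \<phi> w (E \<inter> B w)})) \<le> exp ((exp (- l) - 1) * q * card Y)"
      using assms by (intro expect_exp_count_le mult_left_mono_neg) auto
  qed simp
  also have "\<dots> \<le> exp (l * t) * exp ((exp (- l) - 1) * \<mu>)"
    using l mult_left_mono_neg[OF mu, of "exp (- l) - 1"] by (simp add: mult.assoc)
  finally show ?thesis by (simp add: exp_add[symmetric] algebra_simps)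
qed

lemma chernoff_upper:
  fixes q \<mu> t :: real
  assumes "finite \<Omega>" "finite Y" "disjoint_family_on B Y" "\<And>w. w \<in> Y \<Longrightarrow> B w \<subseteq> \<Omega>"
    and "0 \<le> p" "p \<le> 1" and e: "0 \<le> \<eta>" "\<eta> \<le> 1"
    and "\<And>w. w \<in> Y \<Longrightarrow> prob (B w) p (\<phi> w) \<le> q" and mu: "q * card Y \<le> \<mu>" "0 \<le> \<mu>"
    and t: "(1 + \<eta>) * \<mu> \<le> t"
  shows "prob \<Omega> p (\<lambda>E. t \<le> card {w\<in>Y. \<phi> w (E \<inter> B w)}) \<le> exp (- (\<eta>\<^sup>2 * \<mu> / 4))"
proof -
  have "exp (\<eta> / 2) - 1 \<le> \<eta> / 2 + (\<eta> / 2)\<^sup>2" using exp_bound[of "\<eta> / 2"] e by simp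
  from mult_right_mono[OF this mu(2)]
  have "(exp (\<eta> / 2) - 1) * \<mu> \<le> (\<eta> / 2 + (\<eta> / 2)\<^sup>2) * \<mu>" .
  moreover have "\<eta> / 2 * ((1 + \<eta>) * \<mu>) \<le> \<eta> / 2 * t" using t e by (intro mult_left_mono) auto
  ultimately have "(exp (\<eta> / 2) - 1) * \<mu> - \<eta> / 2 * t \<le> - (\<eta>\<^sup>2 * \<mu> / 4)"
    by (simp add: algebra_simps power2_eq_square)
  moreover have "prob \<Omega> p (\<lambda>E. t \<le> card {w\<in>Y. \<phi> w (E \<inter> B w)}) \<le> exp ((exp (\<eta> / 2) - 1) * \<mu> - \<eta> / 2 * t)"
    using assms by (intro chernoff_upper_exp[where q = q]) auto
  ultimately show ?thesis by (meson exp_le_cancel_iff order_trans)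
qed

text \<open>\<open>exp x \<ge> 1 + x + x^2 / 2\<close>, and
  \<open>(1 + x + x^2 / 2) * (1 - x + x^2 / 2) = 1 + x^4 / 4 \<ge> 1\<close>.\<close>

lemma exp_minus_le:
  fixes x :: real
  assumes "0 \<le> x"
  shows "exp (- x) \<le> 1 - x + x\<^sup>2 / 2"
proof -
  have "0 < 1 + x + x\<^sup>2 / 2" using assms by (simp add: add_pos_nonneg)
  have "1 \<le> (1 + x + x\<^sup>2 / 2) * (1 - x + x\<^sup>2 / 2)"
    by (simp add: algebra_simps power2_eq_square) (simp flip: power2_eq_square mult.assoc)
  then have "1 / (1 + x + x\<^sup>2 / 2) \<le> 1 - x + x\<^sup>2 / 2"
    using \<open>0 < _\<close> by (simp add: field_simps)
  moreover have "exp (- x) \<le> 1 / (1 + x + x\<^sup>2 / 2)"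
    using exp_lower_Taylor_quadratic[OF assms] \<open>0 < _\<close> by (simp add: exp_minus field_simps)
  ultimately show ?thesis by linarith
qed

lemma chernoff_lower:
  fixes q \<mu> t :: real
  assumes "finite \<Omega>" "finite Y" "disjoint_family_on B Y" "\<And>w. w \<in> Y \<Longrightarrow> B w \<subseteq> \<Omega>"
    and "0 \<le> p" "p \<le> 1" and e: "0 \<le> \<eta>"
    and "\<And>w. w \<in> Y \<Longrightarrow> q \<le> prob (B w) p (\<phi> w)" and mu: "\<mu> \<le> q * card Y" "0 \<le> \<mu>"
    and t: "t \<le> (1 - \<eta>) * \<mu>"
  shows "prob \<Omega> p (\<lambda>E. card {w\<in>Y. \<phi> w (E \<inter> B w)} \<le> t) \<le> exp (- (\<eta>\<^sup>2 * \<mu> / 2))"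
proof -
  have "\<eta> - \<eta>\<^sup>2 / 2 \<le> 1 - exp (- \<eta>)" using exp_minus_le[OF e] by simp
  from mult_right_mono[OF this mu(2)]
  have "(\<eta> - \<eta>\<^sup>2 / 2) * \<mu> \<le> (1 - exp (- \<eta>)) * \<mu>" .
  moreover have "\<eta> * t \<le> \<eta> * ((1 - \<eta>) * \<mu>)" using t e by (intro mult_left_mono) auto
  ultimately have "\<eta> * t - (1 - exp (- \<eta>)) * \<mu> \<le> - (\<eta>\<^sup>2 * \<mu> / 2)"
    by (simp add: algebra_simps power2_eq_square)
  moreover have "prob \<Omega> p (\<lambda>E. card {w\<in>Y. \<phi> w (E \<inter> B w)} \<le> t) \<le> exp (\<eta> * t - (1 - exp (- \<eta>)) * \<mu>)"
    using assms by (intro chernoff_lower_exp[where q = q]) auto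
  ultimately show ?thesis by (meson exp_le_cancel_iff order_trans)
qed

section \<open>Exposing a ball layer by layer\<close>

lemma finite_all_pairs [simp]: "finite (all_pairs n)"
  by (rule finite_subset[of _ "Pow {1..n}"]) (auto simp: all_pairs_def)

lemma gnp_prob_eq_prob: "gnp_prob n p P = prob (all_pairs n) p P"
proof -
  have "prob (all_pairs n) p P = (\<Sum>E\<in>{E\<in>Pow (all_pairs n). P E}.
      p ^ card E * (1 - p) ^ (card (all_pairs n) - card E))"
    unfolding expect_def by (rule sum.mono_neutral_cong_right) auto
  then show ?thesis by (simp add: gnp_prob_def Pow_def)
qed

text \<open>The potential edges from \<open>w\<close> to \<open>Q\<close>. Stars of different
  \<open>w\<close> outside \<open>Q\<close> are disjoint, so the events that \<open>w\<close> has a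
  neighbour in \<open>Q\<close> are independent and their number obeys Chernoff bounds.\<close>

definition star_edges :: "nat set \<Rightarrow> nat \<Rightarrow> nat set set" where
  "star_edges Q w = (\<lambda>q. {q, w}) ` Q"

lemma star_edges_subset: "Q \<subseteq> {1..n} \<Longrightarrow> w \<in> {1..n} - Q \<Longrightarrow> star_edges Q w \<subseteq> all_pairs n"
  unfolding star_edges_def all_pairs_def by blast

lemma card_star_edges: "w \<notin> Q \<Longrightarrow> card (star_edges Q w) = card Q"
  unfolding star_edges_def by (intro card_image inj_onI) (auto simp: doubleton_eq_iff)

lemma disjoint_star_edges: "Y \<inter> Q = {} \<Longrightarrow> disjoint_family_on (star_edges Q) Y"
  unfolding disjoint_family_on_def star_edges_def by (auto simp: doubleton_eq_iff)

lemma nb_diff_eq: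
  assumes "E \<subseteq> all_pairs n" "Q \<subseteq> A" "A \<subseteq> {1..n}"
  shows "nb E Q - A = {w\<in>{1..n} - A. E \<inter> star_edges Q w \<noteq> {}}"
proof (intro equalityI subsetI)
  fix w assume w: "w \<in> nb E Q - A"
  then have "w \<in> {1..n}" using nb_subset[OF assms(1), of Q] assms by blast
  with w show "w \<in> {w\<in>{1..n} - A. E \<inter> star_edges Q w \<noteq> {}}"
    using assms(2) by (auto simp: nb_def step_def adj_def star_edges_def)
next
  fix w assume w: "w \<in> {w\<in>{1..n} - A. E \<inter> star_edges Q w \<noteq> {}}"
  then obtain q where "q \<in> Q" "{q, w} \<in> E" by (auto simp: star_edges_def)
  then show "w \<in> nb E Q - A" using w assms(2) by (auto simp: nb_def step_def adj_def)
qed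

section \<open>One growth step from a fixed set\<close>

lemma one_minus_power_le: "0 \<le> p \<Longrightarrow> p \<le> 1 \<Longrightarrow> 1 - (1 - p) ^ k \<le> p * k" for p :: real
  using Bernoulli_inequality[of "- p" k] by (simp add: algebra_simps)

lemma one_minus_power_ge:
  fixes p l :: real
  assumes "0 \<le> p" "p \<le> 1" "l \<le> k"
  shows "1 - exp (- (p * l)) \<le> 1 - (1 - p) ^ k"
proof -
  have "(1 - p) ^ k \<le> exp (- p) ^ k"
    using assms exp_ge_add_one_self[of "- p"] by (intro power_mono) auto
  also have "\<dots> = exp (- (p * k))" by (simp add: exp_of_nat_mult[symmetric] mult.commute)
  also have "\<dots> \<le> exp (- (p * l))" using assms by (simp add: mult_left_mono)
  finally show ?thesis by simp
qed

lemma card_nb_diff_upper: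
  fixes t l :: real
  assumes p: "0 \<le> p" "p \<le> 1" and A: "Q \<subseteq> A" "A \<subseteq> {1..n}" and l: "card Q \<le> l"
    and e: "0 \<le> \<eta>" "\<eta> \<le> 1" and t: "(1 + \<eta>) * (l * (p * (real n - 1))) \<le> t" and n: "n \<ge> 1"
  shows "prob (all_pairs n) p (\<lambda>E. t \<le> card (nb E Q - A)) \<le> exp (- (\<eta>\<^sup>2 * (l * (p * (real n - 1))) / 4))"
proof -
  let ?Y = "{1..n} - A"
  let ?q = "1 - (1 - p) ^ card Q"
  have finA: "finite A" "finite Q" using A by (meson finite_atLeastAtMost finite_subset)+
  have "prob (all_pairs n) p (\<lambda>E. t \<le> card (nb E Q - A))
      = prob (all_pairs n) p (\<lambda>E. t \<le> card {w\<in>?Y. E \<inter> star_edges Q w \<noteq> {}})"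
    by (rule expect_cong) (simp add: nb_diff_eq[OF _ A])
  also have "\<dots> \<le> exp (- (\<eta>\<^sup>2 * (l * (p * (real n - 1))) / 4))"
  proof (rule chernoff_upper[where q = ?q and \<phi> = "\<lambda>_ E. E \<noteq> {}"])
    show "disjoint_family_on (star_edges Q) ?Y" using A by (intro disjoint_star_edges) auto
    show "star_edges Q w \<subseteq> all_pairs n" if "w \<in> ?Y" for w
      using that A by (intro star_edges_subset) auto
    show "prob (star_edges Q w) p (\<lambda>E. E \<noteq> {}) \<le> ?q" if "w \<in> ?Y" for w
    proof -
      have "w \<notin> Q" using that A by blast
      moreover have "finite (star_edges Q w)" using finA by (simp add: star_edges_def)
      ultimately show ?thesis by (simp add: prob_nonempty card_star_edges)
    qed
    show "?q * card ?Y \<le> l * (p * (real n - 1))"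
    \<comment> \<open>For nonempty \<open>Q\<close> at most \<open>n - 1\<close> vertices lie
      outside \<open>A\<close>, which gives the factor \<open>n - 1\<close> and not
      \<open>n\<close>. For empty \<open>Q\<close> the set \<open>A\<close> may be empty too, but
      then \<open>?q = 0\<close>.\<close>
    proof (cases "Q = {}")
      case False
      then have "card A \<ge> 1" using A finA by (metis One_nat_def Suc_leI card_gt_0_iff subset_empty)
      moreover have "card A \<le> n" using card_mono[OF _ A(2)] by simp
      ultimately have "real (card ?Y) \<le> real n - 1" using A finA by (simp add: card_Diff_subset)
      then have "?q * card ?Y \<le> (p * card Q) * (real n - 1)"
        using p n by (intro mult_mono one_minus_power_le) auto
      also have "\<dots> \<le> (p * l) * (real n - 1)" using p l n by (intro mult_right_mono mult_left_mono) auto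
      finally show ?thesis by (simp add: mult_ac)
    qed (use p l n in auto)
  qed (use p e t n l in auto)
  finally show ?thesis .
qed

text \<open>Both sources of loss stay explicit: \<open>1 - exp (- (p * l))\<close> in place of
  \<open>p * l\<close> accounts for vertices reached several times, and \<open>n - b\<close> for
  those already inside \<open>A\<close>.\<close>

lemma card_nb_diff_lower:
  fixes t l b \<mu> :: real
  assumes p: "0 \<le> p" "p \<le> 1" and A: "Q \<subseteq> A" "A \<subseteq> {1..n}" and l: "0 \<le> l" "l \<le> card Q" and b: "card A \<le> b"
    and e: "0 \<le> \<eta>" and mu: "\<mu> \<le> (1 - exp (- (p * l))) * (n - b)" "0 \<le> \<mu>" and t: "t \<le> (1 - \<eta>) * \<mu>"
  shows "prob (all_pairs n) p (\<lambda>E. card (nb E Q - A) \<le> t) \<le> exp (- (\<eta>\<^sup>2 * \<mu> / 2))"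
proof -
  let ?Y = "{1..n} - A"
  let ?q = "1 - (1 - p) ^ card Q"
  have finA: "finite A" "finite Q" using A by (meson finite_atLeastAtMost finite_subset)+
  have "prob (all_pairs n) p (\<lambda>E. card (nb E Q - A) \<le> t)
      = prob (all_pairs n) p (\<lambda>E. card {w\<in>?Y. E \<inter> star_edges Q w \<noteq> {}} \<le> t)"
    by (rule expect_cong) (simp add: nb_diff_eq[OF _ A])
  also have "\<dots> \<le> exp (- (\<eta>\<^sup>2 * \<mu> / 2))"
  proof (rule chernoff_lower[where q = ?q and \<phi> = "\<lambda>_ E. E \<noteq> {}"])
    show "disjoint_family_on (star_edges Q) ?Y" using A by (intro disjoint_star_edges) auto
    show "star_edges Q w \<subseteq> all_pairs n" if "w \<in> ?Y" for w
      using that A by (intro star_edges_subset) auto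
    show "?q \<le> prob (star_edges Q w) p (\<lambda>E. E \<noteq> {})" if "w \<in> ?Y" for w
    proof -
      have "w \<notin> Q" using that A by blast
      moreover have "finite (star_edges Q w)" using finA by (simp add: star_edges_def)
      ultimately show ?thesis by (simp add: prob_nonempty card_star_edges)
    qed
    have "card A \<le> n" using card_mono[OF _ A(2)] by simp
    then have Y: "real (card ?Y) = real n - card A" using A finA by (simp add: card_Diff_subset)
    have "\<mu> \<le> (1 - exp (- (p * l))) * card ?Y"
      using mu(1) b p l unfolding Y by (elim order_trans) (intro mult_left_mono, auto)
    also have "\<dots> \<le> ?q * card ?Y"
      using p l by (intro mult_right_mono one_minus_power_ge) auto
    finally show "\<mu> \<le> ?q * card ?Y" .
  qed (use p e t mu in auto)
  finally show ?thesis .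
qed

text \<open>The ball of radius \<open>i - 1\<close>, with the empty set for radius -1; truncated
  subtraction would give \<open>S\<close> at \<open>i = 0\<close> and make layer 0 empty.\<close>

definition prev_ball :: "nat set set \<Rightarrow> nat set \<Rightarrow> nat \<Rightarrow> nat set" where
  "prev_ball E S i = (case i of 0 \<Rightarrow> {} | Suc k \<Rightarrow> ball E S k)"

definition layer :: "nat set set \<Rightarrow> nat set \<Rightarrow> nat \<Rightarrow> nat set" where
  "layer E S i = ball E S i - prev_ball E S i"

lemma prev_ball_subset: "prev_ball E S i \<subseteq> ball E S i"
  by (auto simp: prev_ball_def subset_nb[THEN subsetD] split: nat.splits)

text \<open>Neighbours of the previous ball are already inside the current one, so new vertices are
  reached from the last layer only.\<close>

lemma layer_Suc_eq: "layer E S (Suc i) = nb E (layer E S i) - ball E S i"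
proof -
  have "nb E (prev_ball E S i) \<subseteq> ball E S i"
    by (cases i) (auto simp: prev_ball_def nb_def)
  moreover have "nb E (ball E S i) = nb E (layer E S i) \<union> nb E (prev_ball E S i)"
    using prev_ball_subset[of E S i] by (auto simp: layer_def nb_def)
  ultimately show ?thesis by (auto simp: layer_def prev_ball_def)
qed

lemma nb_inter_touching:
  assumes "E \<subseteq> \<Omega>" "X \<subseteq> A"
  shows "nb (E \<inter> {e\<in>\<Omega>. e \<inter> A \<noteq> {}}) X = nb E X"
  using assms unfolding nb_def step_def adj_def by blast

text \<open>A step out of a ball of radius less than \<open>i\<close> uses only edges that touch the
  ball of radius \<open>i - 1\<close>; changing the others leaves all balls up to radius
  \<open>i\<close> as they are.\<close>

lemma ball_determined_by_touching:
  assumes "E \<subseteq> \<Omega>" "E' \<subseteq> \<Omega>" and eq: "E \<inter> {e\<in>\<Omega>. e \<inter> A \<noteq> {}} = E' \<inter> {e\<in>\<Omega>. e \<inter> A \<noteq> {}}"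
    and "prev_ball E S i = A"
  shows "k \<le> i \<Longrightarrow> ball E' S k = ball E S k"
proof (induction k)
  case (Suc k)
  then obtain m where m: "i = Suc m" "k \<le> m" by (cases i) auto
  then have "ball E S k \<subseteq> A" using assms(4) ball_mono_radius[of k m E S] by (simp add: prev_ball_def)
  then have "nb E' (ball E S k) = nb E (ball E S k)"
    using nb_inter_touching[OF assms(1), of "ball E S k" A] nb_inter_touching[OF assms(2), of "ball E S k" A]
    by (simp add: eq)
  then show ?case using Suc by simp
qed simp

text \<open>Revealing the ball of radius \<open>i\<close> only inspects edges that touch the ball of radius
  \<open>i - 1\<close>, while the next layer depends on the remaining edges only. Hence a bound for the
  neighbourhood of a fixed set transfers to the random layer.\<close>

lemma layer_exposure:
  assumes p: "0 \<le> p" "p \<le> 1" and S: "S \<subseteq> {1..n}" and tau: "0 \<le> \<tau>"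
    and bound: "\<And>A' A. A' \<subseteq> A \<Longrightarrow> A \<subseteq> {1..n} \<Longrightarrow> cond A' A \<Longrightarrow>
        prob (all_pairs n) p (\<lambda>E. \<psi> (card (nb E (A - A') - A))) \<le> \<tau>"
  shows "prob (all_pairs n) p (\<lambda>E. cond (prev_ball E S i) (ball E S i) \<and> \<psi> (card (layer E S (Suc i)))) \<le> \<tau>"
proof -
  let ?\<Omega> = "all_pairs n"
  define I where "I = {X\<in>Pow {1..n} \<times> Pow {1..n}. fst X \<subseteq> snd X \<and> cond (fst X) (snd X)}"
  define here where "here X E \<longleftrightarrow> prev_ball E S i = fst X \<and> ball E S i = snd X" for X and E :: "nat set set"
  define nx where "nx X E \<longleftrightarrow> \<psi> (card (nb E (snd X - fst X) - snd X))" for X and E :: "nat set set"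
  have finI: "finite I" by (simp add: I_def)
  have "prob ?\<Omega> p (\<lambda>E. cond (prev_ball E S i) (ball E S i) \<and> \<psi> (card (layer E S (Suc i))))
      \<le> prob ?\<Omega> p (\<lambda>E. \<exists>X\<in>I. here X E \<and> nx X E)"
    using p
  proof (rule prob_mono)
    fix E assume E: "E \<subseteq> ?\<Omega>" "cond (prev_ball E S i) (ball E S i) \<and> \<psi> (card (layer E S (Suc i)))"
    have "ball E S i \<subseteq> {1..n}" using ball_subset[OF E(1) S] .
    then have "(prev_ball E S i, ball E S i) \<in> I" using E(2) prev_ball_subset[of E S i] by (auto simp: I_def)
    moreover have "here (prev_ball E S i, ball E S i) E" "nx (prev_ball E S i, ball E S i) E"
      using E(2) by (auto simp: here_def nx_def layer_Suc_eq layer_def[of E S i])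
    ultimately show "\<exists>X\<in>I. here X E \<and> nx X E" by blast
  qed
  also have "\<dots> \<le> (\<Sum>X\<in>I. prob ?\<Omega> p (\<lambda>E. here X E \<and> nx X E))"
    using p finI by (rule prob_union_bound)
  also have "\<dots> \<le> (\<Sum>X\<in>I. prob ?\<Omega> p (here X) * \<tau>)"
  proof (rule sum_mono)
    fix X assume X: "X \<in> I"
    obtain A' A where A: "X = (A', A)" by (cases X)
    let ?T = "{e\<in>?\<Omega>. e \<inter> A' \<noteq> {}}"
    have "prob ?\<Omega> p (\<lambda>E. here X E \<and> nx X E) = expect ?\<Omega> p (\<lambda>E. of_bool (here X E) * of_bool (nx X E))"
      by (rule expect_cong) auto
    also have "\<dots> = prob ?\<Omega> p (here X) * prob ?\<Omega> p (nx X)"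
    proof (rule expect_indep[of _ ?T])
      fix E assume E: "E \<subseteq> ?\<Omega>"
      have E': "E \<inter> ?T \<subseteq> ?\<Omega>" using E by blast
      have eq: "E \<inter> ?T = (E \<inter> ?T) \<inter> ?T" by blast
      have "here X E'" if "here X F" and F: "F \<subseteq> ?\<Omega>" "E' \<subseteq> ?\<Omega>" "F \<inter> ?T = E' \<inter> ?T" for F E'
      proof -
        have eqb: "ball E' S k = ball F S k" if "k \<le> i" for k
          using ball_determined_by_touching[OF F, of S i k] that \<open>here X F\<close> by (simp add: here_def A)
        then have "prev_ball E' S i = prev_ball F S i" by (cases i) (simp_all add: prev_ball_def)
        then show ?thesis using \<open>here X F\<close> eqb[of i] by (simp add: here_def)
      qed
      from this[OF _ E E' eq] this[OF _ E' E eq[symmetric]]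
      have "here X (E \<inter> ?T) \<longleftrightarrow> here X E" by blast
      then show "of_bool (here X (E \<inter> ?T)) = (of_bool (here X E) :: real)" by simp
      \<comment> \<open>An edge that matters here joins \<open>A - A'\<close> to a vertex outside
        \<open>A\<close>, so it misses \<open>A'\<close>. Vertices reached by staying put lie in
        \<open>A\<close> and are removed.\<close>
      have "nb (E \<inter> (?\<Omega> - ?T)) (A - A') - A = nb E (A - A') - A"
        using E X unfolding A I_def nb_def step_def adj_def by auto
      then show "of_bool (nx X (E \<inter> (?\<Omega> - ?T))) = (of_bool (nx X E) :: real)"
        by (simp add: nx_def A)
    qed auto
    also have "\<dots> \<le> prob ?\<Omega> p (here X) * \<tau>"
      using bound[of A' A] X p prob_nonneg[OF p] unfolding nx_def A I_def
      by (intro mult_left_mono) auto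
    finally show "prob ?\<Omega> p (\<lambda>E. here X E \<and> nx X E) \<le> prob ?\<Omega> p (here X) * \<tau>" .
  qed
  \<comment> \<open>The events \<open>here X\<close> are disjoint for different \<open>X\<close>, so
    summing over exponentially many pairs costs nothing.\<close>
  also have "\<dots> = expect ?\<Omega> p (\<lambda>E. \<Sum>X\<in>I. of_bool (here X E)) * \<tau>"
    by (simp add: expect_sum sum_distrib_right)
  also have "\<dots> \<le> 1 * \<tau>"
  proof (rule mult_right_mono[OF _ tau])
    have "expect ?\<Omega> p (\<lambda>E. \<Sum>X\<in>I. of_bool (here X E)) \<le> expect ?\<Omega> p (\<lambda>E. 1)"
      using p
    proof (rule expect_mono)
      fix E
      have "(\<Sum>X\<in>I. of_bool (here X E) :: real) = card (I \<inter> {X. here X E})"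
        using finI by (simp add: sum_of_bool_eq)
      also have "\<dots> \<le> card {(prev_ball E S i, ball E S i)}"
        by (intro of_nat_mono card_mono) (auto simp: here_def)
      finally show "(\<Sum>X\<in>I. of_bool (here X E) :: real) \<le> 1" by simp
    qed
    then show "expect ?\<Omega> p (\<lambda>E. \<Sum>X\<in>I. of_bool (here X E)) \<le> 1" by (simp add: expect_const)
  qed
  finally show ?thesis by simp
qed

lemma layer_upper:
  fixes t l :: real
  assumes p: "0 \<le> p" "p \<le> 1" and S: "S \<subseteq> {1..n}" and n: "n \<ge> 1"
    and e: "0 \<le> \<eta>" "\<eta> \<le> 1" and t: "(1 + \<eta>) * (l * (p * (real n - 1))) \<le> t"
  shows "prob (all_pairs n) p (\<lambda>E. card (layer E S i) \<le> l \<and> t \<le> card (layer E S (Suc i)))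
    \<le> exp (- (\<eta>\<^sup>2 * (l * (p * (real n - 1))) / 4))"
  unfolding layer_def[of _ S i]
  by (rule layer_exposure[where cond = "\<lambda>A' A. card (A - A') \<le> l" and \<psi> = "\<lambda>k. t \<le> real k"])
    (use assms in \<open>auto intro!: card_nb_diff_upper[where l = l]\<close>)

lemma layer_lower:
  fixes t l b \<mu> :: real
  assumes p: "0 \<le> p" "p \<le> 1" and S: "S \<subseteq> {1..n}" and l: "0 \<le> l"
    and e: "0 \<le> \<eta>" and mu: "\<mu> \<le> (1 - exp (- (p * l))) * (n - b)" "0 \<le> \<mu>" and t: "t \<le> (1 - \<eta>) * \<mu>"
  shows "prob (all_pairs n) p (\<lambda>E. (l \<le> card (layer E S i) \<and> card (ball E S i) \<le> b) \<and> card (layer E S (Suc i)) \<le> t)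
    \<le> exp (- (\<eta>\<^sup>2 * \<mu> / 2))"
  unfolding layer_def[of _ S i]
  by (rule layer_exposure[where cond = "\<lambda>A' A. l \<le> card (A - A') \<and> card A \<le> b" and \<psi> = "\<lambda>k. real k \<le> t"])
    (use assms in \<open>auto intro!: card_nb_diff_lower[where l = l and b = b]\<close>)

section \<open>Growth of balls\<close>

lemma layer_0 [simp]: "layer E S 0 = S"
  by (simp add: layer_def prev_ball_def)

lemma layer_1: "layer E S (Suc 0) = nb E S - S"
  by (simp add: layer_def prev_ball_def)

lemma layer_subset_ball: "layer E S i \<subseteq> ball E S i"
  by (auto simp: layer_def)

lemma card_ball_Suc_le:
  assumes "E \<subseteq> all_pairs n" "S \<subseteq> {1..n}"
  shows "card (ball E S (Suc i)) \<le> card (ball E S i) + card (layer E S (Suc i))"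
proof -
  have "ball E S (Suc i) = ball E S i \<union> layer E S (Suc i)"
    using ball_subset_Suc[of E S i] by (auto simp: layer_def prev_ball_def)
  then show ?thesis by (metis card_Un_le)
qed

lemma finite_ball: "E \<subseteq> all_pairs n \<Longrightarrow> S \<subseteq> {1..n} \<Longrightarrow> finite (ball E S i)"
  by (meson ball_subset finite_atLeastAtMost finite_subset)

text \<open>\<open>32784 = 16 * 2049\<close>, where \<open>2049\<close> is the coefficient of the relative loss in one growth step.\<close>

definition cutoff :: real where "cutoff = 32784"

text \<open>\<open>ln_le\<close> is the lower bound (ln n) / 2 on \<open>d\<close> that drives the
  growth estimates; the surplus over it is spent on counting low-degree vertices.\<close>

locale gnp =
  fixes n :: nat and p d :: real
  assumes p: "0 \<le> p" "p \<le> 1" and n: "n \<ge> 2" and d: "d = p * (real n - 1)"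
    and d4: "4 \<le> d" and ln_le: "ln n \<le> 2 * d"
begin

abbreviation "V \<equiv> {1..n}"

lemma p_ge: "d / n \<le> p" and p_le: "p \<le> 2 * d / n"
proof -
  have "0 \<le> p * (n - 2)" using p n by simp
  then show "p \<le> 2 * d / n" using n p by (simp add: d field_simps of_nat_diff)
  show "d / n \<le> p" using n p by (simp add: d field_simps)
qed

lemma ln_pos: "0 < ln n" using n by simp

text \<open>The factor \<open>2 - 2\<^sup>-\<^sup>i\<close> leaves room for a relative deviation of \<open>2\<^sup>-\<^sup>i / 4\<close> in step \<open>i\<close>.\<close>

definition upper_bound :: "nat \<Rightarrow> real" where
  "upper_bound i = 512 * d ^ i * (2 - (1/2) ^ i)"

text \<open>One implication per step, since exposure treats one step at a time; from the one-vertex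
  layer 0 they chain to bounds on all layers. Single vertices suffice because balls around sets are
  unions.\<close>

definition controlled_growth :: "nat \<Rightarrow> nat set set \<Rightarrow> bool" where
  "controlled_growth R E \<longleftrightarrow> (\<forall>v\<in>V. \<forall>i\<le>R. card (layer E {v} i) \<le> upper_bound i \<longrightarrow>
     card (layer E {v} (Suc i)) < upper_bound (Suc i))"

lemma prob_not_controlled_growth:
  "prob (all_pairs n) p (\<lambda>E. \<not> controlled_growth R E) \<le> n * (R + 1) * exp (- 4 * ln n)"
proof -
  let ?B = "\<lambda>v i E. card (layer E {v} i) \<le> upper_bound i \<and> upper_bound (Suc i) \<le> card (layer E {v} (Suc i))"
  have "prob (all_pairs n) p (\<lambda>E. \<not> controlled_growth R E)
      \<le> prob (all_pairs n) p (\<lambda>E. \<exists>vi\<in>V \<times> {..R}. ?B (fst vi) (snd vi) E)"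
    using p by (intro prob_mono) (auto simp: controlled_growth_def not_less)
  also have "\<dots> \<le> (\<Sum>vi\<in>V \<times> {..R}. prob (all_pairs n) p (?B (fst vi) (snd vi)))"
    using p by (intro prob_union_bound) auto
  also have "\<dots> \<le> (\<Sum>vi\<in>V \<times> {..R}. exp (- 4 * ln n))"
  proof (rule sum_mono)
    fix vi assume vi: "vi \<in> V \<times> {..R}"
    define v where "v = fst vi"
    define i where "i = snd vi"
    define e where "e = (1/2 :: real) ^ i / 4"
    have q: "0 < (1/2 :: real) ^ i" "(1/2 :: real) ^ i \<le> 1" by (auto simp: power_le_one)
    have e: "0 \<le> e" "e \<le> 1" using q by (auto simp: e_def)
    have "(1 + e) * (2 - (1/2) ^ i) \<le> 2 - (1/2) ^ Suc i"
      using q by (simp add: e_def algebra_simps)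
    then have "(512 * d ^ Suc i) * ((1 + e) * (2 - (1/2) ^ i)) \<le> (512 * d ^ Suc i) * (2 - (1/2) ^ Suc i)"
      using d4 by (intro mult_left_mono) auto
    then have t: "(1 + e) * (upper_bound i * (p * (real n - 1))) \<le> upper_bound (Suc i)"
      by (simp add: upper_bound_def d[symmetric] mult_ac)
    have "prob (all_pairs n) p (?B v i) \<le> exp (- (e\<^sup>2 * (upper_bound i * (p * (real n - 1))) / 4))"
      by (rule layer_upper) (use p n e t vi in \<open>auto simp: v_def\<close>)
    \<comment> \<open>Origin of 512: with \<open>e\<^sup>2 = (1/4) ^ i / 16\<close> the Chernoff
      exponent is at least \<open>512 * d / 64 = 8 * d\<close>, and
      \<open>8 * d \<ge> 4 * ln n\<close>.\<close>
    also have "\<dots> \<le> exp (- 4 * ln n)"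
    proof -
      have "(1/4) ^ i * 4 ^ i = (1 :: real)" by (simp add: power_mult_distrib[symmetric])
      moreover have "(((1/4) ^ i / 16) * ((512 * 4 ^ i) * d)) / 4 = 8 * d * ((1/4) ^ i * 4 ^ i)" by simp
      ultimately have "8 * d = (((1/4) ^ i / 16) * ((512 * 4 ^ i) * d)) / 4" by (simp only: mult_1_right)
      also have "\<dots> \<le> ((1/4) ^ i / 16 * (upper_bound i * d)) / 4"
      proof -
        have "512 * 4 ^ i * 1 \<le> upper_bound i"
          unfolding upper_bound_def using d4 q by (intro mult_mono power_mono) auto
        then show ?thesis using d4 by (intro divide_right_mono mult_left_mono mult_right_mono) auto
      qed
      also have "(1/4) ^ i / 16 = e\<^sup>2"
        by (simp add: e_def power2_eq_square power_mult_distrib[symmetric])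
      finally show ?thesis using ln_le by (simp add: d[symmetric])
    qed
    finally show "prob (all_pairs n) p (?B (fst vi) (snd vi)) \<le> exp (- 4 * ln n)" by (simp add: v_def i_def)
  qed
  also have "\<dots> = n * (R + 1) * exp (- 4 * ln n)" by (simp add: card_cartesian_product)
  finally show ?thesis .
qed

text \<open>Each layer around a single vertex has at most \<open>1024 * d ^ i\<close> vertices; as
  \<open>d \<ge> 4\<close>, summing the layers at most doubles this. Sets follow by
  subadditivity.\<close>

lemma card_ball_le:
  assumes E: "E \<subseteq> all_pairs n" and cg: "controlled_growth R E" and S: "S \<subseteq> V" and i: "i \<le> Suc R"
  shows "card (ball E S i) \<le> 2048 * card S * d ^ i"
proof -
  have single: "card (ball E {v} i) \<le> 2048 * d ^ i" if v: "v \<in> V" for v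
  proof -
    have L: "i \<le> Suc R \<Longrightarrow> card (layer E {v} i) \<le> upper_bound i" for i
    proof (induction i)
      case (Suc i)
      then show ?case using cg v unfolding controlled_growth_def by (meson Suc_le_mono Suc_leD less_imp_le)
    qed (simp add: upper_bound_def)
    from i show ?thesis
    proof (induction i)
      case (Suc i)
      have "real (card (ball E {v} (Suc i))) \<le> card (ball E {v} i) + card (layer E {v} (Suc i))"
        using card_ball_Suc_le[OF E, of "{v}" i] v by simp
      also have "\<dots> \<le> 2048 * d ^ i + upper_bound (Suc i)" using Suc L[of "Suc i"] by simp
      also have "upper_bound (Suc i) \<le> 1024 * d ^ Suc i"
        unfolding upper_bound_def using d4 by (simp add: algebra_simps)
      also have "2048 * d ^ i \<le> 1024 * d ^ Suc i" using d4 by simp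
      finally show ?case by simp
    qed simp
  qed
  have finS: "finite S" using S finite_subset by blast
  have "card (ball E S i) \<le> (\<Sum>v\<in>S. card (ball E {v} i))"
    by (subst ball_UN) (rule card_UN_le[OF finS])
  then have "real (card (ball E S i)) \<le> (\<Sum>v\<in>S. real (card (ball E {v} i)))"
    by (metis of_nat_le_iff of_nat_sum)
  also have "\<dots> \<le> (\<Sum>v\<in>S. 2048 * d ^ i)" using single S by (intro sum_mono) auto
  finally show ?thesis by simp
qed

text \<open>The last factor decreases in step \<open>i\<close> by at least the relative deviation \<open>2\<^sup>-\<^sup>i / 4\<close> plus the
  fraction \<open>2049 s d ^ (i + 1) / n\<close> lost to vertices that are reached twice. It stays above \<open>1/8\<close> as
  long as \<open>s d ^ i \<le> n / cutoff\<close>.\<close>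

definition lower_bound :: "real \<Rightarrow> real \<Rightarrow> nat \<Rightarrow> real" where
  "lower_bound c s i = c * s * d ^ i * (1/4 + (1/2) ^ i / 2 - 4098 * (s * d ^ i / n))"

text \<open>\<open>cutoff\<close> makes the loss term at most \<open>4098 / cutoff = 1/8\<close>,
  half of the constant term 1/4.\<close>

lemma lower_bound_factor:
  assumes "0 \<le> s" "s * d ^ i \<le> n / cutoff" "1 \<le> i"
  shows "1/8 \<le> 1/4 + (1/2) ^ i / 2 - 4098 * (s * d ^ i / n)"
    and "1/4 + (1/2) ^ i / 2 - 4098 * (s * d ^ i / n) \<le> 1"
proof -
  define y where "y = s * d ^ i / n"
  have "y \<le> 1 / cutoff" using assms(2) n by (simp add: field_simps cutoff_def y_def)
  moreover have "0 \<le> y" using assms d4 by (simp add: y_def)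
  moreover have "0 \<le> (1/2 :: real) ^ i" "(1/2 :: real) ^ i \<le> 1" by (auto simp: power_le_one)
  ultimately show "1/8 \<le> 1/4 + (1/2) ^ i / 2 - 4098 * (s * d ^ i / n)"
    and "1/4 + (1/2) ^ i / 2 - 4098 * (s * d ^ i / n) \<le> 1" unfolding y_def[symmetric] cutoff_def by linarith+
qed

lemma lower_bound_ge:
  assumes "0 \<le> c" "0 \<le> s" "s * d ^ i \<le> n / cutoff" "1 \<le> i"
  shows "c * s * d ^ i / 8 \<le> lower_bound c s i"
  unfolding lower_bound_def using mult_left_mono[OF lower_bound_factor(1)[OF assms(2-4)], of "c * s * d ^ i"] assms d4
  by simp

lemma lower_bound_le:
  assumes "0 \<le> c" "c \<le> 1" "0 \<le> s" "s * d ^ i \<le> n / cutoff" "1 \<le> i"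
  shows "lower_bound c s i \<le> s * d ^ i"
proof -
  have "lower_bound c s i \<le> c * s * d ^ i * 1"
    unfolding lower_bound_def using lower_bound_factor(2)[OF assms(3-5)] assms d4 by (intro mult_left_mono) auto
  also have "\<dots> \<le> 1 * (s * d ^ i)" using mult_right_mono[OF assms(2), of "s * d ^ i"] assms d4 by (simp add: mult_ac)
  finally show ?thesis by simp
qed

text \<open>The mean of the next layer is of order c s d^(i+1) and the relative deviation is
  2^(-i)/4, so the exponent is of order c s d (d/4)^i. For \<open>i \<ge> 1\<close> this contains d
  at least twice and is at least c s (ln n)^2 / 8192, which exceeds 4 s ln n by
  \<open>large\<close>. With \<open>i = 0\<close> only one factor d would remain, too little when d
  is about (ln n) / 2.\<close>

lemma lower_step:
  fixes c s :: real
  assumes S: "S \<subseteq> V" "S \<noteq> {}" and s: "s = real (card S)" and c: "0 < c" "c \<le> 1" and i: "1 \<le> i"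
    and le: "s * d ^ Suc i \<le> n / cutoff" and large: "32768 \<le> c * ln n"
  shows "prob (all_pairs n) p (\<lambda>E. (lower_bound c s i \<le> card (layer E S i) \<and> card (ball E S i) \<le> 2048 * s * d ^ i)
      \<and> card (layer E S (Suc i)) \<le> lower_bound c s (Suc i)) \<le> exp (- 4 * s * ln n)"
proof -
  have s1: "1 \<le> s" using S finite_subset[OF S(1)] by (simp add: s Suc_leI card_gt_0_iff)
  define X where "X = s * d ^ Suc i / n"
  define h where "h = 1/4 + (1/2) ^ i / 2 - 4098 * (s * d ^ i / n)"
  define l where "l = lower_bound c s i"
  define e where "e = (1/2 :: real) ^ i / 4"
  define \<mu> where "\<mu> = d * l * (1 - 2049 * X)"
  have q: "0 < (1/2 :: real) ^ i" "(1/2 :: real) ^ i \<le> 1" by (auto simp: power_le_one)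
  have mono: "s * d ^ i \<le> s * d ^ Suc i" using s1 d4 by simp
  then have le': "s * d ^ i \<le> n / cutoff" using le by linarith
  have X: "0 \<le> X" "X \<le> 1 / cutoff" using le s1 d4 n by (simp_all add: X_def field_simps cutoff_def)
  have X': "2049 * X \<le> 1 / 2" using X by (simp add: cutoff_def)
  have l0: "c * s * d ^ i / 8 \<le> l" unfolding l_def using lower_bound_ge le' c s1 i by simp
  moreover have "0 < c * s * d ^ i / 8" using c s1 d4 by simp
  ultimately have l_pos: "0 < l" by linarith
  have l1: "l \<le> s * d ^ i" unfolding l_def using lower_bound_le le' c s1 i by simp
  have m0: "0 \<le> \<mu>" unfolding \<mu>_def using l_pos d4 X' by simp
  have "prob (all_pairs n) p (\<lambda>E. (l \<le> card (layer E S i) \<and> card (ball E S i) \<le> 2048 * s * d ^ i)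
      \<and> card (layer E S (Suc i)) \<le> lower_bound c s (Suc i)) \<le> exp (- (e\<^sup>2 * \<mu> / 2))"
  proof (rule layer_lower[OF p S(1)])
    show "\<mu> \<le> (1 - exp (- (p * l))) * (n - 2048 * s * d ^ i)"
    proof -
      define z where "z = p * l"
      have z: "0 \<le> z" using p l_pos by (simp add: z_def)
      have "z \<le> (2 * d / n) * (s * d ^ i)" unfolding z_def using p_le p l1 l_pos d4 by (intro mult_mono) auto
      then have z2: "z / 2 \<le> X" by (simp add: X_def field_simps)
      have "d * l \<le> n * z"
        using mult_right_mono[OF p_ge, of "n * l"] l_pos n by (simp add: z_def field_simps)
      then have "\<mu> \<le> n * z * (1 - 2049 * X)" unfolding \<mu>_def using X' by (intro mult_right_mono) auto
      \<comment> \<open>The coefficient 2049 splits here: 2048 for the vertices already in the ball,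
        and 1 for vertices reached more than once, since \<open>z / 2 \<le> X\<close>.\<close>
      also have "\<dots> \<le> n * z * ((1 - z / 2) * (1 - 2048 * X))"
      proof (rule mult_left_mono)
        have "(1 - X) * (1 - 2048 * X) \<le> (1 - z / 2) * (1 - 2048 * X)"
          using z2 X' X by (intro mult_right_mono) auto
        moreover have "1 - 2049 * X \<le> (1 - X) * (1 - 2048 * X)" by (simp add: algebra_simps)
        ultimately show "1 - 2049 * X \<le> (1 - z / 2) * (1 - 2048 * X)" by linarith
      qed (use z in simp)
      also have "\<dots> = (z - z\<^sup>2 / 2) * (n - 2048 * (n * X))" by (simp add: algebra_simps power2_eq_square)
      also have "\<dots> \<le> (1 - exp (- z)) * (n - 2048 * s * d ^ i)"
      proof (rule mult_mono)
        show "z - z\<^sup>2 / 2 \<le> 1 - exp (- z)" using exp_minus_le[OF z] by simp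
        show "n - 2048 * (n * X) \<le> n - 2048 * s * d ^ i" using mono n by (simp add: X_def)
        show "0 \<le> 1 - exp (- z)" using z by simp
        show "0 \<le> n - 2048 * (n * X)" using mult_left_mono[of "2048 * X" 1 "real n"] X X' by simp
      qed
      finally show ?thesis by (simp add: z_def)
    qed
    show "lower_bound c s (Suc i) \<le> (1 - e) * \<mu>"
    proof -
      have h: "h \<le> 1" unfolding h_def using lower_bound_factor(2) le' s1 i by simp
      have h0: "1/8 \<le> h" unfolding h_def using lower_bound_factor(1) le' s1 i by simp
      have e0: "0 \<le> e" using q by (simp add: e_def)
      then have a: "0 \<le> e + 2049 * X" using X by simp
      define h' where "h' = 1/4 + (1/2) ^ Suc i / 2 - 4098 * (s * d ^ Suc i / n)"
      \<comment> \<open>As d is at least 2, the loss term with 4098 = 2 * 2049 grows by at least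
        \<open>2049 * X\<close> in this step, while \<open>(1/2) ^ i / 2\<close> drops by
        \<open>e\<close>: exactly the room that the step consumes.\<close>
      have "2 * (s * d ^ i) \<le> s * d ^ Suc i" using s1 d4 by simp
      then have "2 * (s * d ^ i) / n \<le> X" unfolding X_def by (rule divide_right_mono) simp
      then have "h' \<le> h - (e + 2049 * X)"
        unfolding h'_def h_def e_def X_def[symmetric] by simp
      also have "\<dots> \<le> h - h * (e + 2049 * X)"
        using mult_right_mono[OF h a] by simp
      also have "\<dots> \<le> h * ((1 - e) * (1 - 2049 * X))"
        using mult_nonneg_nonneg[of h "e * X"] X e0 h0 by (simp add: algebra_simps)
      finally have "c * s * d ^ Suc i * h' \<le> c * s * d ^ Suc i * (h * ((1 - e) * (1 - 2049 * X)))"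
        using c s1 d4 by (intro mult_left_mono) auto
      moreover have "lower_bound c s (Suc i) = c * s * d ^ Suc i * h'" by (simp only: lower_bound_def h'_def)
      moreover have "l = c * s * d ^ i * h" by (simp only: l_def lower_bound_def h_def)
      ultimately show ?thesis by (simp add: \<mu>_def mult_ac)
    qed
  qed (use l_pos q m0 in \<open>auto simp: e_def\<close>)
  also have "\<dots> \<le> exp (- 4 * s * ln n)"
  proof -
    have "(1/2) * (d * (c * s * d ^ i / 8)) \<le> (1 - 2049 * X) * (d * l)"
      using X' l0 d4 c s1 by (intro mult_mono) auto
    then have mu: "c * s * d * d ^ i / 16 \<le> \<mu>" by (simp add: \<mu>_def mult_ac)
    have dd: "d / 4 \<le> (d / 4) ^ i" using power_increasing[of 1 i "d / 4"] d4 i by simp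
    have "4 * s * ln n = s * (4 * ln n)" by simp
    also have "\<dots> \<le> s * (c * ln n * ln n / 8192)"
    proof (rule mult_left_mono)
      show "4 * ln n \<le> c * ln n * ln n / 8192" using mult_right_mono[OF large, of "ln n"] ln_pos by simp
    qed (use s1 in simp)
    also have "\<dots> \<le> s * (c * (2 * d) * (2 * d) / 8192)"
      using s1 c ln_le ln_pos by (intro mult_left_mono divide_right_mono mult_mono) auto
    also have "\<dots> = c * s * d * (d / 4) / 512" by simp
    also have "\<dots> \<le> c * s * d * (d / 4) ^ i / 512"
      using dd c s1 d4 by (intro divide_right_mono mult_left_mono) auto
    also have "\<dots> = (1/4) ^ i / 16 * (c * s * d * d ^ i / 16) / 2" by (simp add: power_divide)
    also have "\<dots> \<le> (1/4) ^ i / 16 * \<mu> / 2" using mu by (intro divide_right_mono mult_left_mono) auto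
    also have "(1/4) ^ i / 16 = e\<^sup>2"
      by (simp add: e_def power2_eq_square power_mult_distrib[symmetric])
    finally show ?thesis by simp
  qed
  finally show ?thesis by (simp add: l_def)
qed

text \<open>The step that crosses \<open>n / cutoff\<close>. Sharp growth is no longer at stake:
  each of at least n/2 unexposed vertices is reached with probability at least \<open>z / 2\<close>,
  and half of the resulting mean is \<open>c * n / (64 * cutoff)\<close>.\<close>

lemma last_step:
  fixes c s :: real
  assumes S: "S \<subseteq> V" "S \<noteq> {}" and s: "s = real (card S)" and c: "0 < c" "c \<le> 1" and i: "1 \<le> i"
    and le: "s * d ^ i \<le> n / cutoff" "n / cutoff < s * d ^ Suc i" and large: "4 * s * ln n \<le> c * n / (256 * cutoff)"
  shows "prob (all_pairs n) p (\<lambda>E. (lower_bound c s i \<le> card (layer E S i) \<and> card (ball E S i) \<le> 2048 * s * d ^ i)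
      \<and> card (layer E S (Suc i)) \<le> c * n / (64 * cutoff)) \<le> exp (- 4 * s * ln n)"
proof -
  have s1: "1 \<le> s" using S finite_subset[OF S(1)] by (simp add: s Suc_leI card_gt_0_iff)
  define l where "l = lower_bound c s i"
  define z where "z = c / (8 * cutoff)"
  define \<mu> where "\<mu> = z / 2 * (n / 2)"
  have l0: "c * s * d ^ i / 8 \<le> l" unfolding l_def using lower_bound_ge le c s1 i by simp
  moreover have "0 < c * s * d ^ i / 8" using c s1 d4 by simp
  ultimately have l_pos: "0 < l" by linarith
  have z: "0 < z" "z \<le> 1" using c by (auto simp: z_def cutoff_def)
  have m0: "0 \<le> \<mu>" using z by (simp add: \<mu>_def)
  have "prob (all_pairs n) p (\<lambda>E. (l \<le> card (layer E S i) \<and> card (ball E S i) \<le> 2048 * s * d ^ i)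
      \<and> card (layer E S (Suc i)) \<le> c * n / (64 * cutoff)) \<le> exp (- ((1/2)\<^sup>2 * \<mu> / 2))"
  proof (rule layer_lower[OF p S(1)])
    have "z = (c / 8 / n) * (n / cutoff)" using n by (simp add: z_def)
    also have "\<dots> \<le> (c / 8 / n) * (s * d ^ Suc i)" using le c n by (intro mult_left_mono) auto
    also have "\<dots> = (d / n) * (c * s * d ^ i / 8)" by (simp add: mult_ac)
    also have "\<dots> \<le> p * l" using p_ge l0 d4 c s1 p by (intro mult_mono) auto
    finally have zl: "z \<le> p * l" .
    have "z / 2 \<le> z - z\<^sup>2 / 2" using z by (simp add: power2_eq_square mult_left_le)
    also have "\<dots> \<le> 1 - exp (- z)" using exp_minus_le[of z] z by simp
    also have "\<dots> \<le> 1 - exp (- (p * l))" using zl by simp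
    finally have "z / 2 \<le> 1 - exp (- (p * l))" .
    moreover have "n / 2 \<le> n - 2048 * s * d ^ i" using le(1) by (simp add: cutoff_def)
    ultimately show "\<mu> \<le> (1 - exp (- (p * l))) * (n - 2048 * s * d ^ i)"
      unfolding \<mu>_def using z zl by (intro mult_mono) auto
    show "c * n / (64 * cutoff) \<le> (1 - 1/2) * \<mu>" by (simp add: \<mu>_def z_def)
  qed (use l_pos m0 in auto)
  also have "\<dots> \<le> exp (- 4 * s * ln n)" using large by (simp add: \<mu>_def z_def power2_eq_square)
  finally show ?thesis by (simp add: l_def)
qed

end

section \<open>First layers, low degrees and domination\<close>

text \<open>Double counting: an edge with an end in \<open>S\<close> lies inside
  \<open>nb E S\<close> and is counted by at most two vertices.\<close>

lemma sum_degrees_le: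
  assumes E: "E \<subseteq> all_pairs n" and S: "S \<subseteq> {1..n}"
  shows "(\<Sum>v\<in>S. card (nb E {v} - {v})) \<le> 2 * card (E \<inter> Pow (nb E S))"
proof -
  define F where "F = E \<inter> Pow (nb E S)"
  have finE: "finite E" using E finite_all_pairs by (rule finite_subset)
  then have finF: "finite F" by (simp add: F_def)
  have finS: "finite S" using S by (meson finite_atLeastAtMost finite_subset)
  have "card (nb E {v} - {v}) \<le> card {e\<in>F. v \<in> e}" if v: "v \<in> S" for v
  proof (rule card_inj_on_le[of "\<lambda>w. {v, w}"])
    show "inj_on (\<lambda>w. {v, w}) (nb E {v} - {v})" by (auto simp: inj_on_def doubleton_eq_iff)
    show "(\<lambda>w. {v, w}) ` (nb E {v} - {v}) \<subseteq> {e\<in>F. v \<in> e}"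
      using v by (auto simp: F_def nb_def step_def adj_def)
  qed (use finF in simp)
  then have "(\<Sum>v\<in>S. card (nb E {v} - {v})) \<le> (\<Sum>v\<in>S. card {e\<in>F. v \<in> e})"
    by (rule sum_mono)
  also have "\<dots> = (\<Sum>v\<in>S. \<Sum>e\<in>F. of_bool (v \<in> e))"
    using finF by (simp add: sum_of_bool_eq Int_def)
  also have "\<dots> = (\<Sum>e\<in>F. \<Sum>v\<in>S. of_bool (v \<in> e))" by (rule sum.swap)
  also have "\<dots> \<le> (\<Sum>e\<in>F. 2)"
  proof (rule sum_mono)
    fix e assume "e \<in> F"
    then have "e \<in> all_pairs n" using E by (auto simp: F_def)
    then obtain u w where e: "e = {u, w}" by (auto simp: all_pairs_def)
    have "(\<Sum>v\<in>S. of_bool (v \<in> e)) = card (S \<inter> e)" using finS by (simp add: sum_of_bool_eq Int_def)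
    also have "\<dots> \<le> card {u, w}" unfolding e by (intro card_mono) auto
    also have "\<dots> \<le> 2" by (simp add: card_insert_if)
    finally show "(\<Sum>v\<in>S. of_bool (v \<in> e)) \<le> (2::nat)" .
  qed
  finally show ?thesis by (simp add: F_def)
qed

context gnp
begin

lemma exp_neg_ln: "exp (- ln n) = 1 / n"
  using n by (simp add: exp_minus field_simps)

text \<open>There are at most n^s sets of size s, so failure probabilities n^(-4 s) can be summed
  over all nonempty sets.\<close>

lemma prob_union_subsets:
  fixes m :: real
  assumes "\<And>S. S \<subseteq> V \<Longrightarrow> S \<noteq> {} \<Longrightarrow> card S \<le> m \<Longrightarrow> prob (all_pairs n) p (P S) \<le> exp (- 4 * real (card S) * ln n)"
  shows "prob (all_pairs n) p (\<lambda>E. \<exists>S. S \<subseteq> V \<and> S \<noteq> {} \<and> real (card S) \<le> m \<and> P S E) \<le> exp (1 - 2 * ln n)"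
proof -
  let ?I = "{S\<in>Pow V. 1 \<le> real (card S)}"
  have ne: "1 \<le> real (card S)" if "S \<subseteq> V" "S \<noteq> {}" for S
    using that finite_subset[OF that(1)] by (simp add: Suc_leI card_gt_0_iff)
  have "prob (all_pairs n) p (\<lambda>E. \<exists>S. S \<subseteq> V \<and> S \<noteq> {} \<and> real (card S) \<le> m \<and> P S E)
      \<le> prob (all_pairs n) p (\<lambda>E. \<exists>S\<in>?I. real (card S) \<le> m \<and> P S E)"
    using p ne by (intro prob_mono) auto
  also have "\<dots> \<le> (\<Sum>S\<in>?I. prob (all_pairs n) p (\<lambda>E. real (card S) \<le> m \<and> P S E))"
    using p by (intro prob_union_bound) auto
  also have "\<dots> \<le> (\<Sum>S\<in>?I. exp (- 4 * ln n) ^ card S)"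
  proof (rule sum_mono)
    fix S assume S: "S \<in> ?I"
    then have "S \<subseteq> V" "S \<noteq> {}" by auto
    then have "prob (all_pairs n) p (\<lambda>E. real (card S) \<le> m \<and> P S E) \<le> exp (- 4 * real (card S) * ln n)"
      using assms[of S] by (cases "real (card S) \<le> m") auto
    then show "prob (all_pairs n) p (\<lambda>E. real (card S) \<le> m \<and> P S E) \<le> exp (- 4 * ln n) ^ card S"
      by (simp add: exp_of_nat_mult[symmetric] mult_ac)
  qed
  \<comment> \<open>Rankin's trick with \<open>u = 1\<close> and \<open>\<theta> = 2 * ln n\<close>;
    the second summand in the exponent equals \<open>1 / n\<close>.\<close>
  also have "\<dots> \<le> exp (- (2 * ln n) * 1 + exp (- 4 * ln n) * exp (2 * ln n) * card V)"
    using ln_pos by (intro sum_large_subsets_power_card_le) auto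
  also have "exp (- 4 * ln n) * exp (2 * ln n) = exp (- ln n) * exp (- ln n)"
    by (simp add: exp_add[symmetric])
  also have "\<dots> * card V \<le> 1" unfolding exp_neg_ln using n by (simp add: field_simps)
  then have "exp (- (2 * ln n) * 1 + exp (- ln n) * exp (- ln n) * card V) \<le> exp (1 - 2 * ln n)" by simp
  finally show ?thesis .
qed

text \<open>Once \<open>d \<ge> 128 * ln n\<close>, a single factor d beats the union bound: the
  Chernoff exponent is \<open>min (s * d) n / 32\<close>.\<close>

lemma first_layer_dense:
  fixes s :: real
  assumes S: "S \<subseteq> V" "S \<noteq> {}" and s: "s = real (card S)"
    and large: "128 * ln n \<le> d" "128 * s * ln n \<le> n" "2 * s \<le> n"
  shows "prob (all_pairs n) p (\<lambda>E. card (layer E S (Suc 0)) \<le> min (s * d) n / 8) \<le> exp (- 4 * s * ln n)"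
proof -
  have s1: "1 \<le> s" using S finite_subset[OF S(1)] by (simp add: s Suc_leI card_gt_0_iff)
  define \<mu> where "\<mu> = min (s * d) n / 4"
  define z where "z = min (s * d / n) 1"
  have z: "0 \<le> z" "z \<le> 1" using s1 d4 by (auto simp: z_def)
  have m0: "0 \<le> \<mu>" using s1 d4 by (simp add: \<mu>_def)
  have zn: "z * n = min (s * d) n" using n by (auto simp: z_def min_def field_simps)
  have "prob (all_pairs n) p (\<lambda>E. card (layer E S (Suc 0)) \<le> min (s * d) n / 8)
     = prob (all_pairs n) p (\<lambda>E. (s \<le> card (layer E S 0) \<and> card (ball E S 0) \<le> s) \<and> card (layer E S (Suc 0)) \<le> min (s * d) n / 8)"
    by (rule expect_cong) (simp add: s)
  also have "\<dots> \<le> exp (- ((1/2)\<^sup>2 * \<mu> / 2))"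
  proof (rule layer_lower[OF p S(1)])
    have "s * d / n \<le> p * s" using mult_right_mono[OF p_ge, of s] s1 by (simp add: mult_ac)
    then have zp: "z \<le> p * s" by (simp add: z_def)
    have "z / 2 \<le> z - z\<^sup>2 / 2" using z by (simp add: power2_eq_square mult_left_le)
    also have "\<dots> \<le> 1 - exp (- z)" using exp_minus_le[of z] z by simp
    also have "\<dots> \<le> 1 - exp (- (p * s))" using zp by simp
    finally have "z / 2 \<le> 1 - exp (- (p * s))" .
    moreover have "n / 2 \<le> n - s" using large by simp
    ultimately have "z / 2 * (n / 2) \<le> (1 - exp (- (p * s))) * (n - s)"
      using z zp by (intro mult_mono) auto
    then show "\<mu> \<le> (1 - exp (- (p * s))) * (n - s)" by (simp add: \<mu>_def zn[symmetric])
    show "min (s * d) n / 8 \<le> (1 - 1/2) * \<mu>" by (simp add: \<mu>_def)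
  qed (use m0 s1 in auto)
  also have "\<dots> \<le> exp (- 4 * s * ln n)"
  proof -
    have "128 * s * ln n \<le> s * d" using mult_left_mono[OF large(1), of s] s1 by simp
    then have "128 * s * ln n \<le> min (s * d) n" using large(2) by simp
    then show ?thesis by (simp add: \<mu>_def power2_eq_square)
  qed
  finally show ?thesis .
qed

definition low_degree :: "real \<Rightarrow> nat set set \<Rightarrow> nat set" where
  "low_degree \<delta> E = {v\<in>V. card (layer E {v} (Suc 0)) < \<delta> * d}"

text \<open>As 2/3 exceeds 1/2, sets of order sqrt n * ln n fall under the condition; this is the
  size of a neighbourhood of O(sqrt n) vertices when degrees are of order ln n.\<close>

definition locally_sparse :: "nat set set \<Rightarrow> bool" where
  "locally_sparse E \<longleftrightarrow> (\<forall>X. X \<subseteq> V \<and> X \<noteq> {} \<and> real (card X) \<le> n powr (2/3) \<longrightarrow>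
     card (E \<inter> Pow X) < 8 * card X)"

lemma prob_not_locally_sparse:
  assumes "n powr (1/4) * p * n powr (2/3) \<le> 1" "2 \<le> ln n"
  shows "prob (all_pairs n) p (\<lambda>E. \<not> locally_sparse E) \<le> exp (1 - ln n / 2)"
proof -
  let ?I = "{X\<in>Pow V. 1 \<le> real (card X)}"
  have ne: "1 \<le> real (card X)" if "X \<subseteq> V" "X \<noteq> {}" for X
    using that finite_subset[OF that(1)] by (simp add: Suc_leI card_gt_0_iff)
  let ?P = "\<lambda>X E. real (card X) \<le> n powr (2/3) \<and> 8 * real (card X) \<le> card (E \<inter> Pow X)"
  have "prob (all_pairs n) p (\<lambda>E. \<not> locally_sparse E) \<le> prob (all_pairs n) p (\<lambda>E. \<exists>X\<in>?I. ?P X E)"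
    using p
  proof (rule prob_mono)
    fix E assume "\<not> locally_sparse E"
    then obtain X where X: "X \<subseteq> V" "X \<noteq> {}" "real (card X) \<le> n powr (2/3)" "8 * card X \<le> card (E \<inter> Pow X)"
      unfolding locally_sparse_def by (meson not_less)
    then have "8 * real (card X) \<le> card (E \<inter> Pow X)" by linarith
    then show "\<exists>X\<in>?I. ?P X E" using X ne[OF X(1,2)] by blast
  qed
  also have "\<dots> \<le> (\<Sum>X\<in>?I. prob (all_pairs n) p (?P X))"
    using p by (intro prob_union_bound) auto
  also have "\<dots> \<le> (\<Sum>X\<in>?I. exp (1 - 2 * ln n) ^ card X)"
  proof (rule sum_mono)
    fix X assume X: "X \<in> ?I"
    show "prob (all_pairs n) p (?P X) \<le> exp (1 - 2 * ln n) ^ card X"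
    proof (cases "real (card X) \<le> n powr (2/3)")
      case True
      let ?Y = "all_pairs n \<inter> Pow X"
      have "X \<subseteq> V" using X by simp
      then have finX: "finite X" by (rule finite_subset) simp
      have "card ?Y \<le> card ((\<lambda>(u, w). {u, w}) ` (X \<times> X))"
        by (intro card_mono) (use finX in \<open>auto simp: all_pairs_def\<close>)
      also have "\<dots> \<le> card (X \<times> X)" using finX by (intro card_image_le) auto
      finally have "card ?Y \<le> card X * card X" by (simp add: card_cartesian_product)
      then have Y: "p * card ?Y \<le> p * (card X * card X)" using p by (intro mult_left_mono) (simp_all flip: of_nat_mult)
      have "prob (all_pairs n) p (?P X) \<le> prob (all_pairs n) p (\<lambda>E. 8 * real (card X) \<le> card {e\<in>?Y. e \<in> E \<inter> {e}})"
        using p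
      proof (rule prob_mono)
        fix E assume E: "E \<subseteq> all_pairs n" "?P X E"
        then have "E \<inter> Pow X = {e\<in>?Y. e \<in> E \<inter> {e}}" by blast
        then show "8 * real (card X) \<le> card {e\<in>?Y. e \<in> E \<inter> {e}}" using E by simp
      qed
      \<comment> \<open>The exponential moment is taken at \<open>n powr (1/4)\<close>, so that \<open>8 |X|\<close> edges cost \<open>n powr (- 2 |X|)\<close>.\<close>
      also have "\<dots> \<le> exp ((exp (ln n / 4) - 1) * (p * (card X * card X)) - ln n / 4 * (8 * real (card X)))"
        by (rule chernoff_upper_exp[where B = "\<lambda>e. {e}" and \<phi> = "\<lambda>e E. e \<in> E" and q = p])
          (use p Y ln_pos in \<open>auto simp: disjoint_family_on_def expect_def Pow_insert\<close>)
      also have "\<dots> \<le> exp (card X * (1 - 2 * ln n))"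
      proof -
        have "exp (ln n / 4) = n powr (1/4)" using n by (simp add: powr_def)
        then have "(exp (ln n / 4) - 1) * (p * (card X * card X)) \<le> n powr (1/4) * (p * (card X * card X))"
          using p by (intro mult_right_mono) auto
        also have "\<dots> = n powr (1/4) * p * card X * card X" by simp
        also have "\<dots> \<le> n powr (1/4) * p * n powr (2/3) * card X"
          using p True by (intro mult_right_mono mult_left_mono) auto
        also have "\<dots> \<le> 1 * real (card X)" using assms(1) by (intro mult_right_mono) auto
        finally show ?thesis by (simp add: algebra_simps)
      qed
      finally show ?thesis by (simp add: exp_of_nat_mult[symmetric])
    qed simp
  qed
  also have "\<dots> \<le> exp (- (ln n / 2) * 1 + exp (1 - 2 * ln n) * exp (ln n / 2) * card V)"
    using ln_pos by (intro sum_large_subsets_power_card_le) auto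
  also have "\<dots> \<le> exp (1 - ln n / 2)"
  proof -
    have "real (card V) = exp (ln n)" using n by simp
    then have "exp (1 - 2 * ln n) * exp (ln n / 2) * card V = exp (1 - ln n / 2)"
      by (simp only: exp_add[symmetric]) simp
    also have "\<dots> \<le> 1" using assms(2) by simp
    finally show ?thesis by simp
  qed
  finally show ?thesis .
qed

text \<open>If the layer were smaller, the closed neighbourhood \<open>X\<close> would have at most
  \<open>2 * (\<delta> / 32 * s * d)\<close> vertices, while degrees of at least
  \<open>\<delta> * d\<close> force \<open>\<delta> * s * d / 2\<close> edges into it, at least 8
  per vertex. This contradicts local sparsity and explains the factor 32.\<close>

lemma first_layer_sparse:
  fixes s \<delta> :: real
  assumes E: "E \<subseteq> all_pairs n" and ls: "locally_sparse E" and S: "S \<subseteq> V - low_degree \<delta> E" "S \<noteq> {}"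
    and s: "s = real (card S)" and large: "1 \<le> \<delta> / 32 * d" "2 * (\<delta> / 32 * s * d) \<le> n powr (2/3)"
  shows "\<delta> / 32 * s * d \<le> card (layer E S (Suc 0))"
proof (rule ccontr)
  assume small: "\<not> ?thesis"
  define X where "X = nb E S"
  have SV: "S \<subseteq> V" using S by blast
  have finS: "finite S" using SV by (meson finite_atLeastAtMost finite_subset)
  have s1: "1 \<le> s" using S finS by (simp add: s Suc_leI card_gt_0_iff)
  have X: "X \<subseteq> V" "X \<noteq> {}" using nb_subset[OF E SV] subset_nb[of S E] S by (auto simp: X_def)
  have "X = S \<union> layer E S (Suc 0)" using subset_nb[of S E] by (auto simp: X_def layer_1)
  then have "card X \<le> card S + card (layer E S (Suc 0))" by (metis card_Un_le)
  then have "real (card X) \<le> s + card (layer E S (Suc 0))" by (simp add: s)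
  moreover have "s * 1 \<le> s * (\<delta> / 32 * d)" using large s1 by (intro mult_left_mono) auto
  moreover have "s * (\<delta> / 32 * d) = \<delta> / 32 * s * d" by simp
  ultimately have cX: "card X \<le> 2 * (\<delta> / 32 * s * d)" using small by linarith
  have "s * (\<delta> * d) = (\<Sum>v\<in>S. \<delta> * d)" by (simp add: s)
  also have "\<dots> \<le> (\<Sum>v\<in>S. real (card (nb E {v} - {v})))"
    using S SV by (intro sum_mono) (auto simp: low_degree_def layer_1)
  also have "\<dots> \<le> real (2 * card (E \<inter> Pow X))"
    using sum_degrees_le[OF E SV] unfolding X_def of_nat_sum[symmetric] of_nat_le_iff .
  finally have "8 * real (card X) \<le> card (E \<inter> Pow X)" using cX by (simp add: algebra_simps)
  moreover have "card (E \<inter> Pow X) < 8 * card X"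
    using ls X cX large(2) unfolding locally_sparse_def by simp
  ultimately show False by linarith
qed

text \<open>Markov's inequality for the number of low-degree vertices, whose mean is at most n times
  one Chernoff tail. For large \<open>l\<close> and small \<open>l * \<delta>\<close> the exponent
  is close to \<open>- d\<close>, which beats the remaining factor \<open>sqrt n\<close> as soon as
  d exceeds (ln n) / 2 by a constant factor.\<close>

lemma prob_many_low_degree:
  fixes \<delta> l :: real
  assumes l: "0 \<le> l"
  shows "prob (all_pairs n) p (\<lambda>E. sqrt n < card (low_degree \<delta> E))
    \<le> sqrt n * exp ((l * \<delta> - (1 - exp (- l))) * d)"
proof -
  let ?\<Omega> = "all_pairs n"
  have deg: "prob ?\<Omega> p (\<lambda>E. card (layer E {v} (Suc 0)) < \<delta> * d) \<le> exp ((l * \<delta> - (1 - exp (- l))) * d)"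
    if v: "v \<in> V" for v
  proof -
    let ?Y = "V - {v}"
    have "prob ?\<Omega> p (\<lambda>E. card (layer E {v} (Suc 0)) < \<delta> * d)
        \<le> prob ?\<Omega> p (\<lambda>E. card {w\<in>?Y. E \<inter> star_edges {v} w \<noteq> {}} \<le> \<delta> * d)"
      using p v by (intro prob_mono) (auto simp: layer_1 nb_diff_eq[of _ n "{v}" "{v}"])
    also have "\<dots> \<le> exp (l * (\<delta> * d) - (1 - exp (- l)) * d)"
    proof (rule chernoff_lower_exp[where q = p and \<phi> = "\<lambda>_ E. E \<noteq> {}"])
      show "disjoint_family_on (star_edges {v}) ?Y" by (intro disjoint_star_edges) auto
      show "star_edges {v} w \<subseteq> ?\<Omega>" if "w \<in> ?Y" for w
        using that v by (intro star_edges_subset) auto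
      show "p \<le> prob (star_edges {v} w) p (\<lambda>E. E \<noteq> {})" if "w \<in> ?Y" for w
        by (subst prob_nonempty) (simp_all add: star_edges_def)
      show "d \<le> p * card ?Y" using v n by (simp add: d card_Diff_subset of_nat_diff)
    qed (use p l in auto)
    finally show ?thesis by (simp add: algebra_simps)
  qed
  have "prob ?\<Omega> p (\<lambda>E. sqrt n < card (low_degree \<delta> E))
      \<le> expect ?\<Omega> p (\<lambda>E. (1 / sqrt n) * (\<Sum>v\<in>V. of_bool (card (layer E {v} (Suc 0)) < \<delta> * d)))"
    using p
  proof (rule expect_mono)
    fix E
    have "(\<Sum>v\<in>V. of_bool (card (layer E {v} (Suc 0)) < \<delta> * d)) = real (card (low_degree \<delta> E))"
      by (simp add: low_degree_def sum_of_bool_eq Int_def)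
    then show "of_bool (sqrt n < card (low_degree \<delta> E))
        \<le> (1 / sqrt n) * (\<Sum>v\<in>V. of_bool (card (layer E {v} (Suc 0)) < \<delta> * d))"
      using n by (auto simp: field_simps)
  qed
  also have "\<dots> = (1 / sqrt n) * (\<Sum>v\<in>V. prob ?\<Omega> p (\<lambda>E. card (layer E {v} (Suc 0)) < \<delta> * d))"
    by (simp only: expect_cmult expect_sum)
  also have "\<dots> \<le> (1 / sqrt n) * (\<Sum>v\<in>V. exp ((l * \<delta> - (1 - exp (- l))) * d))"
    using deg by (intro mult_left_mono sum_mono) auto
  also have "\<dots> = (n / sqrt n) * exp ((l * \<delta> - (1 - exp (- l))) * d)" by simp
  also have "n / sqrt n = sqrt n" by (simp add: real_div_sqrt)
  finally show ?thesis .
qed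

text \<open>With \<open>x = d / sqrt n\<close>, a vertex is joined to \<open>v\<close> and to no
  dominator with probability at most \<open>p * exp (- (4 * x))\<close>. The mean number is at most
  \<open>2 * sqrt n * x * exp (- (4 * x))\<close>, hence at most \<open>sqrt n / 4\<close> for
  \<open>x \<ge> 1\<close>. The extra 1 in the threshold is for \<open>v\<close> itself, which
  belongs to its closed neighbourhood.\<close>

lemma prob_many_undominated:
  assumes D: "D \<subseteq> V" "4 * sqrt n \<le> card D" and dn: "sqrt n \<le> d"
  shows "prob (all_pairs n) p (\<lambda>E. \<exists>v\<in>V. sqrt n + 1 < card (nb E {v} - nb E D)) \<le> n * exp (- (sqrt n / 2))"
proof -
  let ?\<Omega> = "all_pairs n"
  have finD: "finite D" using D by (meson finite_atLeastAtMost finite_subset)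
  have one: "prob ?\<Omega> p (\<lambda>E. sqrt n + 1 < card (nb E {v} - nb E D)) \<le> exp (- (sqrt n / 2))"
    if v: "v \<in> V" for v
  proof (cases "v \<in> D")
    case True
    then have "nb E {v} - nb E D = {}" for E using nb_mono[of "{v}" D E] by auto
    then have "\<not> sqrt n + 1 < card (nb E {v} - nb E D)" for E by (simp only: card.empty) (simp add: not_less add_nonneg_nonneg)
    then show ?thesis by simp
  next
    case False
    let ?Y = "V - insert v D"
    let ?\<phi> = "\<lambda>w E. {v, w} \<in> E \<and> E \<inter> star_edges D w = {}"
    define x where "x = d / sqrt n"
    have x: "1 \<le> x" using dn n by (simp add: x_def)
    have ins: "star_edges (insert v D) w = insert {v, w} (star_edges D w)" for w
      by (simp add: star_edges_def)
    have "prob ?\<Omega> p (\<lambda>E. sqrt n + 1 < card (nb E {v} - nb E D))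
        \<le> prob ?\<Omega> p (\<lambda>E. sqrt n \<le> card {w\<in>?Y. ?\<phi> w (E \<inter> star_edges (insert v D) w)})"
      using p
    proof (rule prob_mono)
      fix E assume E: "E \<subseteq> ?\<Omega>" "sqrt n + 1 < card (nb E {v} - nb E D)"
      let ?Z = "{w\<in>?Y. ?\<phi> w (E \<inter> star_edges (insert v D) w)}"
      have "nb E {v} - nb E D \<subseteq> insert v ?Z"
      proof
        fix w assume w: "w \<in> nb E {v} - nb E D"
        then have wV: "w \<in> V" using nb_subset[OF E(1), of "{v}"] v by blast
        have "w \<notin> D" using w subset_nb[of D E] by blast
        moreover have "E \<inter> star_edges D w = {}"
          using w \<open>w \<notin> D\<close> by (auto simp: nb_def step_def adj_def star_edges_def)
        moreover have "w = v \<or> {v, w} \<in> E" using w by (auto simp: nb_def step_def adj_def)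
        ultimately show "w \<in> insert v ?Z" using wV by (auto simp: ins)
      qed
      then have "card (nb E {v} - nb E D) \<le> card (insert v ?Z)" by (intro card_mono) auto
      also have "\<dots> \<le> Suc (card ?Z)" by (rule card_insert_le_m1) auto
      finally have "real (card (nb E {v} - nb E D)) \<le> card ?Z + 1" by simp
      then show "sqrt n \<le> card ?Z" using E(2) by linarith
    qed
    also have "\<dots> \<le> exp ((exp 1 - 1) * (sqrt n / 4) - 1 * sqrt n)"
    proof (rule chernoff_upper_exp[where q = "p * (1 - p) ^ card D"])
      show "disjoint_family_on (star_edges (insert v D)) ?Y" by (intro disjoint_star_edges) auto
      show "star_edges (insert v D) w \<subseteq> ?\<Omega>" if "w \<in> ?Y" for w
        using that v D by (intro star_edges_subset) auto
      show "prob (star_edges (insert v D) w) p (?\<phi> w) \<le> p * (1 - p) ^ card D" if "w \<in> ?Y" for w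
      proof -
        have "w \<notin> D" "{v, w} \<notin> star_edges D w" using that False by (auto simp: star_edges_def doubleton_eq_iff)
        moreover have "finite (star_edges D w)" using finD by (simp add: star_edges_def)
        ultimately show ?thesis
          unfolding ins by (subst prob_one_edge_and_none) (simp_all add: card_star_edges)
      qed
      have "(1 - p) ^ card D \<le> exp (- (p * card D))" using one_minus_power_ge[OF p, of "card D" "card D"] by simp
      also have "\<dots> \<le> exp (- (4 * x))"
      proof -
        have "4 * x = (d / n) * (4 * sqrt n)"
          using n by (simp add: x_def field_simps)
        also have "\<dots> \<le> p * card D" using p_ge D(2) p by (intro mult_mono) auto
        finally show ?thesis by simp
      qed
      finally have "p * (1 - p) ^ card D * card ?Y \<le> (2 * d / n) * exp (- (4 * x)) * n"
        using p p_le d4 card_mono[of V ?Y] by (intro mult_mono) auto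
      also have "\<dots> = 2 * sqrt n * (x * exp (- (4 * x)))" using n by (simp add: x_def)
      also have "\<dots> \<le> 2 * sqrt n * (1 / 8)"
      proof (rule mult_left_mono)
        have "x * 1 \<le> x * x" using x by (intro mult_left_mono) auto
        then have "8 * x \<le> 1 + 4 * x + 8 * (x * x)" using x by linarith
        also have "\<dots> = 1 + 4 * x + (4 * x)\<^sup>2 / 2" by (simp add: power2_eq_square)
        also have "\<dots> \<le> exp (4 * x)" using x by (intro exp_lower_Taylor_quadratic) auto
        finally show "x * exp (- (4 * x)) \<le> 1 / 8" by (simp add: exp_minus field_simps)
      qed simp
      finally show "p * (1 - p) ^ card D * card ?Y \<le> sqrt n / 4" by simp
    qed (use p in auto)
    also have "\<dots> \<le> exp (- (sqrt n / 2))"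
    proof -
      have "exp 1 \<le> (3::real)" using exp_le .
      then have "(exp 1 - 1) * (sqrt n / 4) \<le> 2 * (sqrt n / 4)" by (intro mult_right_mono) auto
      then show ?thesis by (simp add: algebra_simps)
    qed
    finally show ?thesis .
  qed
  have "prob ?\<Omega> p (\<lambda>E. \<exists>v\<in>V. sqrt n + 1 < card (nb E {v} - nb E D))
      \<le> (\<Sum>v\<in>V. prob ?\<Omega> p (\<lambda>E. sqrt n + 1 < card (nb E {v} - nb E D)))"
    using p by (intro prob_union_bound) auto
  also have "\<dots> \<le> (\<Sum>v\<in>V. exp (- (sqrt n / 2)))" using one by (rule sum_mono)
  finally show ?thesis by simp
qed

end

section \<open>Good graphs have small cop number\<close>

context gnp
begin

text \<open>The size conditions on the current layer and ball are part of the event, as in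
  \<open>layer_exposure\<close>; this replaces conditioning on earlier steps. The alternatives are
  growth below \<open>n / cutoff\<close> and the step that crosses it; beyond that nothing can
  fail.\<close>

definition bad_step :: "real \<Rightarrow> nat set \<Rightarrow> nat \<Rightarrow> nat set set \<Rightarrow> bool" where
  "bad_step c S i E \<longleftrightarrow>
     (lower_bound c (card S) i \<le> card (layer E S i) \<and> card (ball E S i) \<le> 2048 * real (card S) * d ^ i) \<and>
     (card S * d ^ Suc i \<le> n / cutoff \<and> card (layer E S (Suc i)) \<le> lower_bound c (card S) (Suc i) \<or>
      card S * d ^ i \<le> n / cutoff \<and> n / cutoff < card S * d ^ Suc i \<and> card (layer E S (Suc i)) \<le> c * real n / (64 * cutoff))"

lemma prob_bad_step:
  fixes c :: real
  assumes S: "S \<subseteq> V" "S \<noteq> {}" and c: "0 < c" "c \<le> 1" and i: "1 \<le> i"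
    and large: "32768 \<le> c * ln n" "4 * real (card S) * ln n \<le> c * real n / (256 * cutoff)"
  shows "prob (all_pairs n) p (bad_step c S i) \<le> exp (- 4 * real (card S) * ln n)"
proof -
  consider "card S * d ^ Suc i \<le> n / cutoff" | "card S * d ^ i \<le> n / cutoff" "n / cutoff < card S * d ^ Suc i"
    | "n / cutoff < card S * d ^ i" "n / cutoff < card S * d ^ Suc i" by linarith
  then show ?thesis
  proof cases
    case 1
    then show ?thesis
      using lower_step[OF S refl c i 1 large(1)] by (simp add: bad_step_def)
  next
    case 2
    then show ?thesis
      using last_step[OF S refl c i 2 large(2)] by (simp add: bad_step_def)
  next
    case 3
    then show ?thesis by (simp add: bad_step_def)
  qed
qed

definition steps_ok :: "real \<Rightarrow> real \<Rightarrow> nat \<Rightarrow> nat set set \<Rightarrow> bool" where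
  "steps_ok c m R E \<longleftrightarrow> (\<forall>S i. S \<subseteq> V \<longrightarrow> S \<noteq> {} \<longrightarrow> real (card S) \<le> m \<longrightarrow> i \<in> {1..R} \<longrightarrow> \<not> bad_step c S i E)"

lemma prob_not_steps_ok:
  fixes c m :: real
  assumes c: "0 < c" "c \<le> 1" and large: "32768 \<le> c * ln n" "4 * m * ln n \<le> c * real n / (256 * cutoff)"
  shows "prob (all_pairs n) p (\<lambda>E. \<not> steps_ok c m R E) \<le> R * exp (1 - 2 * ln n)"
proof -
  let ?P = "\<lambda>i E. \<exists>S. S \<subseteq> V \<and> S \<noteq> {} \<and> real (card S) \<le> m \<and> bad_step c S i E"
  have "prob (all_pairs n) p (\<lambda>E. \<not> steps_ok c m R E) \<le> prob (all_pairs n) p (\<lambda>E. \<exists>i\<in>{1..R}. ?P i E)"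
    by (rule prob_mono[OF p]) (unfold steps_ok_def, blast)
  also have "\<dots> \<le> (\<Sum>i\<in>{1..R}. prob (all_pairs n) p (?P i))"
    using p by (intro prob_union_bound) auto
  also have "\<dots> \<le> (\<Sum>i\<in>{1..R}. exp (1 - 2 * ln n))"
  proof (rule sum_mono)
    fix i assume i: "i \<in> {1..R}"
    show "prob (all_pairs n) p (?P i) \<le> exp (1 - 2 * ln n)"
    proof (rule prob_union_subsets)
      fix S assume S: "S \<subseteq> V" "S \<noteq> {}" "real (card S) \<le> m"
      have "4 * real (card S) * ln n \<le> 4 * m * ln n" using S ln_pos by simp
      then show "prob (all_pairs n) p (bad_step c S i) \<le> exp (- 4 * real (card S) * ln n)"
        using prob_bad_step[OF S(1,2) c _ large(1), of i] large(2) i by simp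
    qed
  qed
  finally show ?thesis by simp
qed

text \<open>Invariant: either \<open>s * d ^ j\<close> is still at most \<open>n / cutoff\<close>
  and the layer satisfies \<open>lower_bound\<close>, or the ball already holds a constant fraction
  of all vertices, which it keeps.\<close>

lemma card_ball_ge:
  fixes c m :: real
  assumes E: "E \<subseteq> all_pairs n" and cg: "controlled_growth R E" and ok: "steps_ok c m R E"
    and S: "S \<subseteq> V" "S \<noteq> {}" "card S \<le> m" and c: "0 < c" "c \<le> 1"
    and first: "c * min (card S * d) n \<le> card (layer E S (Suc 0))"
    and j: "1 \<le> j" "j \<le> Suc R"
  shows "c / (64 * cutoff) * min (card S * d ^ j) n \<le> card (ball E S j)"
proof -
  define s where "s = real (card S)"
  have finS: "finite S" using S(1) by (rule finite_subset) simp
  have s1: "1 \<le> s" using S finS by (simp add: s_def Suc_leI card_gt_0_iff)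
  have layer_le: "card (layer E S i) \<le> card (ball E S i)" for i
    by (intro card_mono finite_ball[OF E S(1)] layer_subset_ball)
  have "s * d ^ j \<le> n / cutoff \<and> lower_bound c s j \<le> card (layer E S j) \<or> c * real n / (64 * cutoff) \<le> card (ball E S j)"
    using j
  proof (induction j rule: nat_induct_at_least)
    case base
    show ?case
    proof (cases "s * d \<le> n / cutoff")
      case True
      then have "s * d \<le> n" by (simp add: cutoff_def)
      have "lower_bound c s 1 = c * s * d * (1/2 - 4098 * (s * d / n))" by (simp add: lower_bound_def)
      also have "\<dots> \<le> c * s * d * 1"
      proof (rule mult_left_mono)
        have "0 \<le> s * d / n" using s1 d4 by simp
        then show "1/2 - 4098 * (s * d / n) \<le> 1" by linarith
      qed (use c s1 d4 in simp)
      also have "\<dots> \<le> card (layer E S 1)" using first \<open>s * d \<le> n\<close> by (simp add: s_def[symmetric])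
      finally show ?thesis using True by simp
    next
      case False
      then have "n / (64 * cutoff) \<le> min (s * d) n" by (simp add: cutoff_def)
      then have "c * (n / (64 * cutoff)) \<le> c * min (s * d) n" using c by (intro mult_left_mono) auto
      then have "c * real n / (64 * cutoff) \<le> card (layer E S 1)" using first by (simp add: s_def)
      then show ?thesis using layer_le[of 1] by linarith
    qed
  next
    case (Suc i)
    then have IH: "s * d ^ i \<le> n / cutoff \<and> lower_bound c s i \<le> card (layer E S i) \<or> c * real n / (64 * cutoff) \<le> card (ball E S i)"
      by simp
    show ?case
    proof (cases "c * real n / (64 * cutoff) \<le> card (ball E S i)")
      case True
      have "card (ball E S i) \<le> card (ball E S (Suc i))"
        by (intro card_mono finite_ball[OF E S(1)] ball_subset_Suc)
      then show ?thesis using True by linarith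
    next
      case False
      have "card (ball E S i) \<le> 2048 * s * d ^ i"
        unfolding s_def using card_ball_le[OF E cg S(1), of i] Suc by simp
      moreover have "\<not> bad_step c S i E" using ok S Suc by (auto simp: steps_ok_def)
      ultimately have "\<not> (s * d ^ Suc i \<le> n / cutoff \<and> card (layer E S (Suc i)) \<le> lower_bound c s (Suc i))"
        "\<not> (n / cutoff < s * d ^ Suc i \<and> card (layer E S (Suc i)) \<le> c * real n / (64 * cutoff))"
        using IH False unfolding bad_step_def s_def[symmetric] by blast+
      then show ?thesis using layer_le[of "Suc i"] by linarith
    qed
  qed
  then show ?thesis
  proof
    assume *: "s * d ^ j \<le> n / cutoff \<and> lower_bound c s j \<le> card (layer E S j)"
    have "c / (64 * cutoff) * min (s * d ^ j) n \<le> c / 8 * (s * d ^ j)"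
      using c s1 d4 by (intro mult_mono) (auto simp: cutoff_def)
    also have "\<dots> \<le> lower_bound c s j" using lower_bound_ge[of c s j] * c s1 j by simp
    finally show ?thesis using * layer_le[of j] by (simp add: s_def)
  next
    assume *: "c * real n / (64 * cutoff) \<le> card (ball E S j)"
    have "c / (64 * cutoff) * min (s * d ^ j) n \<le> c / (64 * cutoff) * n"
      using c by (intro mult_left_mono) (auto simp: cutoff_def)
    then show ?thesis using * by (simp add: s_def)
  qed
qed

end

text \<open>The deterministic interface between the random graph and the game. The size limit
  \<open>2048 * sqrt n\<close> fits the sets to be covered, since balls of radius \<open>r\<close>
  have at most \<open>2048 * d ^ r\<close> vertices. The two radii are the numbers of rounds that
  the two teams have.\<close>

locale good_graph = gnp +
  fixes E :: "nat set set" and r :: nat and c \<delta> :: real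
  assumes E: "E \<subseteq> all_pairs n" and cg: "controlled_growth (Suc r) E" and c: "0 < c"
    and expand: "\<And>S j. S \<subseteq> V - low_degree \<delta> E \<Longrightarrow> S \<noteq> {} \<Longrightarrow> card S \<le> 2048 * sqrt n \<Longrightarrow>
        j \<in> {Suc r, Suc (Suc r)} \<Longrightarrow> c * min (card S * d ^ j) n \<le> card (ball E S j)"
    and low: "card (low_degree \<delta> E) \<le> sqrt n"
    and r: "d ^ r \<le> sqrt n" "sqrt n \<le> d ^ Suc r"
    and dominators: "r = 0 \<Longrightarrow> \<exists>D\<subseteq>V. card D \<le> 5 * sqrt n \<and> (\<forall>v\<in>V. card (nb E {v} - nb E D) \<le> sqrt n + 1)"
    and large: "exp (1 - ln n) * (2048 * sqrt n) \<le> 1" "3 \<le> ln n" "ln (3 * n) \<le> sqrt n"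
      "ln n * (ln (3 * n))\<^sup>2 \<le> 2 * sqrt n"
begin

section \<open>Winning teams in a good graph\<close>

abbreviation "L \<equiv> low_degree \<delta> E"

text \<open>\<open>2 * D / c * sqrt n\<close> with \<open>D = 5000\<close>. Here \<open>D\<close>
  exceeds \<open>2 * 2048 + 1\<close>, so that \<open>exp (- D * sqrt n)\<close> beats the sum over
  all subsets of a set of size \<open>2048 * sqrt n\<close>, with \<open>exp (- sqrt n)\<close> to
  spare for the starting vertices.\<close>

definition team_size :: nat where
  "team_size = nat \<lceil>10000 * sqrt n / c\<rceil>"

lemma team_size: "2 * 5000 * sqrt n \<le> c * team_size" "team_size \<le> 10000 * sqrt n / c + 1"
proof -
  have "0 \<le> 10000 * sqrt n / c" using c by simp
  then have "10000 * sqrt n / c \<le> team_size" "team_size \<le> 10000 * sqrt n / c + 1"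
    unfolding team_size_def by linarith+
  then show "2 * 5000 * sqrt n \<le> c * team_size" "team_size \<le> 10000 * sqrt n / c + 1"
    using c by (simp_all add: field_simps)
qed

lemma sqrt_pos: "1 \<le> sqrt n" using n by simp

lemma ln_3n: "ln (3 * n) \<le> 2 + ln n"
proof -
  have "ln (3::real) \<le> 3 - 1" by (rule ln_le_minus_one) simp
  then show ?thesis using n by (simp add: ln_mult)
qed

text \<open>With expansion \<open>y\<close> at least \<open>ln n / 2\<close> the deficiency can be
  0: \<open>\<theta> = 3 * ln n\<close> is affordable, and then even the failure of one-element sets
  is summable over all starting vertices.\<close>

lemma full_team:
  assumes A: "\<And>v. v \<in> V \<Longrightarrow> A v \<subseteq> V - L" "\<And>v. v \<in> V \<Longrightarrow> card (A v) \<le> 2048 * sqrt n"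
    and j: "j \<in> {Suc r, Suc (Suc r)}" "ln n / 2 * sqrt n \<le> d ^ j"
  obtains C where "length C = team_size" "set C \<subseteq> V" "\<And>v. v \<in> V \<Longrightarrow> can_cover E C (A v) j"
proof -
  define y where "y = d ^ j / sqrt n"
  have y: "ln n / 2 \<le> y" using j(2) sqrt_pos by (simp add: y_def field_simps)
  have y0: "0 \<le> y" using y ln_pos by linarith
  have ys: "y * sqrt n = d ^ j" using sqrt_pos by (simp add: y_def)
  have finA: "finite (A v)" if "v \<in> V" for v
    by (rule finite_subset[of _ V]) (use A(1)[OF that] in auto)
  have k1: "- (3 * ln n) * (real 0 + 1) + exp (1 - 5000 * y + 3 * ln n) * (2048 * sqrt n) \<le> - ln (3 * n)"
  proof -
    have "exp (1 - 5000 * y + 3 * ln n) \<le> exp (1 - ln n)" using y ln_pos by simp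
    then have "exp (1 - 5000 * y + 3 * ln n) * (2048 * sqrt n) \<le> exp (1 - ln n) * (2048 * sqrt n)"
      by (intro mult_right_mono) auto
    then show ?thesis using large(1,2) ln_3n by simp
  qed
  have k2: "2 * (2048 * sqrt n) - 5000 * sqrt n \<le> - ln (3 * n)" using large(3) sqrt_pos by linarith
  have k3: "c * min (card S * (y * sqrt n)) n \<le> card (ball E S j)"
    if "v \<in> V" "S \<subseteq> A v" "S \<noteq> {}" for v S
  proof -
    have "card S \<le> card (A v)" using card_mono[OF finA] that by blast
    then have "card S \<le> 2048 * sqrt n" using A(2)[OF that(1)] by linarith
    then show ?thesis unfolding ys using expand[of S j] A(1)[OF that(1)] that j by blast
  qed
  obtain C U where C: "length C = team_size" "set C \<subseteq> V"
    "\<And>v. v \<in> V \<Longrightarrow> U v \<subseteq> A v" "\<And>v. v \<in> V \<Longrightarrow> card (U v) \<le> 0" "\<And>v. v \<in> V \<Longrightarrow> can_cover E C (A v - U v) j"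
  proof (rule team_exists_of_expansion[where n = n and E = E and A = A and a = "2048 * sqrt n" and c = c and y = y
        and j = j and D = 5000 and k = team_size and \<theta> = "3 * ln n" and u = 0])
    show "A v \<subseteq> {1..n}" if "v \<in> V" for v using A(1)[OF that] by blast
  qed (use n E A(2) team_size(1) c y ln_pos y0 k1 k2 k3 in \<open>auto simp del: atLeastAtMost_iff\<close>)
  have "U v = {}" if "v \<in> V" for v
    using C(3,4)[OF that] finite_subset[OF C(3)[OF that] finA[OF that]] by simp
  then show ?thesis using that[of C] C by fastforce
qed

lemma cop_number_le_length:
  assumes "set C \<subseteq> V" "\<And>v. v \<in> V \<Longrightarrow> cops_win E C v"
  shows "cop_number n E \<le> length C"
  unfolding cop_number_def by (rule Least_le) (use assms in \<open>auto simp: k_cops_win_def\<close>)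

definition low_list :: "nat list" where
  "low_list = sorted_list_of_set L"

lemma low_list: "set low_list = L" "length low_list = card L" "L \<subseteq> V"
proof -
  have "finite L" by (simp add: low_degree_def)
  then show "set low_list = L" "length low_list = card L" by (simp_all add: low_list_def)
qed (auto simp: low_degree_def)

lemma card_ball_r: "v \<in> V \<Longrightarrow> card (ball E {v} r) \<le> 2048 * d ^ r"
  using card_ball_le[OF E cg, of "{v}" r] by simp

lemma card_A_r: "v \<in> V \<Longrightarrow> card (ball E {v} r - L) \<le> 2048 * d ^ r"
proof -
  assume v: "v \<in> V"
  then have "card (ball E {v} r - L) \<le> card (ball E {v} r)"
    by (intro card_mono finite_ball[OF E]) auto
  then show ?thesis using card_ball_r[OF v] by linarith
qed

lemma A_r_subset: "v \<in> V \<Longrightarrow> ball E {v} r - L \<subseteq> V - L"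
  using ball_subset[OF E, of "{v}" r] by auto

lemma cop_number_one_team:
  assumes "ln n / 2 * sqrt n \<le> d ^ Suc r"
  shows "cop_number n E \<le> 10000 * sqrt n / c + 1 + sqrt n"
proof -
  obtain C where C: "length C = team_size" "set C \<subseteq> V"
    "\<And>v. v \<in> V \<Longrightarrow> can_cover E C (ball E {v} r - L) (Suc r)"
  proof (rule full_team[of "\<lambda>v. ball E {v} r - L" "Suc r"])
    show "card (ball E {v} r - L) \<le> 2048 * sqrt n" if "v \<in> V" for v
      using card_A_r[OF that] r(1) by linarith
  qed (use assms A_r_subset in auto)
  have "cop_number n E \<le> length (C @ [] @ low_list)"
  proof (rule cop_number_le_length)
    fix v assume "v \<in> V"
    \<comment> \<open>No vertex is exceptional, so the second team is the empty list and
      \<open>U = {}\<close>.\<close>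
    from C(3)[OF this] show "cops_win E (C @ [] @ low_list) v"
      using can_cover_static[of E "[]" "Suc (Suc r)"]
      by (rule cops_win_two_teams[where U = "{}"]) (auto simp: low_list nb_def)
  qed (use C low_list in auto)
  then show ?thesis using C(1) team_size(2) low low_list by simp
qed

text \<open>The first team leaves at most \<open>sqrt n / d\<close> vertices of the ball of radius \<open>r\<close> uncovered, and
  the second team takes care of their neighbours one round later.\<close>

lemma cop_number_two_teams:
  assumes small: "d ^ Suc r < ln n / 2 * sqrt n" and r1: "1 \<le> r"
  shows "cop_number n E \<le> 2 * (10000 * sqrt n / c + 1) + sqrt n"
proof -
  define x where "x = d ^ Suc r / sqrt n"
  define w where "w = sqrt n / d"
  define u where "u = nat \<lfloor>w\<rfloor>"
  have x1: "1 \<le> x" using r(2) sqrt_pos by (simp add: x_def)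
  have xs: "x * sqrt n = d ^ Suc r" using sqrt_pos by (simp add: x_def)
  have w0: "0 < w" using sqrt_pos d4 by (simp add: w_def)
  \<comment> \<open>The ball exceeds the allowance \<open>w\<close> by a factor of order
    \<open>x\<close> only, which \<open>exp (- 5000 * x)\<close> absorbs in
    \<open>c1\<close>.\<close>
  have wx: "w * x = d ^ r" using sqrt_pos d4 by (simp add: w_def x_def)
  have u: "real u \<le> w" "w \<le> real u + 1" unfolding u_def using w0 by linarith+
  \<comment> \<open>The allowance has to pay for the union bound over starting vertices. This is
    where \<open>r \<ge> 1\<close> enters: \<open>d^2 \<le> d ^ Suc r < ln n / 2 * sqrt n\<close>
    keeps \<open>w^2\<close> above \<open>2 * sqrt n / ln n\<close>.\<close>
  have wl: "ln (3 * n) \<le> w"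
  proof (rule power2_le_imp_le)
    have "d\<^sup>2 \<le> d ^ Suc r" using r1 d4 by (intro power_increasing) auto
    then have d2: "d\<^sup>2 \<le> ln n / 2 * sqrt n" using small by linarith
    have "(ln (3 * n))\<^sup>2 * d\<^sup>2 \<le> (ln (3 * n))\<^sup>2 * (ln n / 2 * sqrt n)"
      using d2 by (intro mult_left_mono) auto
    also have "\<dots> = (ln n * (ln (3 * n))\<^sup>2) / 2 * sqrt n" by simp
    also have "\<dots> \<le> sqrt n * sqrt n" using large(4) by (intro mult_right_mono) auto
    finally show "(ln (3 * n))\<^sup>2 \<le> w\<^sup>2"
      using d4 by (simp add: w_def power_divide field_simps)
  qed (use w0 in simp)
  have finA: "finite (ball E {v} r - L)" if "v \<in> V" for v
    using finite_ball[OF E, of "{v}" r] that by simp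
  have c1: "- 3 * (real u + 1) + exp (1 - 5000 * x + 3) * (2048 * d ^ r) \<le> - ln (3 * n)"
  proof -
    have "2048 = (2 :: real) ^ 11" by simp
    also have "\<dots> \<le> exp 1 ^ 11" using exp_ge_add_one_self[of "1::real"] by (intro power_mono) auto
    also have "\<dots> = exp (11 :: real)" by (simp add: exp_of_nat_mult[symmetric])
    finally have e: "(2048 :: real) \<le> exp 11" .
    have "x \<le> exp x" using exp_ge_add_one_self[of x] by linarith
    then have "exp (1 - 5000 * x + 3) * (2048 * x) \<le> exp (1 - 5000 * x + 3) * (exp 11 * exp x)"
      using e x1 by (intro mult_left_mono mult_mono) auto
    also have "\<dots> = exp (15 - 4999 * x)" by (simp add: exp_add[symmetric])
    also have "\<dots> \<le> 1" using x1 by simp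
    finally have "exp (1 - 5000 * x + 3) * (2048 * x) * w \<le> 1 * w" using w0 by (intro mult_right_mono) auto
    then have "exp (1 - 5000 * x + 3) * (2048 * d ^ r) \<le> w" by (simp add: wx[symmetric] mult_ac)
    moreover have "- 3 * (real u + 1) \<le> - 3 * w" using u by simp
    ultimately show ?thesis using wl w0 by linarith
  qed
  have c2: "2 * (2048 * d ^ r) - 5000 * sqrt n \<le> - ln (3 * n)" using large(3) r(1) sqrt_pos by linarith
  have c3: "c * min (card S * (x * sqrt n)) n \<le> card (ball E S (Suc r))"
    if "v \<in> V" "S \<subseteq> ball E {v} r - L" "S \<noteq> {}" for v S
  proof -
    have "card S \<le> card (ball E {v} r - L)" using card_mono[OF finA] that by blast
    then have "card S \<le> 2048 * sqrt n" using card_A_r[OF that(1)] r(1) by linarith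
    then show ?thesis unfolding xs using expand[of S "Suc r"] A_r_subset[OF that(1)] that by blast
  qed
  obtain C1 U where C1: "length C1 = team_size" "set C1 \<subseteq> V" "\<And>v. v \<in> V \<Longrightarrow> U v \<subseteq> ball E {v} r - L"
    "\<And>v. v \<in> V \<Longrightarrow> card (U v) \<le> u" "\<And>v. v \<in> V \<Longrightarrow> can_cover E C1 (ball E {v} r - L - U v) (Suc r)"
  proof (rule team_exists_of_expansion[where n = n and E = E and A = "\<lambda>v. ball E {v} r - L"
        and a = "2048 * d ^ r" and c = c and y = x
        and j = "Suc r" and D = 5000 and k = team_size and \<theta> = 3 and u = u])
    show "ball E {v} r - L \<subseteq> {1..n}" if "v \<in> V" for v using A_r_subset[OF that] by blast
  qed (use n E team_size(1) c x1 c1 c2 c3 card_A_r in \<open>auto simp del: atLeastAtMost_iff\<close>)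
  have UV: "U v \<subseteq> V" if "v \<in> V" for v using C1(3)[OF that] A_r_subset[OF that] by blast
  obtain C2 where C2: "length C2 = team_size" "set C2 \<subseteq> V"
    "\<And>v. v \<in> V \<Longrightarrow> can_cover E C2 (nb E (U v) - L) (Suc (Suc r))"
  proof (rule full_team[of "\<lambda>v. nb E (U v) - L" "Suc (Suc r)"])
    fix v assume v: "v \<in> V"
    show "nb E (U v) - L \<subseteq> V - L" using nb_subset[OF E UV[OF v]] by blast
    have "card (nb E (U v) - L) \<le> card (nb E (U v))"
      by (rule card_mono) (use finite_ball[OF E UV[OF v], of 1] in auto)
    also have "real (card (nb E (U v))) \<le> 2048 * card (U v) * d"
      using card_ball_le[OF E cg UV[OF v], of 1] by simp
    \<comment> \<open>The allowance \<open>sqrt n / d\<close> is chosen for this: it keeps the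
      neighbourhood of the exceptional vertices at O(sqrt n).\<close>
    also have "\<dots> \<le> 2048 * w * d" using C1(4)[OF v] u d4 by (intro mult_right_mono mult_left_mono) auto
    also have "\<dots> = 2048 * sqrt n" using d4 by (simp add: w_def)
    finally show "card (nb E (U v) - L) \<le> 2048 * sqrt n" by simp
  next
    \<comment> \<open>One more round multiplies the expansion by \<open>d \<ge> ln n / 2\<close>, so
      the second team leaves no exceptions.\<close>
    have "ln n / 2 * sqrt n \<le> d * d ^ Suc r" using ln_le r(2) ln_pos sqrt_pos d4 by (intro mult_mono) auto
    then show "ln n / 2 * sqrt n \<le> d ^ Suc (Suc r)" by simp
  qed (simp, blast)
  have "cop_number n E \<le> length (C1 @ C2 @ low_list)"
  proof (rule cop_number_le_length)
    fix v assume "v \<in> V"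
    from C1(5)[OF this] C2(3)[OF this] show "cops_win E (C1 @ C2 @ low_list) v"
      by (rule cops_win_two_teams[where U = "U v"]) (auto simp: low_list)
  qed (use C1 C2 low_list in auto)
  then show ?thesis using C1(1) C2(1) team_size(2) low low_list by simp
qed

text \<open>Here \<open>d \<ge> sqrt n\<close>, so an allowance of \<open>sqrt n / d \<le> 1\<close>
  exceptional vertices could not pay for the union bound over starting vertices. Instead the robber
  is granted one move: all but about \<open>sqrt n\<close> of its possible ends are dominated, and a
  team with two rounds takes the rest.\<close>

lemma cop_number_dominators:
  assumes "r = 0"
  shows "cop_number n E \<le> 10000 * sqrt n / c + 1 + 6 * sqrt n"
proof -
  obtain D where D: "D \<subseteq> V" "card D \<le> 5 * sqrt n" "\<And>v. v \<in> V \<Longrightarrow> card (nb E {v} - nb E D) \<le> sqrt n + 1"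
    using dominators[OF assms] by blast
  have finD: "finite D" using D(1) by (rule finite_subset) simp
  define DL where "DL = sorted_list_of_set D"
  have DL: "set DL = D" "length DL = card D" using finD by (simp_all add: DL_def)
  obtain C where C: "length C = team_size" "set C \<subseteq> V"
    "\<And>v. v \<in> V \<Longrightarrow> can_cover E C (nb E {v} - nb E D - L) (Suc (Suc r))"
  proof (rule full_team[of "\<lambda>v. nb E {v} - nb E D - L" "Suc (Suc r)"])
    fix v assume v: "v \<in> V"
    show "nb E {v} - nb E D - L \<subseteq> V - L" using nb_subset[OF E, of "{v}"] v by blast
    have "card (nb E {v} - nb E D - L) \<le> card (nb E {v} - nb E D)"
      by (rule card_mono) (use finite_ball[OF E, of "{v}" 1] v in auto)
    then show "card (nb E {v} - nb E D - L) \<le> 2048 * sqrt n" using D(3)[OF v] sqrt_pos by linarith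
  next
    have "ln n / 2 * sqrt n \<le> d * d ^ Suc r" using ln_le r(2) ln_pos sqrt_pos d4 by (intro mult_mono) auto
    then show "ln n / 2 * sqrt n \<le> d ^ Suc (Suc r)" by simp
  qed (simp, blast)
  have "cop_number n E \<le> length (C @ DL @ low_list)"
  proof (rule cop_number_le_length)
    fix v assume "v \<in> V"
    from C(3)[OF this] have "can_cover E C (nb E {v} - nb E D - L) 2" by (simp add: assms numeral_2_eq_2)
    then show "cops_win E (C @ DL @ low_list) v"
      by (rule cops_win_dominators) (auto simp: low_list DL nb_def)
  qed (use C low_list D DL in auto)
  then show ?thesis using C(1) team_size(2) low low_list D DL by simp
qed

theorem cop_number_le: "cop_number n E \<le> (20000 / c + 10) * sqrt n"
proof -
  have "cop_number n E \<le> 2 * (10000 * sqrt n / c + 1) + 6 * sqrt n"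
  proof -
    define t where "t = sqrt n"
    define q where "q = 10000 * t / c"
    have nn: "0 \<le> q" "1 \<le> t" using c n by (simp_all add: q_def t_def)
    consider "r = 0" | "ln n / 2 * sqrt n \<le> d ^ Suc r" | "d ^ Suc r < ln n / 2 * sqrt n" "1 \<le> r" by linarith
    then show ?thesis
    proof cases
      case 1
      show ?thesis using cop_number_dominators[OF 1] nn unfolding t_def[symmetric] q_def[symmetric] by argo
    next
      case 2
      show ?thesis using cop_number_one_team[OF 2] nn unfolding t_def[symmetric] q_def[symmetric] by argo
    next
      case 3
      show ?thesis using cop_number_two_teams[OF 3] nn unfolding t_def[symmetric] q_def[symmetric] by argo
    qed
  qed
  also have "\<dots> = 20000 / c * sqrt n + 2 + 6 * sqrt n" by simp
  also have "\<dots> \<le> (20000 / c + 10) * sqrt n" using sqrt_pos unfolding distrib_right by argo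
  finally show ?thesis .
qed

end

section \<open>Almost all graphs are good\<close>

context gnp
begin

definition sphere_radius :: nat where
  "sphere_radius = (LEAST r. sqrt n \<le> d ^ Suc r)"

lemma sphere_radius: "d ^ sphere_radius \<le> sqrt n" "sqrt n \<le> d ^ Suc sphere_radius" "sphere_radius < n"
proof -
  obtain k where "sqrt n < d ^ k" using real_arch_pow[of d "sqrt n"] d4 by auto
  moreover have "d ^ k \<le> d ^ Suc k" using d4 by (intro power_increasing) auto
  ultimately have "sqrt n \<le> d ^ Suc k" by linarith
  then show "sqrt n \<le> d ^ Suc sphere_radius"
    unfolding sphere_radius_def by (rule LeastI)
  show le: "d ^ sphere_radius \<le> sqrt n"
  proof (cases sphere_radius)
    case 0
    then show ?thesis using n by simp
  next
    case (Suc r)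
    then have "r < (LEAST r. sqrt n \<le> d ^ Suc r)" by (simp add: sphere_radius_def)
    then have "\<not> sqrt n \<le> d ^ Suc r" by (rule not_less_Least)
    then show ?thesis using Suc by simp
  qed
  have "real sphere_radius < 2 ^ sphere_radius" by (rule of_nat_less_two_power)
  also have "\<dots> \<le> d ^ sphere_radius" using d4 by (intro power_mono) auto
  also have "\<dots> \<le> sqrt n" by (rule le)
  also have "\<dots> \<le> n" using n by (simp add: real_le_lsqrt self_le_power)
  finally show "sphere_radius < n" by simp
qed

definition first_layers_ok :: "real \<Rightarrow> nat set set \<Rightarrow> bool" where
  "first_layers_ok \<delta> E \<longleftrightarrow> (\<forall>S. S \<subseteq> V - low_degree \<delta> E \<and> S \<noteq> {} \<and> real (card S) \<le> 2048 * sqrt n \<longrightarrow>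
     \<delta> / 32 * min (card S * d) n \<le> card (layer E S (Suc 0)))"

text \<open>Split at \<open>d = 128 * ln n\<close>. Above it the first layer concentrates for every
  set; below it \<open>p\<close> is small enough for local sparsity, and the degree condition then
  forces expansion.\<close>

lemma prob_not_first_layers_ok:
  assumes delta: "0 < \<delta>" "\<delta> \<le> 1"
    and large: "64 \<le> \<delta> * ln n" "128 * (2048 * sqrt n) * ln n \<le> n" "2 * (2048 * sqrt n) \<le> n"
      "n powr (1/4) * (256 * ln n / n) * n powr (2/3) \<le> 1" "2 * (2048 * sqrt n * (128 * ln n)) \<le> n powr (2/3)"
      "2 \<le> ln n"
  shows "prob (all_pairs n) p (\<lambda>E. \<not> first_layers_ok \<delta> E) \<le> exp (1 - ln n / 2)"
proof (cases "128 * ln n \<le> d")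
  case True
  have "prob (all_pairs n) p (\<lambda>E. \<not> first_layers_ok \<delta> E)
     \<le> prob (all_pairs n) p (\<lambda>E. \<exists>S. S \<subseteq> V \<and> S \<noteq> {} \<and> real (card S) \<le> 2048 * sqrt n \<and>
          card (layer E S (Suc 0)) \<le> min (card S * d) n / 8)"
  proof (rule prob_mono[OF p])
    fix E assume "\<not> first_layers_ok \<delta> E"
    then obtain S where S: "S \<subseteq> V - low_degree \<delta> E" "S \<noteq> {}" "real (card S) \<le> 2048 * sqrt n"
      "\<not> \<delta> / 32 * min (card S * d) n \<le> card (layer E S (Suc 0))" unfolding first_layers_ok_def by blast
    have "\<delta> / 32 * min (card S * d) n \<le> 1 / 8 * min (card S * d) n"
      using delta d4 by (intro mult_right_mono) auto
    then have "card (layer E S (Suc 0)) \<le> min (card S * d) n / 8" using S(4) by simp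
    then show "\<exists>S. S \<subseteq> V \<and> S \<noteq> {} \<and> real (card S) \<le> 2048 * sqrt n \<and>
          card (layer E S (Suc 0)) \<le> min (card S * d) n / 8" using S by blast
  qed
  also have "\<dots> \<le> exp (1 - 2 * ln n)"
  proof (rule prob_union_subsets)
    fix S assume S: "S \<subseteq> V" "S \<noteq> {}" "real (card S) \<le> 2048 * sqrt n"
    have "128 * real (card S) * ln n \<le> 128 * (2048 * sqrt n) * ln n"
      using S ln_pos by (intro mult_right_mono mult_left_mono) auto
    then show "prob (all_pairs n) p (\<lambda>E. card (layer E S (Suc 0)) \<le> min (card S * d) n / 8)
        \<le> exp (- 4 * real (card S) * ln n)"
      using S large by (intro first_layer_dense[OF S(1,2) refl True]) linarith+
  qed
  also have "\<dots> \<le> exp (1 - ln n / 2)" using ln_pos by simp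
  finally show ?thesis .
next
  case False
  have "prob (all_pairs n) p (\<lambda>E. \<not> first_layers_ok \<delta> E) \<le> prob (all_pairs n) p (\<lambda>E. \<not> locally_sparse E)"
  proof (rule prob_mono[OF p], rule notI)
    fix E assume E: "E \<subseteq> all_pairs n" "\<not> first_layers_ok \<delta> E" and ls: "locally_sparse E"
    from E(2) obtain S where S: "S \<subseteq> V - low_degree \<delta> E" "S \<noteq> {}" "real (card S) \<le> 2048 * sqrt n"
      "\<not> \<delta> / 32 * min (card S * d) n \<le> card (layer E S (Suc 0))" unfolding first_layers_ok_def by blast
    have "\<delta> / 32 * card S * d \<le> card (layer E S (Suc 0))"
    proof (rule first_layer_sparse[OF E(1) ls S(1,2) refl])
      have "\<delta> * ln n \<le> \<delta> * (2 * d)" using ln_le delta by (intro mult_left_mono) auto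
      then show "1 \<le> \<delta> / 32 * d" using large(1) by simp
      have "\<delta> / 32 * card S * d \<le> 1 * (2048 * sqrt n) * (128 * ln n)"
        using delta S(3) False d4 by (intro mult_mono) auto
      then have "\<delta> / 32 * card S * d \<le> 2048 * sqrt n * (128 * ln n)" by (simp only: mult_1_left)
      then show "2 * (\<delta> / 32 * card S * d) \<le> n powr (2/3)" using large(5) by argo
    qed
    moreover have "\<delta> / 32 * min (card S * d) n \<le> \<delta> / 32 * (card S * d)"
      using delta by (intro mult_left_mono) auto
    ultimately show False using S(4) by simp
  qed
  also have "\<dots> \<le> exp (1 - ln n / 2)"
  proof (rule prob_not_locally_sparse[OF _ large(6)])
    have "2 * d / n \<le> 256 * ln n / n" using False by (intro divide_right_mono) auto
    then have "p \<le> 256 * ln n / n" using p_le by linarith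
    then have "n powr (1/4) * p * n powr (2/3) \<le> n powr (1/4) * (256 * ln n / n) * n powr (2/3)"
      by (intro mult_right_mono mult_left_mono) auto
    then show "n powr (1/4) * p * n powr (2/3) \<le> 1" using large(4) by linarith
  qed
  finally show ?thesis .
qed

lemma prob_cop_number_large:
  fixes \<delta> l e :: real
  assumes delta: "0 < \<delta>" "\<delta> \<le> 1"
    and l: "0 \<le> l" "l * \<delta> - (1 - exp (- l)) \<le> - (1 - e / 2)"
    and e: "0 < e" "e \<le> 1 / 2" "(1 / 2 + e) * ln n \<le> d"
    and large: "64 \<le> \<delta> * ln n" "128 * (2048 * sqrt n) * ln n \<le> n" "2 * (2048 * sqrt n) \<le> n"
      "n powr (1/4) * (256 * ln n / n) * n powr (2/3) \<le> 1" "2 * (2048 * sqrt n * (128 * ln n)) \<le> n powr (2/3)"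
      "32768 \<le> \<delta> / 32 * ln n" "4 * (2048 * sqrt n) * ln n \<le> \<delta> / 32 * n / (256 * cutoff)"
      "exp (1 - ln n) * (2048 * sqrt n) \<le> 1" "3 \<le> ln n" "ln (3 * n) \<le> sqrt n"
      "ln n * (ln (3 * n))\<^sup>2 \<le> 2 * sqrt n"
  shows "prob (all_pairs n) p (\<lambda>E. \<not> cop_number n E \<le> (20000 / (\<delta> / 32 / (64 * cutoff)) + 10) * sqrt n)
    \<le> 2 * exp (- 2 * ln n) + exp (1 - ln n) + exp (- (e * ln n / 2)) + exp (1 - ln n / 2) + n * exp (- (sqrt n / 2))"
proof -
  define r where "r = sphere_radius"
  define c where "c = \<delta> / 32"
  \<comment> \<open>The dominators may not depend on the graph; any fixed set of this size serves,
    and an initial segment is convenient.\<close>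
  define D where "D = {1..nat \<lceil>4 * sqrt n\<rceil>}"
  let ?\<Omega> = "all_pairs n"
  let ?B1 = "\<lambda>E. \<not> controlled_growth (Suc r) E"
  let ?B2 = "\<lambda>E. \<not> steps_ok c (2048 * sqrt n) (Suc r) E"
  let ?B3 = "\<lambda>E. sqrt n < card (low_degree \<delta> E)"
  let ?B4 = "\<lambda>E. \<not> first_layers_ok \<delta> E"
  let ?B5 = "\<lambda>E. r = 0 \<and> (\<exists>v\<in>V. sqrt n + 1 < card (nb E {v} - nb E D))"
  note r = sphere_radius[folded r_def]
  have c: "0 < c" "c \<le> 1" using delta by (auto simp: c_def)
  have sq: "1 \<le> sqrt n" using n by simp
  have cD: "4 * sqrt n \<le> card D" "card D \<le> 5 * sqrt n" "D \<subseteq> V"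
  proof -
    define k where "k = nat \<lceil>4 * sqrt n\<rceil>"
    have "0 \<le> 4 * sqrt n" by simp
    then have k: "4 * sqrt n \<le> k" "k \<le> 4 * sqrt n + 1" unfolding k_def by linarith+
    have k5: "k \<le> 5 * sqrt n" using k(2) sq by argo
    have "real k \<le> n" using k5 large(3) sq by argo
    then show "4 * sqrt n \<le> card D" "card D \<le> 5 * sqrt n" "D \<subseteq> V"
      using k(1) k5 unfolding D_def k_def[symmetric] by auto
  qed
  have "prob ?\<Omega> p (\<lambda>E. \<not> cop_number n E \<le> (20000 / (\<delta> / 32 / (64 * cutoff)) + 10) * sqrt n)
      \<le> prob ?\<Omega> p (\<lambda>E. (((?B1 E \<or> ?B2 E) \<or> ?B3 E) \<or> ?B4 E) \<or> ?B5 E)"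
  proof (rule prob_mono[OF p], rule ccontr)
    fix E assume bad: "E \<subseteq> ?\<Omega>" "\<not> cop_number n E \<le> (20000 / (\<delta> / 32 / (64 * cutoff)) + 10) * sqrt n"
      and "\<not> ((((?B1 E \<or> ?B2 E) \<or> ?B3 E) \<or> ?B4 E) \<or> ?B5 E)"
    then have g: "controlled_growth (Suc r) E" "steps_ok c (2048 * sqrt n) (Suc r) E"
      "card (low_degree \<delta> E) \<le> sqrt n" "first_layers_ok \<delta> E"
      "r = 0 \<Longrightarrow> \<forall>v\<in>V. card (nb E {v} - nb E D) \<le> sqrt n + 1" by (auto simp: not_less)
    interpret good_graph n p d E r "c / (64 * cutoff)" \<delta>
    proof
      show "0 < c / (64 * cutoff)" using c by (simp add: cutoff_def)
      show "c / (64 * cutoff) * min (card S * d ^ j) n \<le> card (ball E S j)"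
        if "S \<subseteq> V - low_degree \<delta> E" "S \<noteq> {}" "card S \<le> 2048 * sqrt n" "j \<in> {Suc r, Suc (Suc r)}" for S j
      proof (rule card_ball_ge[OF bad(1) g(1,2) _ that(2,3) c])
        show "c * min (card S * d) n \<le> card (layer E S (Suc 0))"
          using g(4) that unfolding first_layers_ok_def c_def by blast
      qed (use that in auto)
      show "\<exists>D\<subseteq>V. card D \<le> 5 * sqrt n \<and> (\<forall>v\<in>V. card (nb E {v} - nb E D) \<le> sqrt n + 1)" if "r = 0"
        using cD g(5)[OF that] by blast
    qed (use bad g r large in auto)
    show False using cop_number_le bad(2) by (simp add: c_def)
  qed
  also have "\<dots> \<le> prob ?\<Omega> p ?B1 + prob ?\<Omega> p ?B2 + prob ?\<Omega> p ?B3 + prob ?\<Omega> p ?B4 + prob ?\<Omega> p ?B5"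
    by (intro order_trans[OF prob_disj_le[OF p]] add_mono order_refl)
  also have "\<dots> \<le> 2 * exp (- 2 * ln n) + exp (1 - ln n) + exp (- (e * ln n / 2)) + exp (1 - ln n / 2) + n * exp (- (sqrt n / 2))"
  proof (intro add_mono)
    have n_exp: "real n = exp (ln n)" using n by simp
    have "prob ?\<Omega> p ?B1 \<le> n * (Suc r + 1) * exp (- 4 * ln n)" by (rule prob_not_controlled_growth)
    also have "\<dots> \<le> n * (2 * n) * exp (- 4 * ln n)"
      using r(3) n by (intro mult_right_mono of_nat_mono mult_left_mono) auto
    also have "\<dots> = 2 * (exp (ln n) * exp (ln n) * exp (- 4 * ln n))"
      unfolding n_exp[symmetric] by simp
    also have "\<dots> = 2 * exp (- 2 * ln n)" by (simp only: exp_add[symmetric]) simp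
    finally show "prob ?\<Omega> p ?B1 \<le> 2 * exp (- 2 * ln n)" .
    have "prob ?\<Omega> p ?B2 \<le> Suc r * exp (1 - 2 * ln n)"
      by (rule prob_not_steps_ok[OF c]) (use large in \<open>auto simp: c_def\<close>)
    also have "\<dots> \<le> n * exp (1 - 2 * ln n)" using r(3) by (intro mult_right_mono of_nat_mono) auto
    also have "\<dots> = exp (ln n) * exp (1 - 2 * ln n)" unfolding n_exp[symmetric] by simp
    also have "\<dots> = exp (1 - ln n)" by (simp only: exp_add[symmetric]) simp
    finally show "prob ?\<Omega> p ?B2 \<le> exp (1 - ln n)" .
    have "prob ?\<Omega> p ?B3 \<le> sqrt n * exp ((l * \<delta> - (1 - exp (- l))) * d)"
      by (rule prob_many_low_degree[OF l(1)])
    also have "\<dots> \<le> sqrt n * exp (- (1 - e / 2) * d)"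
      using l(2) d4 by (intro mult_left_mono) (auto intro!: mult_right_mono)
    also have "\<dots> \<le> sqrt n * exp (- (1 - e / 2) * ((1 / 2 + e) * ln n))"
      using e by (intro mult_left_mono) (auto intro!: mult_left_mono_neg simp: )
    also have "\<dots> = exp (ln n / 2) * exp (- (1 - e / 2) * ((1 / 2 + e) * ln n))"
      using n by (simp add: ln_sqrt[symmetric])
    also have "\<dots> = exp ((1 / 2 - (1 - e / 2) * (1 / 2 + e)) * ln n)"
      by (simp only: exp_add[symmetric]) (simp add: field_simps)
    \<comment> \<open>\<open>(1 - e / 2) * (1/2 + e) = 1/2 + 3 * e / 4 - e^2 / 2\<close>, at least
      \<open>1/2 + e / 2\<close> because \<open>e \<le> 1/2\<close>; hence the cap on
      \<open>e\<close>.\<close>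
    also have "\<dots> \<le> exp (- (e / 2) * ln n)"
    proof -
      have "e * e \<le> e * (1 / 2)" using e by (intro mult_left_mono) auto
      then have "1 / 2 - (1 - e / 2) * (1 / 2 + e) \<le> - (e / 2)" by (simp add: algebra_simps)
      from mult_right_mono[OF this, of "ln n"] show ?thesis using ln_pos by simp
    qed
    finally show "prob ?\<Omega> p ?B3 \<le> exp (- (e * ln n / 2))" by simp
    show "prob ?\<Omega> p ?B4 \<le> exp (1 - ln n / 2)"
      by (rule prob_not_first_layers_ok[OF delta]) (use large in auto)
    show "prob ?\<Omega> p ?B5 \<le> n * exp (- (sqrt n / 2))"
    proof (cases "r = 0")
      case True
      then have "sqrt n \<le> d" using r(2) by simp
      then show ?thesis using prob_many_undominated[OF cD(3,1)] True by simp
    qed simp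
  qed
  finally show ?thesis .
qed

end

theorem theorem1p2:
  fixes \<epsilon> :: real and p :: "nat \<Rightarrow> real"
  assumes "\<epsilon> > 0"
    and "\<And>n. 0 \<le> p n \<and> p n \<le> 1"
    and "eventually (\<lambda>n. p n * (real n - 1) \<ge> (1/2 + \<epsilon>) * ln (real n)) sequentially"
  shows "\<exists>K::real. (\<lambda>n. gnp_prob n (p n)
            (\<lambda>E. real (cop_number n E) \<le> K * sqrt (real n))) \<longlonglongrightarrow> 1"
proof -
  define e where "e = min \<epsilon> (1/2)"
  \<comment> \<open>\<open>exp (- l)\<close> and \<open>l * \<delta>\<close> both become
    \<open>e / 4\<close>, so the exponent of the low-degree count loses \<open>e / 2\<close> in
    all.\<close>
  define l where "l = ln (4 / e)"
  define \<delta> where "\<delta> = e / (4 * l)"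
  define M where "M = 20000 / (\<delta> / 32 / (64 * cutoff)) + 10"
  define err where "err n = 2 * exp (- 2 * ln (real n)) + exp (1 - ln n) + exp (- (e * ln n / 2))
      + exp (1 - ln n / 2) + n * exp (- (sqrt n / 2))" for n :: nat
  have e: "0 < e" "e \<le> 1/2" using assms(1) by (auto simp: e_def)
  have "ln (exp 1) \<le> ln (4 / e)"
  proof (rule ln_mono)
    have "exp 1 \<le> (3 :: real)" by (rule exp_le)
    also have "3 \<le> 4 / e" using e by (simp add: field_simps)
    finally show "exp 1 \<le> 4 / e" .
  qed (use e in auto)
  then have l: "1 \<le> l" by (simp add: l_def)
  have delta: "0 < \<delta>" "\<delta> \<le> 1" using e l by (auto simp: \<delta>_def field_simps)
  have el: "exp (- l) = e / 4" using e by (simp add: l_def exp_minus)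
  have "l * \<delta> = e / 4" using l by (simp add: \<delta>_def)
  then have ld: "l * \<delta> - (1 - exp (- l)) \<le> - (1 - e / 2)" by (simp add: el)
  \<comment> \<open>\<open>ln n \<ge> 8\<close> gives \<open>d \<ge> 4\<close>, because
    \<open>ln n \<le> 2 * d\<close>.\<close>
  have ev: "eventually (\<lambda>n. 8 \<le> ln (real n)) sequentially"
    "eventually (\<lambda>n. 64 \<le> \<delta> * ln (real n)) sequentially"
    "eventually (\<lambda>n. 128 * (2048 * sqrt (real n)) * ln n \<le> n) sequentially"
    "eventually (\<lambda>n. 2 * (2048 * sqrt (real n)) \<le> n) sequentially"
    "eventually (\<lambda>n. real n powr (1/4) * (256 * ln n / n) * n powr (2/3) \<le> 1) sequentially"
    "eventually (\<lambda>n. 2 * (2048 * sqrt (real n) * (128 * ln n)) \<le> n powr (2/3)) sequentially"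
    "eventually (\<lambda>n. 32768 \<le> \<delta> / 32 * ln (real n)) sequentially"
    "eventually (\<lambda>n. 4 * (2048 * sqrt (real n)) * ln n \<le> \<delta> / 32 * n / (256 * cutoff)) sequentially"
    "eventually (\<lambda>n. exp (1 - ln (real n)) * (2048 * sqrt n) \<le> 1) sequentially"
    "eventually (\<lambda>n. ln (3 * real n) \<le> sqrt n) sequentially"
    "eventually (\<lambda>n. ln (real n) * (ln (3 * real n))\<^sup>2 \<le> 2 * sqrt n) sequentially"
    using delta unfolding cutoff_def by real_asymp+
  have lower: "eventually (\<lambda>n. 1 - err n \<le> gnp_prob n (p n) (\<lambda>E. real (cop_number n E) \<le> M * sqrt (real n))) sequentially"
    using ev assms(3) eventually_ge_at_top[of 2]
  proof eventually_elim
    case (elim n)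
    define d where "d = p n * (real n - 1)"
    have dl: "(1/2 + e) * ln n \<le> d"
    proof -
      have "(1/2 + e) * ln n \<le> (1/2 + \<epsilon>) * ln n" using elim(1) by (intro mult_right_mono) (auto simp: e_def)
      then show ?thesis using elim(12) by (simp add: d_def)
    qed
    have "1/2 * ln n \<le> (1/2 + e) * ln n" using e elim(1) by (intro mult_right_mono) auto
    then have d2: "ln n \<le> 2 * d" using dl by linarith
    interpret gnp n "p n" d
      by standard (use assms(2) elim(13) elim(1) d2 in \<open>auto simp: d_def\<close>)
    have e10: "ln (real (3 * n)) \<le> sqrt n" and e11: "ln n * (ln (real (3 * n)))\<^sup>2 \<le> 2 * sqrt n"
      using elim(10,11) by simp_all
    have "prob (all_pairs n) (p n) (\<lambda>E. \<not> cop_number n E \<le> M * sqrt n) \<le> err n"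
      unfolding M_def err_def
      by (rule prob_cop_number_large[OF delta _ ld e dl elim(2-9) _ e10 e11])
        (use l elim(1) in auto)
    then show ?case
      unfolding gnp_prob_eq_prob
      using prob_compl[OF finite_all_pairs, of n "p n" "\<lambda>E. cop_number n E \<le> M * sqrt n"] by linarith
  qed
  have upper: "gnp_prob n (p n) (\<lambda>E. real (cop_number n E) \<le> M * sqrt (real n)) \<le> 1" for n
    using assms(2)[of n] unfolding gnp_prob_eq_prob by (intro prob_le_1) auto
  have lim: "(\<lambda>n. 1 - err n) \<longlonglongrightarrow> 1"
    unfolding err_def using e by real_asymp
  have "(\<lambda>n. gnp_prob n (p n) (\<lambda>E. real (cop_number n E) \<le> M * sqrt (real n))) \<longlonglongrightarrow> 1"
    by (rule tendsto_sandwich[OF lower always_eventually[OF allI[OF upper]] lim tendsto_const])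
  then show ?thesis by blast
qed

end
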